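(* Let $\theta(z,w)$ be a rational inner function on $\mathbb{D}^2$ without (nonconstant) inner factors depending only on the variable $z$, let $\mathcal{K}_\theta=H^2(\mathbb{D}^2)\ominus\theta H^2(\mathbb{D}^2)$ and let $S_z=P_{\mathcal{K}_\theta}T_z|_{\mathcal{K}_\theta}$. Let $$\Omega=\sigma(S_z)\setminus\sigma_e(S_z)=\bigcup_i\Omega_i,$$ where the $\Omega_i$, $i=1,\dots,N$, are the connected components of $\Omega$. Then $S_z^*$ belongs to $\mathfrak{B}_\alpha(\Omega^* )$, where $\alpha_i$ is the number of zeros of $\theta(\lambda,\cdot)$ in $\mathbb{D}$ for $\lambda\in\Omega_i$ ($\alpha_i$ being attached to the component $\Omega_i^*$ of $\Omega^*$).
   Context: $H^2(\mathbb{D}^2)$ is the Hardy space over the bidisk, with coordinates $(z,w)$; $T_z$ is multiplication by $z$; $P_{\mathcal{K}}$ is the orthogonal projection onto $\mathcal{K}$. An inner function on $\mathbb{D}^2$ is $\theta\in H^2(\mathbb{D}^2)$ with $|\theta|=1$ a.e. on $\mathbb{T}^2$; it is rational inner if it is also a rational function. $\sigma$ denotes the spectrum and $\sigma_e(T)$ the set of $\lambda$ for which $T-\lambda$ is not Fredholm. $\Omega^*=\{\bar\lambda:\lambda\in\Omega\}$. Zeros are counted with multiplicity. Generalized Cowen–Douglas class: let $\Omega$ be a bounded open subset of $\mathbb{C}$ (not necessarily connected) with distinct connected components $\Omega_i$, $1\le i\le N$, $N\in\mathbb{Z}_+\cup\{\infty\}$, and let $\alpha=(\alpha_i)_{i=1}^N$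 be a sequence of positive integers. $\mathfrak{B}_\alpha(\Omega)$ is the set of bounded operators $T$ on a separable complex Hilbert space $\mathcal{H}$ such that (1) $\mathrm{Ran}(T-w)=\mathcal{H}$ for $w\in\Omega$; (2) $\bigvee_{w\in\Omega}\mathrm{Ker}(T-w)=\mathcal{H}$ (closed linear span); (3) $\dim\mathrm{Ker}(T-w)=\alpha_i$ for all $w\in\Omega_i$ and all $i$. *)

theory Defs
  imports "HOL-Complex_Analysis.Complex_Analysis"
begin

section \<open>Complex inner product spaces\<close>

class complex_inner = real_inner +
  fixes scaleC :: "complex \<Rightarrow> 'a \<Rightarrow> 'a" (infixr "*\<^sub>C" 75)
    and cinner :: "'a \<Rightarrow> 'a \<Rightarrow> complex"
  assumes scaleC_add_right: "a *\<^sub>C (x + y) = a *\<^sub>C x + a *\<^sub>C y"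
    and scaleC_add_left: "(a + b) *\<^sub>C x = a *\<^sub>C x + b *\<^sub>C x"
    and scaleC_scaleC: "a *\<^sub>C (b *\<^sub>C x) = (a * b) *\<^sub>C x"
    and scaleC_one: "1 *\<^sub>C x = x"
    and scaleC_of_real: "complex_of_real r *\<^sub>C x = r *\<^sub>R x"
    and cinner_commute: "cinner x y = cnj (cinner y x)"
    and cinner_add_left: "cinner (x + y) z = cinner x z + cinner y z"
    and cinner_scaleC_left: "cinner (a *\<^sub>C x) y = a * cinner x y"
    and Re_cinner: "Re (cinner x y) = inner x y"

global_interpretation complex_vector: vector_space "scaleC :: complex \<Rightarrow> 'a \<Rightarrow> 'a :: complex_inner"
  defines csubspace = complex_vector.subspace
    and cspan = complex_vector.span
    and cdim = complex_vector.dim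
  by unfold_locales
    (simp_all add: scaleC_add_right scaleC_add_left scaleC_scaleC scaleC_one)

section \<open>Operators on a Hilbert space\<close>

text \<open>A complex Hilbert space is represented by a complete complex subspace \<open>H\<close> of a
  complex inner product type, with \<open>H = UNIV\<close> allowed.  An operator on \<open>H\<close> is a function on the
  whole type of which only the values on \<open>H\<close> matter.\<close>

definition hilbert_on :: "'a::complex_inner set \<Rightarrow> bool" where
  "hilbert_on H \<longleftrightarrow> csubspace H \<and> complete H"

definition bounded_op_on :: "'a::complex_inner set \<Rightarrow> ('a \<Rightarrow> 'a) \<Rightarrow> bool" where
  "bounded_op_on H T \<longleftrightarrow>
     (\<forall>x\<in>H. T x \<in> H) \<and>
     (\<forall>x\<in>H. \<forall>y\<in>H. T (x + y) = T x + T y) \<and>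
     (\<forall>a. \<forall>x\<in>H. T (a *\<^sub>C x) = a *\<^sub>C T x) \<and>
     (\<exists>B. \<forall>x\<in>H. norm (T x) \<le> B * norm x)"

definition orthogonal_complement :: "'a::complex_inner set \<Rightarrow> 'a set" where
  "orthogonal_complement M = {x. \<forall>y\<in>M. cinner x y = 0}"

definition orthogonal_projection :: "'a::complex_inner set \<Rightarrow> 'a \<Rightarrow> 'a" where
  "orthogonal_projection K x = (THE y. y \<in> K \<and> x - y \<in> orthogonal_complement K)"

definition adjoint_on :: "'a::complex_inner set \<Rightarrow> ('a \<Rightarrow> 'a) \<Rightarrow> 'a \<Rightarrow> 'a" where
  "adjoint_on H T y = (THE u. u \<in> H \<and> (\<forall>x\<in>H. cinner (T x) y = cinner x u))"

definition shifted_op :: "('a::complex_inner \<Rightarrow> 'a) \<Rightarrow> complex \<Rightarrow> 'a \<Rightarrow> 'a" where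
  "shifted_op T w x = T x - w *\<^sub>C x"

definition kernel_on :: "'a::complex_inner set \<Rightarrow> ('a \<Rightarrow> 'a) \<Rightarrow> 'a set" where
  "kernel_on H T = {x \<in> H. T x = 0}"

definition invertible_on :: "'a::complex_inner set \<Rightarrow> ('a \<Rightarrow> 'a) \<Rightarrow> bool" where
  "invertible_on H T \<longleftrightarrow>
     (\<exists>R. bounded_op_on H R \<and> (\<forall>x\<in>H. R (T x) = x \<and> T (R x) = x))"

definition spectrum_on :: "'a::complex_inner set \<Rightarrow> ('a \<Rightarrow> 'a) \<Rightarrow> complex set" where
  "spectrum_on H T = {w. \<not> invertible_on H (shifted_op T w)}"

text \<open>The second conjunct says that the kernel, the third that the cokernel, is finite-dimensional.\<close>

definition fredholm_on :: "'a::complex_inner set \<Rightarrow> ('a \<Rightarrow> 'a) \<Rightarrow> bool" where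
  "fredholm_on H T \<longleftrightarrow>
     closed (T ` H) \<and>
     (\<exists>B. finite B \<and> kernel_on H T \<subseteq> cspan B) \<and>
     (\<exists>B. finite B \<and> B \<subseteq> H \<and> H = {x + y |x y. x \<in> T ` H \<and> y \<in> cspan B})"

definition essential_spectrum_on :: "'a::complex_inner set \<Rightarrow> ('a \<Rightarrow> 'a) \<Rightarrow> complex set" where
  "essential_spectrum_on H T = {w. \<not> fredholm_on H (shifted_op T w)}"

text \<open>The generalized Cowen--Douglas class.  The sequence \<open>\<alpha>\<close> is indexed by the connected
  components of \<open>\<Omega>\<close> themselves instead of by an enumeration of them; its values on other sets are
  irrelevant.  As \<^const>\<open>cdim\<close> is 0 on infinite-dimensional spaces, positivity of \<open>\<alpha>\<close> makes the
  dimension condition entail finite dimension.\<close>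

definition cowen_douglas ::
  "'a::complex_inner set \<Rightarrow> (complex set \<Rightarrow> nat) \<Rightarrow> complex set \<Rightarrow> ('a \<Rightarrow> 'a) set" where
  "cowen_douglas H \<alpha> \<Omega> =
     {T. hilbert_on H \<and> separable_space (top_of_set H) \<and>
         open \<Omega> \<and> bounded \<Omega> \<and> (\<forall>C\<in>components \<Omega>. \<alpha> C > 0) \<and>
         bounded_op_on H T \<and>
         (\<forall>w\<in>\<Omega>. shifted_op T w ` H = H) \<and>
         closure (cspan (\<Union>w\<in>\<Omega>. kernel_on H (shifted_op T w))) = H \<and>
         (\<forall>C\<in>components \<Omega>. \<forall>w\<in>C. cdim (kernel_on H (shifted_op T w)) = \<alpha> C)}"


section \<open>The Hardy space over the bidisk\<close>

text \<open>An element of the Hardy space is given by its square-summable Taylor coefficients; the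
  function on the bidisk that it stands for is \<open>heval\<close> below (which determines it, see
  \<open>heval_inject\<close>).\<close>

typedef hardy2 = "{a :: nat \<times> nat \<Rightarrow> complex. (\<lambda>k. (cmod (a k))\<^sup>2) summable_on UNIV}"
  morphisms hcoeff Abs_hardy2
  by (rule exI[of _ "\<lambda>_. 0"]) simp

setup_lifting type_definition_hardy2

lemma sq_summable_add:
  fixes a b :: "'i \<Rightarrow> complex"
  assumes "(\<lambda>k. (cmod (a k))\<^sup>2) summable_on UNIV" "(\<lambda>k. (cmod (b k))\<^sup>2) summable_on UNIV"
  shows "(\<lambda>k. (cmod (a k + b k))\<^sup>2) summable_on UNIV"
proof (rule summable_on_comparison_test)
  show "(\<lambda>k. 2 * (cmod (a k))\<^sup>2 + 2 * (cmod (b k))\<^sup>2) summable_on UNIV"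
    using assms by (intro summable_on_add summable_on_cmult_right)
  fix k
  have "(cmod (a k + b k))\<^sup>2 \<le> (cmod (a k) + cmod (b k))\<^sup>2"
    by (intro power_mono norm_triangle_ineq) simp
  also have "\<dots> \<le> 2 * (cmod (a k))\<^sup>2 + 2 * (cmod (b k))\<^sup>2"
    using zero_le_power2[of "cmod (a k) - cmod (b k)"] by (simp add: power2_eq_square algebra_simps)
  finally show "(cmod (a k + b k))\<^sup>2 \<le> 2 * (cmod (a k))\<^sup>2 + 2 * (cmod (b k))\<^sup>2" .
qed simp

lemma sq_summable_scale:
  fixes a :: "'i \<Rightarrow> complex"
  assumes "(\<lambda>k. (cmod (a k))\<^sup>2) summable_on UNIV"
  shows "(\<lambda>k. (cmod (c * a k))\<^sup>2) summable_on UNIV"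
  using summable_on_cmult_right[OF assms, of "(cmod c)\<^sup>2"]
  by (simp add: norm_mult power_mult_distrib)

lemma sq_summable_abs_prod:
  fixes a b :: "'i \<Rightarrow> complex"
  assumes "(\<lambda>k. (cmod (a k))\<^sup>2) summable_on UNIV" "(\<lambda>k. (cmod (b k))\<^sup>2) summable_on UNIV"
  shows "(\<lambda>k. norm (a k * b k)) summable_on UNIV"
  by (rule abs_summable_product) (use assms in \<open>simp_all add: norm_mult power2_eq_square\<close>)

instantiation hardy2 :: complex_inner
begin

lift_definition zero_hardy2 :: hardy2 is "\<lambda>_. 0" by simp

lift_definition plus_hardy2 :: "hardy2 \<Rightarrow> hardy2 \<Rightarrow> hardy2" is "\<lambda>a b k. a k + b k"
  by (rule sq_summable_add)

lift_definition uminus_hardy2 :: "hardy2 \<Rightarrow> hardy2" is "\<lambda>a k. - a k" by simp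

lift_definition minus_hardy2 :: "hardy2 \<Rightarrow> hardy2 \<Rightarrow> hardy2" is "\<lambda>a b k. a k - b k"
  subgoal for a b using sq_summable_add[of a "\<lambda>k. - b k"] by simp
  done

lift_definition scaleR_hardy2 :: "real \<Rightarrow> hardy2 \<Rightarrow> hardy2" is "\<lambda>r a k. complex_of_real r * a k"
  by (rule sq_summable_scale)

lift_definition scaleC_hardy2 :: "complex \<Rightarrow> hardy2 \<Rightarrow> hardy2" is "\<lambda>c a k. c * a k"
  by (rule sq_summable_scale)

definition cinner_hardy2 :: "hardy2 \<Rightarrow> hardy2 \<Rightarrow> complex" where
  "cinner_hardy2 f g = (\<Sum>\<^sub>\<infinity>k. hcoeff f k * cnj (hcoeff g k))"

definition inner_hardy2 :: "hardy2 \<Rightarrow> hardy2 \<Rightarrow> real" where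
  "inner_hardy2 f g = Re (cinner f g)"

definition norm_hardy2 :: "hardy2 \<Rightarrow> real" where
  "norm_hardy2 f = sqrt (inner f f)"

definition sgn_hardy2 :: "hardy2 \<Rightarrow> hardy2" where
  "sgn_hardy2 f = inverse (norm f) *\<^sub>R f"

definition dist_hardy2 :: "hardy2 \<Rightarrow> hardy2 \<Rightarrow> real" where
  "dist_hardy2 f g = norm (f - g)"

definition uniformity_hardy2 :: "(hardy2 \<times> hardy2) filter" where
  "uniformity_hardy2 = (INF e\<in>{0 <..}. principal {(x, y). dist x y < e})"

definition open_hardy2 :: "hardy2 set \<Rightarrow> bool" where
  "open_hardy2 U = (\<forall>x\<in>U. eventually (\<lambda>(x', y). x' = x \<longrightarrow> y \<in> U) uniformity)"

instance
proof
  have summ: "(\<lambda>k. hcoeff f k * cnj (hcoeff g k)) summable_on UNIV" for f g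
    by (rule abs_summable_summable, rule sq_summable_abs_prod) (use hcoeff in auto)
  have comm: "cinner f g = cnj (cinner g f)" for f g :: hardy2
    unfolding cinner_hardy2_def infsum_cnj[symmetric] by (simp add: mult.commute)
  have add: "cinner (f + g) h = cinner f h + cinner g h" for f g h :: hardy2
    unfolding cinner_hardy2_def plus_hardy2.rep_eq
    by (simp add: distrib_right infsum_add summ)
  have scale: "cinner (c *\<^sub>C f) h = c * cinner f h" for c and f h :: hardy2
    unfolding cinner_hardy2_def scaleC_hardy2.rep_eq
    by (simp add: mult.assoc infsum_cmult_right summ)
  have scaleCR: "complex_of_real r *\<^sub>C f = r *\<^sub>R f" for r and f :: hardy2
    by transfer simp
  have inner_self: "inner f f = (\<Sum>\<^sub>\<infinity>k. (cmod (hcoeff f k))\<^sup>2)" for f :: hardy2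
    unfolding inner_hardy2_def cinner_hardy2_def
    by (subst infsum_Re[symmetric, OF summ]) (simp add: complex_mult_cnj cmod_power2)
  fix f g h :: hardy2 and r s :: real and a b :: complex
  show "f + g + h = f + (g + h)" by transfer (simp add: add.assoc)
  show "f + g = g + f" by transfer (simp add: add.commute)
  show "0 + f = f" by transfer simp
  show "- f + f = 0" by transfer simp
  show "f - g = f + - g" by transfer simp
  show "r *\<^sub>R (f + g) = r *\<^sub>R f + r *\<^sub>R g" by transfer (simp add: algebra_simps)
  show "(r + s) *\<^sub>R f = r *\<^sub>R f + s *\<^sub>R f" by transfer (simp add: algebra_simps)
  show "r *\<^sub>R s *\<^sub>R f = (r * s) *\<^sub>R f" by transfer (simp add: algebra_simps)
  show "1 *\<^sub>R f = f" by transfer simp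
  show "sgn f = inverse (norm f) *\<^sub>R f" by (rule sgn_hardy2_def)
  show "dist f g = norm (f - g)" by (rule dist_hardy2_def)
  show "(uniformity :: (hardy2 \<times> hardy2) filter) = (INF e\<in>{0 <..}. principal {(x, y). dist x y < e})"
    by (rule uniformity_hardy2_def)
  show "open U \<longleftrightarrow> (\<forall>x\<in>U. \<forall>\<^sub>F (x', y) in uniformity. x' = x \<longrightarrow> y \<in> U)" for U :: "hardy2 set"
    by (rule open_hardy2_def)
  show "inner f g = inner g f" unfolding inner_hardy2_def by (subst comm) simp
  show "inner (f + g) h = inner f h + inner g h" unfolding inner_hardy2_def by (simp add: add)
  show "inner (r *\<^sub>R f) g = r * inner f g"
    unfolding inner_hardy2_def scaleCR[symmetric] by (simp add: scale)
  show "0 \<le> inner f f" unfolding inner_self by (rule infsum_nonneg) simp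
  show "inner f f = 0 \<longleftrightarrow> f = 0"
  proof
    assume *: "inner f f = 0"
    have "(cmod (hcoeff f k))\<^sup>2 = 0" for k
      by (rule nonneg_infsum_le_0D[where A = UNIV and f = "\<lambda>k. (cmod (hcoeff f k))\<^sup>2"])
        (use * hcoeff[of f] in \<open>auto simp: inner_self\<close>)
    then show "f = 0"
      by (auto simp: hcoeff_inject[symmetric] zero_hardy2.rep_eq)
  qed (simp add: inner_self zero_hardy2.rep_eq)
  show "norm f = sqrt (inner f f)" by (rule norm_hardy2_def)
  show "a *\<^sub>C (f + g) = a *\<^sub>C f + a *\<^sub>C g" by transfer (simp add: algebra_simps)
  show "(a + b) *\<^sub>C f = a *\<^sub>C f + b *\<^sub>C f" by transfer (simp add: algebra_simps)
  show "a *\<^sub>C b *\<^sub>C f = (a * b) *\<^sub>C f" by transfer (simp add: algebra_simps)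
  show "1 *\<^sub>C f = f" by transfer simp
  show "complex_of_real r *\<^sub>C f = r *\<^sub>R f" by (rule scaleCR)
  show "cinner f g = cnj (cinner g f)" by (rule comm)
  show "cinner (f + g) h = cinner f h + cinner g h" by (rule add)
  show "cinner (a *\<^sub>C f) g = a * cinner f g" by (rule scale)
  show "Re (cinner f g) = inner f g" by (simp add: inner_hardy2_def)
qed

end

abbreviation unit_disk :: "complex set" where
  "unit_disk \<equiv> ball 0 1"

definition heval :: "hardy2 \<Rightarrow> complex \<Rightarrow> complex \<Rightarrow> complex" where
  "heval f z w = (\<Sum>\<^sub>\<infinity>(m, n). hcoeff f (m, n) * (z ^ m * w ^ n))"

lemma heval_abs_summable:
  assumes "z \<in> unit_disk" "w \<in> unit_disk"
  shows "(\<lambda>(m, n). norm (hcoeff f (m, n) * (z ^ m * w ^ n))) summable_on UNIV"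
proof -
  have *: "(\<lambda>(m, n). (cmod (z ^ m * w ^ n))\<^sup>2) summable_on UNIV \<times> UNIV"
  proof (rule summable_on_SigmaI)
    fix m
    have "((\<lambda>n. (cmod w ^ 2) ^ n) has_sum (1 / (1 - cmod w ^ 2))) UNIV"
      by (rule norm_summable_imp_has_sum)
        (use assms in \<open>auto intro!: geometric_sums summable_geometric simp: abs_square_less_1 power_less_one_iff\<close>)
    from has_sum_cmult_right[OF this, of "(cmod z ^ 2) ^ m"]
    show "((\<lambda>n. case (m, n) of (m, n) \<Rightarrow> (cmod (z ^ m * w ^ n))\<^sup>2) has_sum
            ((cmod z ^ 2) ^ m * (1 / (1 - cmod w ^ 2)))) UNIV"
      by (simp add: norm_mult norm_power power_mult_distrib power_mult[symmetric] mult.commute)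
  next
    show "(\<lambda>m. (cmod z ^ 2) ^ m * (1 / (1 - cmod w ^ 2))) summable_on UNIV"
      by (intro summable_on_cmult_left norm_summable_imp_summable_on)
        (use assms in \<open>auto intro!: summable_geometric simp: power_less_one_iff\<close>)
  qed auto
  then have "(\<lambda>k. (cmod (z ^ fst k * w ^ snd k))\<^sup>2) summable_on UNIV"
    unfolding case_prod_unfold by simp
  from sq_summable_abs_prod[OF _ this, of "hcoeff f"] hcoeff[of f]
  show ?thesis unfolding case_prod_unfold by simp
qed

lemma heval_iterated:
  assumes "z \<in> unit_disk" "w \<in> unit_disk"
  shows "((\<lambda>m. (\<Sum>\<^sub>\<infinity>n. hcoeff f (m, n) * w ^ n) * z ^ m) has_sum heval f z w) UNIV"
    and "(\<lambda>n. hcoeff f (m, n) * w ^ n) summable_on UNIV"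
proof -
  let ?F = "\<lambda>z (m, n). hcoeff f (m, n) * (z ^ m * w ^ n)"
  have F: "?F u summable_on UNIV \<times> UNIV" if "u \<in> unit_disk" for u
    using heval_abs_summable[OF that assms(2), of f] abs_summable_summable[of "?F u" UNIV]
    unfolding case_prod_unfold UNIV_Times_UNIV by blast
  show s: "(\<lambda>n. hcoeff f (m, n) * w ^ n) summable_on UNIV" for m
  proof -
    have "(\<lambda>n. hcoeff f (m, n) * ((1/2) ^ m * w ^ n)) summable_on UNIV"
      using summable_on_SigmaD1[OF F[of "1/2"], of m] by simp
    from summable_on_cmult_right[OF this, of "2 ^ m"] show ?thesis
      by (simp add: power_divide mult.commute mult.left_commute)
  qed
  have "(\<lambda>m. \<Sum>\<^sub>\<infinity>n. ?F z (m, n)) summable_on UNIV"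
    using summable_on_Sigma_banach[OF F[OF assms(1)]] by simp
  moreover have "(\<Sum>\<^sub>\<infinity>m. \<Sum>\<^sub>\<infinity>n. ?F z (m, n)) = heval f z w"
    using infsum_Sigma'_banach[OF F[OF assms(1)]] by (simp add: heval_def)
  moreover have "(\<Sum>\<^sub>\<infinity>n. ?F z (m, n)) = (\<Sum>\<^sub>\<infinity>n. hcoeff f (m, n) * w ^ n) * z ^ m" for m
    unfolding infsum_cmult_left'[symmetric] by (simp add: mult_ac)
  ultimately show "((\<lambda>m. (\<Sum>\<^sub>\<infinity>n. hcoeff f (m, n) * w ^ n) * z ^ m) has_sum heval f z w) UNIV"
    by (metis (no_types, lifting) has_sum_cong has_sum_infsum)
qed

lemma power_series_eq_0:
  fixes c :: "nat \<Rightarrow> complex"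
  assumes "\<And>z. z \<in> unit_disk \<Longrightarrow> ((\<lambda>m. c m * z ^ m) has_sum 0) UNIV"
  shows "c m = 0"
proof (rule ccontr)
  assume m: "c m \<noteq> 0"
  have sums: "(\<lambda>m. c m * z ^ m) sums 0" if "z \<in> unit_disk" for z
    using has_sum_imp_sums[OF assms[OF that]] .
  have "c 0 = 0" using sums[of 0] by (simp add: powser_sums_zero_iff)
  with m have "m > 0" by (cases m) auto
  show False
  proof (rule powser_0_nonzero[of 1 0 c "\<lambda>_. 0" m])
    fix s :: real
    assume "0 < s" "\<And>z::complex. z \<in> cball 0 s - {0} \<Longrightarrow> (0::complex) \<noteq> 0"
    from this(2)[of "complex_of_real s"] this(1) show False by simp
  qed (use sums m \<open>m > 0\<close> in auto)
qed

lemma has_sum_minus: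
  fixes f g :: "'i \<Rightarrow> complex"
  assumes "(f has_sum a) A" "(g has_sum b) A"
  shows "((\<lambda>x. f x - g x) has_sum (a - b)) A"
  using has_sum_add[OF assms(1) has_sum_cmult_right[OF assms(2), of "-1"]] by simp

lemma heval_inject:
  assumes "\<And>z w. z \<in> unit_disk \<Longrightarrow> w \<in> unit_disk \<Longrightarrow> heval f z w = heval g z w"
  shows "f = g"
proof -
  have "hcoeff f (m, n) - hcoeff g (m, n) = 0" for m n
  proof (rule power_series_eq_0)
    fix w :: complex assume w: "w \<in> unit_disk"
    have sf: "(\<lambda>n. hcoeff f (m, n) * w ^ n) summable_on UNIV" 
      and sg: "(\<lambda>n. hcoeff g (m, n) * w ^ n) summable_on UNIV" for m
      using heval_iterated(2)[of 0 w] w by auto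
    have "(\<Sum>\<^sub>\<infinity>n. hcoeff f (m, n) * w ^ n) - (\<Sum>\<^sub>\<infinity>n. hcoeff g (m, n) * w ^ n) = 0" for m
    proof (rule power_series_eq_0)
      fix z :: complex assume z: "z \<in> unit_disk"
      show "((\<lambda>m. ((\<Sum>\<^sub>\<infinity>n. hcoeff f (m, n) * w ^ n) - (\<Sum>\<^sub>\<infinity>n. hcoeff g (m, n) * w ^ n)) * z ^ m)
              has_sum 0) UNIV"
        using has_sum_minus[OF heval_iterated(1)[OF z w, of f] heval_iterated(1)[OF z w, of g]]
        by (simp add: assms[OF z w] left_diff_distrib)
    qed
    then show "((\<lambda>n. (hcoeff f (m, n) - hcoeff g (m, n)) * w ^ n) has_sum 0) UNIV"
      using has_sum_minus[OF has_sum_infsum[OF sf[of m]] has_sum_infsum[OF sg[of m]]]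
      by (simp add: left_diff_distrib)
  qed
  then show ?thesis by (auto simp: hcoeff_inject[symmetric])
qed

lift_definition mult_z :: "hardy2 \<Rightarrow> hardy2" is
  "\<lambda>a (m, n). if m = 0 then 0 else a (m - 1, n)"
proof -
  fix a :: "nat \<times> nat \<Rightarrow> complex"
  assume "(\<lambda>k. (cmod (a k))\<^sup>2) summable_on UNIV"
  then have "(\<lambda>k. (cmod (a (fst k - 1, snd k)))\<^sup>2) summable_on (\<lambda>(m, n). (Suc m, n)) ` UNIV"
    by (subst summable_on_reindex) (auto simp: inj_on_def o_def case_prod_beta)
  then show "(\<lambda>k. (cmod (case k of (m, n) \<Rightarrow> if m = 0 then 0 else a (m - 1, n)))\<^sup>2) summable_on UNIV"
  proof (rule summable_on_cong_neutral[THEN iffD1, rotated -1])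
    fix k assume "k \<in> UNIV - range (\<lambda>(m :: nat, n :: nat). (Suc m, n))"
    then have "fst k = 0" by (cases k; cases "fst k") auto
    then show "(cmod (case k of (m, n) \<Rightarrow> if m = 0 then 0 else a (m - 1, n)))\<^sup>2 = 0"
      by (simp add: case_prod_beta)
  qed auto
qed

lemma heval_mult_z: "heval (mult_z f) z w = z * heval f z w"
proof -
  let ?s = "\<lambda>(m :: nat, n :: nat). (Suc m, n)"
  have "heval (mult_z f) z w = (\<Sum>\<^sub>\<infinity>(m, n)\<in>range ?s. hcoeff (mult_z f) (m, n) * (z ^ m * w ^ n))"
    unfolding heval_def
  proof (rule infsum_cong_neutral)
    fix k assume "k \<in> UNIV - range ?s"
    then have "fst k = 0" by (cases k; cases "fst k") auto
    then show "(case k of (m, n) \<Rightarrow> hcoeff (mult_z f) (m, n) * (z ^ m * w ^ n)) = 0"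
      by (simp add: case_prod_beta mult_z.rep_eq)
  qed auto
  also have "\<dots> = (\<Sum>\<^sub>\<infinity>k. z * (case k of (m, n) \<Rightarrow> hcoeff f (m, n) * (z ^ m * w ^ n)))"
    by (subst infsum_reindex)
      (auto simp: inj_on_def o_def case_prod_beta mult_z.rep_eq mult_ac intro!: infsum_cong)
  also have "\<dots> = z * heval f z w"
    unfolding heval_def by (rule infsum_cmult_right')
  finally show ?thesis .
qed


section \<open>Rational inner functions and the compression of the shift\<close>

text \<open>The boundary value at \<open>(cis s, cis t)\<close> is the radial limit.\<close>

definition inner_fun :: "hardy2 \<Rightarrow> bool" where
  "inner_fun \<theta> \<longleftrightarrow>
     (AE (s, t) in (lborel :: (real \<times> real) measure).
        s \<in> {0..2*pi} \<and> t \<in> {0..2*pi} \<longrightarrow>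
        (\<exists>b. ((\<lambda>r. heval \<theta> (complex_of_real r * cis s) (complex_of_real r * cis t)) \<longlongrightarrow> b) (at_left 1)
             \<and> cmod b = 1))"

text \<open>A polynomial in \<open>z\<close> and \<open>w\<close> is a polynomial in \<open>w\<close> whose coefficients are polynomials
  in \<open>z\<close>.\<close>

definition poly2 :: "complex poly poly \<Rightarrow> complex \<Rightarrow> complex \<Rightarrow> complex" where
  "poly2 p z w = poly (poly p [:w:]) z"

text \<open>Multiplying out the denominator avoids division by \<open>0\<close> where a non-reduced denominator
  vanishes.\<close>

definition rational_fun :: "hardy2 \<Rightarrow> bool" where
  "rational_fun \<theta> \<longleftrightarrow>
     (\<exists>p q. q \<noteq> 0 \<and> (\<forall>z\<in>unit_disk. \<forall>w\<in>unit_disk. heval \<theta> z w * poly2 q z w = poly2 p z w))"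

definition rational_inner :: "hardy2 \<Rightarrow> bool" where
  "rational_inner \<theta> \<longleftrightarrow> inner_fun \<theta> \<and> rational_fun \<theta>"

definition inner_factor :: "hardy2 \<Rightarrow> hardy2 \<Rightarrow> bool" where
  "inner_factor \<phi> \<theta> \<longleftrightarrow>
     inner_fun \<phi> \<and>
     (\<exists>\<psi>. inner_fun \<psi> \<and>
        (\<forall>z\<in>unit_disk. \<forall>w\<in>unit_disk. heval \<theta> z w = heval \<phi> z w * heval \<psi> z w))"

definition only_z :: "hardy2 \<Rightarrow> bool" where
  "only_z \<phi> \<longleftrightarrow>
     (\<forall>z\<in>unit_disk. \<forall>w\<in>unit_disk. \<forall>w'\<in>unit_disk. heval \<phi> z w = heval \<phi> z w')"

definition constant_fun :: "hardy2 \<Rightarrow> bool" where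
  "constant_fun \<phi> \<longleftrightarrow> (\<exists>c. \<forall>z\<in>unit_disk. \<forall>w\<in>unit_disk. heval \<phi> z w = c)"

definition mult_range :: "hardy2 \<Rightarrow> hardy2 set" where
  "mult_range \<theta> =
     {h. \<exists>g. \<forall>z\<in>unit_disk. \<forall>w\<in>unit_disk. heval h z w = heval \<theta> z w * heval g z w}"

definition model_space :: "hardy2 \<Rightarrow> hardy2 set" where
  "model_space \<theta> = orthogonal_complement (mult_range \<theta>)"

definition compressed_shift :: "hardy2 \<Rightarrow> hardy2 \<Rightarrow> hardy2" where
  "compressed_shift \<theta> f = orthogonal_projection (model_space \<theta>) (mult_z f)"

text \<open>\<open>f\<close> has exactly \<open>n\<close> zeros in \<open>A\<close>, counted with multiplicity.\<close>

definition has_zero_count :: "(complex \<Rightarrow> complex) \<Rightarrow> complex set \<Rightarrow> nat \<Rightarrow> bool" where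
  "has_zero_count f A n \<longleftrightarrow>
     finite {w \<in> A. f w = 0} \<and> (\<Sum>w | w \<in> A \<and> f w = 0. nat (zorder f w)) = n"

end

theory Submission
  imports Defs "HOL-Computational_Algebra.Fundamental_Theorem_Algebra"
begin

text \<open>The eigenvectors of \<open>S\<^sub>z\<^sup>*\<close> for \<open>cnj c\<close> are the functions \<open>h(w) / (1 - cnj c z)\<close> with \<open>h\<close>
  orthogonal to \<open>\<theta>(c, _) H\<^sup>2(D)\<close>.  As \<open>\<theta>(c, _)\<close> is a nonzero rational function (zero only if \<open>\<theta>\<close> has a Blaschke
  factor in \<open>z\<close>), they form a space whose dimension is the number of its zeros in the disk.  On \<open>\<Omega>\<close>, which lies
  in the disk, \<open>S\<^sub>z - c\<close> is bounded below, hence \<open>S\<^sub>z\<^sup>* - cnj c\<close> is onto, and both this and the dimension of the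
  kernel are stable under small perturbations of \<open>c\<close>.

  For the density of the eigenvectors let \<open>f\<close> in the model space be orthogonal to all of them.  Then \<open>f(c, _) / \<theta>(c, _)\<close>
  is holomorphic for all \<open>c\<close> in the disk for which \<open>\<theta>(c, _)\<close> has no zeros on the circle; these \<open>c\<close> are dense, so \<open>f / \<theta>\<close>
  is locally bounded and hence holomorphic on the bidisk.  For almost every \<open>\<omega>\<close> on the circle \<open>t \<mapsto> \<theta>(t, t \<omega>)\<close> is a finite
  Blaschke product, so \<open>f / \<theta>\<close> and \<open>f\<close> have the same Hardy norm on the slice \<open>t \<mapsto> (t, t \<omega>)\<close>.  Integrating over \<open>\<omega>\<close>
  gives \<open>f / \<theta> \<in> H\<^sup>2\<close>, and therefore \<open>f = 0\<close>.\<close>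

section \<open>Complex Hilbert spaces\<close>

text \<open>The obstacle is that a fiber \<open>\<theta>(c, _)\<close> may vanish on the circle. No
  lower bound for \<open>S_z - c\<close> is obtained there, so divisibility of
  \<open>f(c, _)\<close> by \<open>\<theta>(c, _)\<close> is proved only over the remaining c and
  has to be spread to all c by a bound on the quotient. The remaining c are dense only after p, in
  \<theta> = p / q, is freed of factors w - \<tau> with \<tau> on the circle, since such a factor
  would make every fiber of p vanish at \<tau>. In the study of multiplication by \<theta>, radial
  limits serve only to get |p| = |q| on the torus. Diagonal slices then take over: the homogeneous
  components are polynomials in \<omega>, and by Parseval the norm is an integral of slice norms.
  The same transfer of norms is used twice, to show that multiplication by \<theta> is an isometry
  and that the quotient lies in the Hardy space. Nonvanishing of the fiber makes
  \<open>S_z - c\<close> injective. This is what upgrades the Fredholm property on \<Omega> to a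
  lower bound, and with a lower bound the kernels of the adjoint at nearby points have no vector in
  one orthogonal to the other.\<close>

lemma cinner_add_right: "cinner x (y + z) = cinner x y + cinner x z"
  by (metis cinner_add_left cinner_commute complex_cnj_add)

lemma cinner_scaleC_right: "cinner x (a *\<^sub>C y) = cnj a * cinner x y"
  by (metis cinner_commute cinner_scaleC_left complex_cnj_mult)

lemma scaleC_minus_one: "(-1) *\<^sub>C x = - (x :: 'a :: complex_inner)"
  using scaleC_of_real[of "-1" x] by simp

lemma cinner_zero_left [simp]: "cinner 0 x = 0"
  using cinner_add_left[of 0 0 x] by simp

lemma cinner_zero_right [simp]: "cinner x 0 = 0"
  using cinner_add_right[of x 0 0] by simp

lemma cinner_minus_left: "cinner (- x) y = - cinner x y"
  using cinner_scaleC_left[of "-1" x y] by (simp add: scaleC_minus_one)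

lemma cinner_minus_right: "cinner x (- y) = - cinner x y"
  using cinner_scaleC_right[of x "-1" y] by (simp add: scaleC_minus_one)

lemma cinner_diff_left: "cinner (x - y) z = cinner x z - cinner y z"
  by (simp add: cinner_add_left cinner_minus_left flip: add_uminus_conv_diff)

lemma cinner_diff_right: "cinner x (y - z) = cinner x y - cinner x z"
  by (simp add: cinner_add_right cinner_minus_right flip: add_uminus_conv_diff)

lemma cinner_sum_left: "cinner (\<Sum>i\<in>A. f i) x = (\<Sum>i\<in>A. cinner (f i) x)"
  by (induction A rule: infinite_finite_induct) (simp_all add: cinner_add_left)

lemmas cinner_simps =
  cinner_add_left cinner_add_right cinner_diff_left cinner_diff_right
  cinner_scaleC_left cinner_scaleC_right

lemma cnj_mult_self: "z * cnj z = complex_of_real ((cmod z)\<^sup>2)"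
  by (rule complex_norm_square[symmetric])

lemma cinner_self: "cinner x x = complex_of_real ((norm x)\<^sup>2)"
proof -
  have "Im (cinner x x) = 0"
    using cinner_commute[of x x] by (simp add: complex_eq_iff)
  then show ?thesis
    by (simp add: complex_eq_iff Re_cinner power2_norm_eq_inner)
qed

lemma norm_scaleC: "norm (a *\<^sub>C x) = cmod a * norm x"
proof -
  have "complex_of_real ((norm (a *\<^sub>C x))\<^sup>2) = complex_of_real ((cmod a * norm x)\<^sup>2)"
    unfolding cinner_self[symmetric] cinner_scaleC_left cinner_scaleC_right
    using cnj_mult_self[of a] by (simp add: cinner_self power_mult_distrib mult_ac)
  then have "(norm (a *\<^sub>C x))\<^sup>2 = (cmod a * norm x)\<^sup>2"
    by (simp only: of_real_eq_iff)
  then show ?thesis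
    by (simp add: power2_eq_iff_nonneg)
qed

lemma norm_cinner_le: "cmod (cinner x y) \<le> norm x * norm y"
proof (cases "cinner x y = 0")
  case False
  \<comment> \<open>The phase u turns \<open>cinner (u *\<^sub>C x) y\<close> into its modulus, so
    that the real Cauchy-Schwarz inequality suffices.\<close>
  define u where "u = cnj (cinner x y) / cmod (cinner x y)"
  have u: "cmod u = 1" using False by (simp add: u_def norm_divide)
  have "u * cinner x y = complex_of_real ((cmod (cinner x y))\<^sup>2) / cmod (cinner x y)"
    by (simp add: u_def cnj_mult_self mult.commute[of "cnj _"])
  also have "\<dots> = complex_of_real (cmod (cinner x y))"
    using False by (simp add: power2_eq_square)
  finally have "cmod (cinner x y) = Re (cinner (u *\<^sub>C x) y)"
    by (simp add: cinner_scaleC_left)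
  also have "\<dots> \<le> norm (u *\<^sub>C x) * norm y"
    unfolding Re_cinner by (rule norm_cauchy_schwarz)
  finally show ?thesis by (simp add: norm_scaleC u)
qed simp

lemma norm_diff_sq: "(norm (x - y :: 'a :: complex_inner))\<^sup>2 = (norm x)\<^sup>2 - 2 * Re (cinner x y) + (norm y)\<^sup>2"
  by (simp add: power2_norm_eq_inner Re_cinner inner_diff inner_commute)

lemma norm_le_norm_diff_of_orthogonal:
  assumes "cinner x y = 0"
  shows "norm x \<le> norm (x - y)"
proof -
  have "(norm x)\<^sup>2 \<le> (norm (x - y))\<^sup>2" using norm_diff_sq[of x y] assms by simp
  then show ?thesis by (rule power2_le_imp_le) simp
qed

section \<open>Complex subspaces, their closures and orthogonal projections\<close>

lemma csubspace_closed_ops: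
  assumes "csubspace K"
  shows "0 \<in> K" "x \<in> K \<Longrightarrow> y \<in> K \<Longrightarrow> x + y \<in> K" "x \<in> K \<Longrightarrow> y \<in> K \<Longrightarrow> x - y \<in> K"
    "x \<in> K \<Longrightarrow> a *\<^sub>C x \<in> K"
  using assms complex_vector.subspace_0 complex_vector.subspace_add
    complex_vector.subspace_diff complex_vector.subspace_scale by auto

lemma csubspaceI:
  assumes "0 \<in> K" "\<And>x y. x \<in> K \<Longrightarrow> y \<in> K \<Longrightarrow> x + y \<in> K" "\<And>a x. x \<in> K \<Longrightarrow> a *\<^sub>C x \<in> K"
  shows "csubspace K"
  using assms by (rule complex_vector.subspaceI)

lemma csubspace_scaleR: "csubspace K \<Longrightarrow> x \<in> K \<Longrightarrow> r *\<^sub>R x \<in> K"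
  using csubspace_closed_ops(4)[of K x "complex_of_real r"] by (simp add: scaleC_of_real)

lemma csubspace_sum:
  assumes "csubspace K" "\<And>i. i \<in> A \<Longrightarrow> f i \<in> K"
  shows "(\<Sum>i\<in>A. f i) \<in> K"
  using assms complex_vector.subspace_sum by auto

lemma csubspace_orthogonal_complement: "csubspace (orthogonal_complement M)"
  by (rule csubspaceI) (auto simp: orthogonal_complement_def cinner_simps)

lemma tendsto_cinner_left:
  assumes "(X \<longlongrightarrow> x) F"
  shows "((\<lambda>n. cinner (X n) y) \<longlongrightarrow> cinner x y) F"
proof (rule tendstoI)
  fix e :: real assume "e > 0"
  then have "\<forall>\<^sub>F n in F. dist (X n) x < e / (norm y + 1)"
    using assms by (intro tendstoD) (auto simp: add_nonneg_pos)
  then show "\<forall>\<^sub>F n in F. dist (cinner (X n) y) (cinner x y) < e"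
  proof eventually_elim
    case (elim n)
    have "dist (cinner (X n) y) (cinner x y) \<le> dist (X n) x * norm y"
      using norm_cinner_le[of "X n - x" y] by (simp add: dist_norm cinner_diff_left)
    also have "\<dots> \<le> dist (X n) x * (norm y + 1)"
      by (intro mult_left_mono) auto
    also have "\<dots> < e"
      using elim by (simp add: pos_less_divide_eq add_nonneg_pos)
    finally show ?case .
  qed
qed

lemma closed_orthogonal_complement: "closed (orthogonal_complement M)"
proof (unfold closed_sequential_limits, safe)
  fix X x assume X: "\<forall>n. X n \<in> orthogonal_complement M" "X \<longlonglongrightarrow> x"
  have "cinner x y = 0" if "y \<in> M" for y
    using tendsto_cinner_left[OF X(2), of y] X(1) that
    by (simp add: orthogonal_complement_def LIMSEQ_const_iff)
  then show "x \<in> orthogonal_complement M" by (simp add: orthogonal_complement_def)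
qed

lemma tendsto_scaleC:
  fixes x :: "'a :: complex_inner"
  assumes "X \<longlonglongrightarrow> x"
  shows "(\<lambda>n. a *\<^sub>C X n) \<longlonglongrightarrow> a *\<^sub>C x"
proof (rule Lim_null_comparison[THEN LIM_zero_cancel])
  show "\<forall>\<^sub>F n in sequentially. norm (a *\<^sub>C X n - a *\<^sub>C x) \<le> cmod a * norm (X n - x)"
    by (simp add: norm_scaleC flip: complex_vector.scale_right_diff_distrib)
  show "(\<lambda>n. cmod a * norm (X n - x)) \<longlonglongrightarrow> 0"
    using assms by (intro tendsto_mult_right_zero tendsto_norm_zero LIM_zero)
qed

lemma csubspace_closure:
  assumes "csubspace K"
  shows "csubspace (closure K)"
proof (rule csubspaceI)
  show "0 \<in> closure K" using assms csubspace_closed_ops(1) closure_subset by blast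
next
  fix x y assume "x \<in> closure K" "y \<in> closure K"
  then obtain X Y where "\<And>n. X n \<in> K" "X \<longlonglongrightarrow> x" "\<And>n. Y n \<in> K" "Y \<longlonglongrightarrow> y"
    by (auto simp: closure_sequential)
  then show "x + y \<in> closure K"
    using csubspace_closed_ops(2)[OF assms]
    by (auto simp: closure_sequential intro!: exI[of _ "\<lambda>n. X n + Y n"] tendsto_add)
next
  fix a x assume "x \<in> closure K"
  then obtain X where X: "\<And>n. X n \<in> K" "X \<longlonglongrightarrow> x"
    by (auto simp: closure_sequential)
  have "(\<lambda>n. a *\<^sub>C X n) \<longlonglongrightarrow> a *\<^sub>C x" by (rule tendsto_scaleC[OF X(2)])
  then show "a *\<^sub>C x \<in> closure K"
    using csubspace_closed_ops(4)[OF assms X(1)] unfolding closure_sequential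
    by (intro exI[of _ "\<lambda>n. a *\<^sub>C X n"]) simp
qed

text \<open>A sequence in K minimizing the distance to x is Cauchy by the parallelogram identity,
  because midpoints stay in K. Its limit attains the distance, and minimality forces the residue to
  be orthogonal to K.\<close>

lemma projection_exists:
  fixes K :: "'a :: {complex_inner, banach} set"
  assumes K: "csubspace K" "closed K"
  shows "\<exists>y\<in>K. x - y \<in> orthogonal_complement K"
proof -
  have "K \<noteq> {}" using csubspace_closed_ops(1)[OF K(1)] by auto
  define d where "d = infdist x K"
  have d0: "d \<ge> 0" by (simp add: d_def infdist_nonneg)
  have d: "d \<le> norm (x - y)" if "y \<in> K" for y
    using infdist_le[OF that, of x] by (simp add: d_def dist_norm)
  have "\<exists>y\<in>K. norm (x - y) < d + 1 / (real n + 1)" for n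
  proof -
    have "infdist x K < d + 1 / (real n + 1)" by (simp add: d_def)
    moreover have "bdd_below (dist x ` K)" by (rule bdd_belowI2[of _ 0]) simp
    ultimately show ?thesis
      using cINF_less_iff[of K "dist x" "d + 1 / (real n + 1)"] \<open>K \<noteq> {}\<close>
      by (simp add: infdist_def dist_norm)
  qed
  then obtain Y where Y: "\<And>n. Y n \<in> K" "\<And>n. norm (x - Y n) < d + 1 / (real n + 1)"
    by metis
  have par: "(norm (Y m - Y n))\<^sup>2 \<le> 2 * ((norm (x - Y m))\<^sup>2 - d\<^sup>2) + 2 * ((norm (x - Y n))\<^sup>2 - d\<^sup>2)" for m n
  proof -
    have "(1/2) *\<^sub>R (Y m + Y n) \<in> K"
      using Y(1) K(1) by (intro csubspace_scaleR csubspace_closed_ops)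
    then have "d\<^sup>2 \<le> (norm (x - (1/2) *\<^sub>R (Y m + Y n)))\<^sup>2"
      using d d0 by (intro power_mono) auto
    moreover have "(norm (Y m - Y n))\<^sup>2 + 4 * (norm (x - (1/2) *\<^sub>R (Y m + Y n)))\<^sup>2
        = 2 * (norm (x - Y m))\<^sup>2 + 2 * (norm (x - Y n))\<^sup>2"
      by (simp add: power2_norm_eq_inner inner_diff inner_add inner_commute algebra_simps)
    ultimately show ?thesis by (simp add: right_diff_distrib)
  qed
  have lim0: "(\<lambda>n. (norm (x - Y n))\<^sup>2 - d\<^sup>2) \<longlonglongrightarrow> 0"
  proof (rule tendsto_sandwich[OF always_eventually always_eventually tendsto_const])
    show "\<forall>n. 0 \<le> (norm (x - Y n))\<^sup>2 - d\<^sup>2" using d Y(1) d0 by (simp add: power_mono)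
    show "\<forall>n. (norm (x - Y n))\<^sup>2 - d\<^sup>2 \<le> (d + 1 / (real n + 1))\<^sup>2 - d\<^sup>2"
      using Y(2) by (intro allI diff_right_mono power_mono) (auto intro: less_imp_le)
    have "(\<lambda>n. 1 / (real n + 1)) \<longlonglongrightarrow> 0"
      using LIMSEQ_inverse_real_of_nat by (simp add: inverse_eq_divide add.commute)
    from tendsto_power[OF tendsto_add[OF tendsto_const this], of d 2]
    show "(\<lambda>n. (d + 1 / (real n + 1))\<^sup>2 - d\<^sup>2) \<longlonglongrightarrow> 0"
      by (auto intro: LIM_zero)
  qed
  have "Cauchy Y"
  proof (rule CauchyI)
    fix e :: real assume "e > 0"
    then obtain N where N: "\<And>n. n \<ge> N \<Longrightarrow> (norm (x - Y n))\<^sup>2 - d\<^sup>2 < e\<^sup>2 / 4"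
      using order_tendstoD(2)[OF lim0, of "e\<^sup>2 / 4"] by (auto simp: eventually_sequentially)
    have "norm (Y m - Y n) < e" if "m \<ge> N" "n \<ge> N" for m n
    proof -
      have "(norm (Y m - Y n))\<^sup>2 < e\<^sup>2"
      proof -
        have *: "a \<le> 2 * b + 2 * c \<Longrightarrow> b < u / 4 \<Longrightarrow> c < u / 4 \<Longrightarrow> a < u" for a b c u :: real
          by linarith
        show ?thesis by (rule *[OF par[of m n] N[OF that(1)] N[OF that(2)]])
      qed
      then show ?thesis using \<open>e > 0\<close> by (simp add: power_less_imp_less_base)
    qed
    then show "\<exists>M. \<forall>m\<ge>M. \<forall>n\<ge>M. norm (Y m - Y n) < e" by blast
  qed
  then obtain y where y: "Y \<longlonglongrightarrow> y"
    using Cauchy_convergent convergent_def by blast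
  have yK: "y \<in> K" using K(2) y Y(1) unfolding closed_sequential_limits by blast
  have "(\<lambda>n. (norm (x - Y n))\<^sup>2 - d\<^sup>2) \<longlonglongrightarrow> (norm (x - y))\<^sup>2 - d\<^sup>2"
    by (intro tendsto_intros y)
  then have dy: "(norm (x - y))\<^sup>2 = d\<^sup>2" using lim0 LIMSEQ_unique by force
  have "cinner (x - y) k = 0" if "k \<in> K" for k
  proof (cases "k = 0")
    case False
    \<comment> \<open>The coefficient of the projection of \<open>x - y\<close> onto k: unless it
      vanishes, moving y by \<open>c *\<^sub>C k\<close> would come closer to x than d.\<close>
    define c where "c = cinner (x - y) k / (norm k)\<^sup>2"
    have ck: "y + c *\<^sub>C k \<in> K" using yK that K(1) by (intro csubspace_closed_ops)
    have re: "Re (cinner (x - y) (c *\<^sub>C k)) = (cmod (cinner (x - y) k))\<^sup>2 / (norm k)\<^sup>2"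
    proof -
      have "cinner (x - y) (c *\<^sub>C k) = complex_of_real ((cmod (cinner (x - y) k))\<^sup>2 / (norm k)\<^sup>2)"
        by (simp add: c_def cinner_scaleC_right cnj_mult_self mult.commute[of "cnj _"])
      then show ?thesis by simp
    qed
    have "d\<^sup>2 \<le> (norm (x - y - c *\<^sub>C k))\<^sup>2"
      using d[OF ck] d0 by (intro power_mono) (auto simp: algebra_simps)
    also have "\<dots> = d\<^sup>2 - 2 * ((cmod (cinner (x - y) k))\<^sup>2 / (norm k)\<^sup>2) + (cmod c * norm k)\<^sup>2"
      using norm_diff_sq[of "x - y" "c *\<^sub>C k"] by (simp only: re dy norm_scaleC)
    also have "(cmod c * norm k)\<^sup>2 = (cmod (cinner (x - y) k))\<^sup>2 / (norm k)\<^sup>2"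
    proof -
      have "cmod c = cmod (cinner (x - y) k) / (norm k)\<^sup>2" by (simp add: c_def norm_divide norm_power)
      then show ?thesis using False by (simp add: power_mult_distrib power_divide field_simps power2_eq_square)
    qed
    finally have "(cmod (cinner (x - y) k))\<^sup>2 / (norm k)\<^sup>2 \<le> 0" by simp
    then show ?thesis using False by (simp add: divide_le_0_iff)
  qed simp
  with yK show ?thesis by (auto simp: orthogonal_complement_def)
qed

lemma orthogonal_projection_props:
  fixes K :: "'a :: {complex_inner, banach} set"
  assumes K: "csubspace K" "closed K"
  shows "orthogonal_projection K x \<in> K" "x - orthogonal_projection K x \<in> orthogonal_complement K"
proof -
  obtain y where y: "y \<in> K" "x - y \<in> orthogonal_complement K"
    using projection_exists[OF K] by blast
  have "y' = y" if "y' \<in> K" "x - y' \<in> orthogonal_complement K" for y'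
  proof -
    have "y' - y \<in> K" using csubspace_closed_ops(3)[OF K(1)] that y by blast
    moreover have "(x - y) - (x - y') \<in> orthogonal_complement K"
      using csubspace_closed_ops(3)[OF csubspace_orthogonal_complement] that y by blast
    ultimately have "cinner (y' - y) (y' - y) = 0" by (simp add: orthogonal_complement_def)
    then show ?thesis by (simp add: cinner_self)
  qed
  then have "\<exists>!y. y \<in> K \<and> x - y \<in> orthogonal_complement K" using y by blast
  from theI'[OF this] show "orthogonal_projection K x \<in> K"
    "x - orthogonal_projection K x \<in> orthogonal_complement K"
    by (simp_all add: orthogonal_projection_def)
qed

lemma orthogonal_projection_unique:
  fixes K :: "'a :: {complex_inner, banach} set"
  assumes K: "csubspace K" "closed K" and "y \<in> K" "x - y \<in> orthogonal_complement K"
  shows "orthogonal_projection K x = y"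
proof -
  let ?p = "orthogonal_projection K x"
  have "?p - y \<in> K"
    using csubspace_closed_ops(3)[OF K(1)] assms(3) orthogonal_projection_props(1)[OF K] by blast
  moreover have "(x - y) - (x - ?p) \<in> orthogonal_complement K"
    using csubspace_closed_ops(3)[OF csubspace_orthogonal_complement] assms(4)
      orthogonal_projection_props(2)[OF K] by blast
  ultimately have "cinner (?p - y) (?p - y) = 0" by (simp add: orthogonal_complement_def)
  then show ?thesis by (simp add: cinner_self)
qed

lemma double_orthogonal_complement:
  fixes M :: "'a :: {complex_inner, banach} set"
  assumes M: "csubspace M" "closed M"
    and x: "x \<in> orthogonal_complement (orthogonal_complement M)"
  shows "x \<in> M"
proof -
  obtain y where y: "y \<in> M" "x - y \<in> orthogonal_complement M"
    using projection_exists[OF M] by blast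
  have "cinner x (x - y) = 0" using x y(2) by (simp add: orthogonal_complement_def)
  moreover have "cinner y (x - y) = 0"
    using y by (subst cinner_commute) (simp add: orthogonal_complement_def)
  ultimately have "cinner (x - y) (x - y) = 0" by (simp add: cinner_diff_left)
  then show ?thesis using y(1) by (simp add: cinner_self)
qed

section \<open>Bounded operators: closed range, lower bounds and adjoints\<close>

lemma bounded_op_onD:
  assumes "bounded_op_on K T" "x \<in> K"
  shows "T x \<in> K" "y \<in> K \<Longrightarrow> T (x + y) = T x + T y" "T (a *\<^sub>C x) = a *\<^sub>C T x"
  using assms by (auto simp: bounded_op_on_def)

lemma bounded_op_on_diff:
  assumes "csubspace K" "bounded_op_on K T" "x \<in> K" "y \<in> K"
  shows "T (x - y) = T x - T y"
proof -
  have "T (x + (-1) *\<^sub>C y) = T x + (-1) *\<^sub>C T y"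
    using assms bounded_op_onD csubspace_closed_ops(4)[OF assms(1,4)] by metis
  then show ?thesis by (simp add: scaleC_minus_one)
qed

lemma bounded_op_on_bound:
  assumes "bounded_op_on K T"
  obtains B where "B > 0" "\<And>x. x \<in> K \<Longrightarrow> norm (T x) \<le> B * norm x"
proof -
  obtain B where B: "\<forall>x\<in>K. norm (T x) \<le> B * norm x" using assms by (auto simp: bounded_op_on_def)
  have "norm (T x) \<le> (\<bar>B\<bar> + 1) * norm x" if "x \<in> K" for x
    by (rule order.trans[OF B[rule_format, OF that]]) (intro mult_right_mono; simp)
  then show thesis using that[of "\<bar>B\<bar> + 1"] by auto
qed

lemma bounded_op_on_tendsto:
  assumes "csubspace K" "bounded_op_on K T" "\<And>n. X n \<in> K" "x \<in> K" "X \<longlonglongrightarrow> x"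
  shows "(\<lambda>n. T (X n)) \<longlonglongrightarrow> T x"
proof -
  obtain B where B: "B > 0" "\<And>x. x \<in> K \<Longrightarrow> norm (T x) \<le> B * norm x"
    using bounded_op_on_bound[OF assms(2)] by blast
  show ?thesis
  proof (rule Lim_null_comparison[THEN LIM_zero_cancel])
    show "\<forall>\<^sub>F n in sequentially. norm (T (X n) - T x) \<le> B * norm (X n - x)"
      using B(2) csubspace_closed_ops(3)[OF assms(1)] assms
      by (simp flip: bounded_op_on_diff[OF assms(1,2)])
    show "(\<lambda>n. B * norm (X n - x)) \<longlonglongrightarrow> 0"
      using assms(5) by (intro tendsto_mult_right_zero tendsto_norm_zero LIM_zero)
  qed
qed

lemma csubspace_range:
  assumes "csubspace K" "bounded_op_on K T"
  shows "csubspace (T ` K)"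
proof (rule csubspaceI)
  have "T (0 - 0) = T 0 - T 0"
    by (rule bounded_op_on_diff[OF assms]) (auto intro: csubspace_closed_ops assms)
  then show "0 \<in> T ` K" using csubspace_closed_ops(1)[OF assms(1)] by (metis diff_self image_eqI)
next
  fix x y assume "x \<in> T ` K" "y \<in> T ` K"
  then obtain u v where "u \<in> K" "v \<in> K" "x = T u" "y = T v" by blast
  then show "x + y \<in> T ` K"
    using bounded_op_onD(2)[OF assms(2)] csubspace_closed_ops(2)[OF assms(1)]
    by (intro image_eqI[of _ _ "u + v"]) auto
next
  fix a x assume "x \<in> T ` K"
  then obtain u where "u \<in> K" "x = T u" by blast
  then show "a *\<^sub>C x \<in> T ` K"
    using bounded_op_onD(3)[OF assms(2)] csubspace_closed_ops(4)[OF assms(1)]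
    by (intro image_eqI[of _ _ "a *\<^sub>C u"]) auto
qed

lemma closed_range_of_bounded_below:
  fixes K :: "'a :: {complex_inner, banach} set"
  assumes K: "csubspace K" "closed K" and T: "bounded_op_on K T"
    and c: "c > 0" "\<And>x. x \<in> K \<Longrightarrow> c * norm x \<le> norm (T x)"
  shows "closed (T ` K)"
proof (unfold closed_sequential_limits, safe)
  fix Y y assume Y: "\<forall>n. Y n \<in> T ` K" "Y \<longlonglongrightarrow> y"
  then have "\<forall>n. \<exists>x. x \<in> K \<and> Y n = T x" by blast
  from choice[OF this] obtain X where X: "\<And>n. X n \<in> K" "\<And>n. Y n = T (X n)" by blast
  have "Cauchy X"
  proof (rule CauchyI)
    fix e :: real assume "e > 0"
    then obtain N where N: "\<And>m n. m \<ge> N \<Longrightarrow> n \<ge> N \<Longrightarrow> norm (Y m - Y n) < c * e"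
      using CauchyD[OF LIMSEQ_imp_Cauchy[OF Y(2)], of "c * e"] c(1) by auto
    have "norm (X m - X n) < e" if "m \<ge> N" "n \<ge> N" for m n
    proof -
      have "c * norm (X m - X n) \<le> norm (Y m - Y n)"
        using c(2)[OF csubspace_closed_ops(3)[OF K(1) X(1) X(1)], of m n] X
        by (simp add: bounded_op_on_diff[OF K(1) T])
      then show ?thesis using N[OF that] c(1) by (metis le_less_trans mult_less_cancel_left_pos)
    qed
    then show "\<exists>M. \<forall>m\<ge>M. \<forall>n\<ge>M. norm (X m - X n) < e" by blast
  qed
  then obtain x where x: "X \<longlonglongrightarrow> x" using Cauchy_convergent convergent_def by blast
  have xK: "x \<in> K" using K(2) x X(1) unfolding closed_sequential_limits by blast
  have "Y \<longlonglongrightarrow> T x" using bounded_op_on_tendsto[OF K(1) T X(1) xK x] X(2) by presburger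
  then show "y \<in> T ` K" using Y(2) LIMSEQ_unique xK by blast
qed

text \<open>As in the open mapping theorem, Baire's theorem yields approximate preimages of controlled
  norm, and a geometric series makes them exact.\<close>

lemma bounded_below_of_closed_range:
  fixes K :: "'a :: {complex_inner, banach} set"
  assumes K: "csubspace K" "closed K" and T: "bounded_op_on K T"
    and inj: "\<And>x. x \<in> K \<Longrightarrow> T x = 0 \<Longrightarrow> x = 0" and R: "closed (T ` K)"
  shows "\<exists>c>0. \<forall>x\<in>K. c * norm x \<le> norm (T x)"
proof -
  define R where "R = T ` K"
  have Rsub: "csubspace R" unfolding R_def by (rule csubspace_range[OF K(1) T])
  have Rcl: "closed R" using assms(5) by (simp add: R_def)
  \<comment> \<open>These closed sets cover the complete space R, so one of them has interior points
    relative to R.\<close>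
  define V where "V n = closure (T ` (K \<inter> cball 0 (real n)))" for n
  have VR: "V n \<subseteq> R" for n
    unfolding V_def using Rcl by (intro closure_minimal) (auto simp: R_def)
  have cover: "\<Union>(range V) = R"
  proof
    show "\<Union>(range V) \<subseteq> R" using VR by blast
    show "R \<subseteq> \<Union>(range V)"
    proof
      fix y assume "y \<in> R"
      then obtain x where x: "x \<in> K" "y = T x" by (auto simp: R_def)
      obtain n where "norm x \<le> real n" using real_arch_simple by blast
      then have "y \<in> T ` (K \<inter> cball 0 (real n))" using x by auto
      then have "y \<in> V n" unfolding V_def by (rule subsetD[OF closure_subset])
      then show "y \<in> \<Union>(range V)" by blast
    qed
  qed
  have "\<exists>n. top_of_set R interior_of V n \<noteq> {}"
  proof (rule ccontr)
    assume "\<nexists>n. top_of_set R interior_of V n \<noteq> {}"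
    moreover have "completely_metrizable_space (top_of_set R)"
      using Rcl completely_metrizable_space_closedin completely_metrizable_space_euclidean closed_closedin by blast
    moreover have "closedin (top_of_set R) (V n)" for n
      using VR by (intro closed_subset) (auto simp: V_def)
    ultimately have "top_of_set R interior_of \<Union>(range V) = {}"
      by (intro Baire_category_alt) auto
    moreover have "0 \<in> R" using csubspace_closed_ops(1)[OF Rsub] .
    ultimately show False unfolding cover by (metis empty_iff interior_of_topspace topspace_euclidean_subtopology)
  qed
  then obtain n y0 where "y0 \<in> top_of_set R interior_of V n" by blast
  then obtain U where "openin (top_of_set R) U" "y0 \<in> U" "U \<subseteq> V n"
    by (auto simp: interior_of_def)
  then obtain e where e: "e > 0" "ball y0 e \<inter> R \<subseteq> V n" and y0: "y0 \<in> R" "y0 \<in> V n"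
    unfolding openin_contains_ball by (metis order.trans subsetD)
  \<comment> \<open>Differences of two points close to \<open>y0\<close> fill a ball about 0; the
    price is a doubled radius for the preimages.\<close>
  have small: "y \<in> closure (T ` (K \<inter> cball 0 (2 * real n)))" if y: "y \<in> R" "norm y < e" for y
  proof -
    have "y0 + y \<in> V n"
      using e(2) y0(1) y csubspace_closed_ops(2)[OF Rsub] by (auto simp: dist_norm)
    then obtain A B where A: "\<And>k. A k \<in> T ` (K \<inter> cball 0 (real n))" "A \<longlonglongrightarrow> y0 + y"
      and B: "\<And>k. B k \<in> T ` (K \<inter> cball 0 (real n))" "B \<longlonglongrightarrow> y0"
      using y0(2) unfolding V_def closure_sequential by metis
    have "A k - B k \<in> T ` (K \<inter> cball 0 (2 * real n))" for k
    proof -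
      obtain a b where ab: "a \<in> K" "norm a \<le> n" "A k = T a" "b \<in> K" "norm b \<le> n" "B k = T b"
        using A(1)[of k] B(1)[of k] by auto
      have "norm (a - b) \<le> 2 * real n" using norm_triangle_ineq4[of a b] ab by linarith
      moreover have "A k - B k = T (a - b)" using ab bounded_op_on_diff[OF K(1) T] by simp
      ultimately show ?thesis using csubspace_closed_ops(3)[OF K(1)] ab by auto
    qed
    moreover have "(\<lambda>k. A k - B k) \<longlonglongrightarrow> y" using tendsto_diff[OF A(2) B(2)] by simp
    ultimately show ?thesis unfolding closure_sequential by (intro exI[of _ "\<lambda>k. A k - B k"]) simp
  qed
  \<comment> \<open>Scaling y to norm e / 2 gives an approximate preimage of norm at most 2 n, and
    undoing the scaling multiplies this by 2 norm y / e.\<close>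
  define C where "C = 4 * real n / e"
  have approx: "\<exists>x\<in>K. norm x \<le> C * norm y \<and> norm (y - T x) \<le> norm y / 2" if y: "y \<in> R" for y
  proof (cases "y = 0")
    case True
    have "T 0 = 0" using bounded_op_on_diff[OF K(1) T, of 0 0] csubspace_closed_ops(1)[OF K(1)] by simp
    then show ?thesis using True csubspace_closed_ops(1)[OF K(1)] by (intro bexI[of _ 0]) auto
  next
    case False
    define s where "s = e / (2 * norm y)"
    have s: "s > 0" using e False by (simp add: s_def)
    have "s *\<^sub>R y \<in> R" "norm (s *\<^sub>R y) < e"
      using csubspace_scaleR[OF Rsub y] e False by (auto simp: s_def)
    from small[OF this] obtain z where z: "z \<in> T ` (K \<inter> cball 0 (2 * real n))" "dist z (s *\<^sub>R y) < s * norm y / 2"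
      unfolding closure_approachable using s False by (metis half_gt_zero mult_pos_pos zero_less_norm_iff)
    then obtain x where x: "x \<in> K" "norm x \<le> 2 * real n" "z = T x" by auto
    have "T ((1/s) *\<^sub>R x) = (1/s) *\<^sub>R T x"
      using bounded_op_onD(3)[OF T x(1), of "complex_of_real (1/s)"] unfolding scaleC_of_real .
    moreover have "y - (1/s) *\<^sub>R T x = (1/s) *\<^sub>R (s *\<^sub>R y - T x)" using s by (simp add: scaleR_right_diff_distrib)
    ultimately have "norm (y - T ((1/s) *\<^sub>R x)) = (1/s) * dist z (s *\<^sub>R y)"
      using s x by (simp add: dist_norm norm_minus_commute)
    also have "\<dots> \<le> norm y / 2" using z(2) s by (simp add: field_simps)
    finally have 1: "norm (y - T ((1/s) *\<^sub>R x)) \<le> norm y / 2" .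
    have "norm ((1/s) *\<^sub>R x) = (1/s) * norm x" using s by simp
    also have "\<dots> \<le> (1/s) * (2 * real n)" using x(2) s by (intro mult_left_mono) auto
    also have "\<dots> = C * norm y" using False e by (simp add: s_def C_def)
    finally have 2: "norm ((1/s) *\<^sub>R x) \<le> C * norm y" .
    then show ?thesis using 1 csubspace_scaleR[OF K(1) x(1), of "1/s"] by (intro bexI[of _ "(1/s) *\<^sub>R x"]) auto
  qed
  then obtain g where g: "\<And>y. y \<in> R \<Longrightarrow> g y \<in> K \<and> norm (g y) \<le> C * norm y \<and> norm (y - T (g y)) \<le> norm y / 2"
    by metis
  have C0: "C \<ge> 0" using e by (simp add: C_def)
  have main: "norm x \<le> (2 * C) * norm (T x)" if x: "x \<in> K" for x
  proof -
    \<comment> \<open>\<open>s k\<close> is what remains of \<open>T x\<close> after k corrections.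
      The sum of all corrections is an exact preimage, and injectivity identifies it with x.\<close>
    define s where "s = (\<lambda>k. ((\<lambda>y. y - T (g y)) ^^ k) (T x))"
    have s0: "s 0 = T x" and sSuc: "s (Suc k) = s k - T (g (s k))" for k by (simp_all add: s_def)
    have sR: "s k \<in> R" for k
    proof (induction k)
      case 0 then show ?case using x by (auto simp: s0 R_def)
    next
      case (Suc k)
      then show ?case using csubspace_closed_ops(3)[OF Rsub] g[OF Suc] by (auto simp: sSuc R_def)
    qed
    have sn: "norm (s k) \<le> norm (T x) * (1/2) ^ k" for k
    proof (induction k)
      case (Suc k)
      have "norm (s (Suc k)) \<le> norm (s k) / 2" using g[OF sR[of k]] by (simp add: sSuc)
      then show ?case using Suc by simp
    qed (simp add: s0)
    have gn: "norm (g (s k)) \<le> (C * norm (T x)) * (1/2) ^ k" for k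
      using g[OF sR[of k]] mult_left_mono[OF sn[of k] C0] by (simp add: mult.assoc)
    have sm: "summable (\<lambda>k. (C * norm (T x)) * (1/2::real) ^ k)" by (intro summable_mult summable_geometric) simp
    then have sumg: "summable (\<lambda>k. norm (g (s k)))"
      using gn by (intro summable_comparison_test'[OF sm]) simp
    define X where "X m = (\<Sum>k<m. g (s k))" for m
    have XK: "X m \<in> K" for m unfolding X_def using g[OF sR] by (intro csubspace_sum[OF K(1)]) blast
    have TX: "T (X m) = T x - s m" for m
    proof (induction m)
      case 0
      have "T 0 = 0" using bounded_op_on_diff[OF K(1) T, of 0 0] csubspace_closed_ops(1)[OF K(1)] by simp
      then show ?case by (simp add: X_def s0)
    next
      case (Suc m)
      have "T (X (Suc m)) = T (X m) + T (g (s m))"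
        using bounded_op_onD(2)[OF T XK[of m]] g[OF sR[of m]] by (simp add: X_def)
      then show ?case using Suc by (simp add: sSuc)
    qed
    have Xlim: "X \<longlonglongrightarrow> (\<Sum>k. g (s k))" unfolding X_def using summable_norm_cancel[OF sumg] by (rule summable_LIMSEQ)
    let ?u = "\<Sum>k. g (s k)"
    have uK: "?u \<in> K" using K(2) Xlim XK unfolding closed_sequential_limits by blast
    have "s \<longlonglongrightarrow> 0"
    proof (rule Lim_null_comparison)
      show "\<forall>\<^sub>F k in sequentially. norm (s k) \<le> norm (T x) * (1/2) ^ k" using sn by simp
      show "(\<lambda>k. norm (T x) * (1/2::real) ^ k) \<longlonglongrightarrow> 0" by (intro tendsto_mult_right_zero LIMSEQ_power_zero) simp
    qed
    then have "(\<lambda>m. T (X m)) \<longlonglongrightarrow> T x - 0" unfolding TX by (intro tendsto_intros)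
    then have "T ?u = T x"
      using bounded_op_on_tendsto[OF K(1) T XK uK Xlim] LIMSEQ_unique by auto
    then have "?u = x"
      using inj[OF csubspace_closed_ops(3)[OF K(1) uK x]] bounded_op_on_diff[OF K(1) T uK x] by simp
    then have "norm x \<le> (\<Sum>k. norm (g (s k)))" using summable_norm[OF sumg] by simp
    also have "\<dots> \<le> (\<Sum>k. (C * norm (T x)) * (1/2) ^ k)" by (rule suminf_le[OF gn sumg sm])
    also have "\<dots> = 2 * C * norm (T x)" by (subst suminf_mult) (auto simp: suminf_geometric)
    finally show ?thesis .
  qed
  show ?thesis
  proof (intro exI[of _ "1 / (2 * C + 1)"] conjI ballI)
    fix x assume x: "x \<in> K"
    have "norm x \<le> (2 * C + 1) * norm (T x)"
      by (rule order.trans[OF main[OF x]]) (intro mult_right_mono; simp)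
    then show "1 / (2 * C + 1) * norm x \<le> norm (T x)" using C0 by (simp add: field_simps)
  qed (use C0 in simp)
qed

text \<open>If \<open>T\<close> is bounded below, \<open>T\<^sup>* T\<close> is coercive, so \<open>x \<mapsto> x - \<epsilon> (T\<^sup>* T x - y)\<close> is a
  contraction for small \<open>\<epsilon>\<close>.\<close>

lemma adjoint_surjective:
  fixes K :: "'a :: {complex_inner, banach} set"
  assumes K: "csubspace K" "closed K" and T: "bounded_op_on K T" and T': "bounded_op_on K T'"
    and adj: "\<And>x y. x \<in> K \<Longrightarrow> y \<in> K \<Longrightarrow> cinner (T x) y = cinner x (T' y)"
    and c: "c > 0" "\<And>x. x \<in> K \<Longrightarrow> c * norm x \<le> norm (T x)" and y: "y \<in> K"
  shows "\<exists>x\<in>K. T' x = y"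
proof -
  obtain B where B: "B > 0" "\<And>x. x \<in> K \<Longrightarrow> norm (T x) \<le> B * norm x"
    using bounded_op_on_bound[OF T] by blast
  obtain B' where B': "B' > 0" "\<And>x. x \<in> K \<Longrightarrow> norm (T' x) \<le> B' * norm x"
    using bounded_op_on_bound[OF T'] by blast
  \<comment> \<open>The maximum keeps \<open>c\<^sup>2 / C\<close> at most 1, so that the radicand
    of q is nonnegative.\<close>
  define C where "C = max (B' * B) (c\<^sup>2)"
  have C: "C > 0" "C \<ge> c\<^sup>2" using c(1) by (auto simp: C_def less_max_iff_disj)
  have AC: "norm (T' (T x)) \<le> C * norm x" if "x \<in> K" for x
  proof -
    have "norm (T' (T x)) \<le> B' * norm (T x)" using B'(2) bounded_op_onD(1)[OF T that] .
    also have "\<dots> \<le> B' * (B * norm x)" using B(2)[OF that] B'(1) by (intro mult_left_mono) auto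
    also have "\<dots> \<le> C * norm x" by (simp add: C_def mult_right_mono flip: mult.assoc)
    finally show ?thesis .
  qed
  \<comment> \<open>The minimizer of 1 - 2 \<epsilon> c^2 + \<epsilon>^2 C^2, whose minimum is the
    square of the contraction constant q.\<close>
  define \<epsilon> where "\<epsilon> = c\<^sup>2 / C\<^sup>2"
  have \<epsilon>: "\<epsilon> > 0" using C c by (simp add: \<epsilon>_def)
  define q where "q = sqrt (1 - (c\<^sup>2 / C)\<^sup>2)"
  have frac: "0 < c\<^sup>2 / C" "c\<^sup>2 / C \<le> 1" using C c by auto
  then have q2: "1 - (c\<^sup>2 / C)\<^sup>2 \<ge> 0" by (simp add: power_le_one)
  have q: "0 \<le> q" "q < 1" using frac q2 by (auto simp: q_def real_sqrt_less_iff[of _ 1, simplified])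
  define F where "F x = x - \<epsilon> *\<^sub>R (T' (T x) - y)" for x
  have "\<exists>!x\<in>K. F x = x"
  proof (rule Banach_fix[OF _ _ q])
    show "complete K" using K(2) by (simp add: complete_eq_closed)
    show "K \<noteq> {}" using y by blast
    show "F ` K \<subseteq> K"
      using y bounded_op_onD(1)[OF T] bounded_op_onD(1)[OF T']
      by (auto simp: F_def intro!: csubspace_closed_ops(3)[OF K(1)] csubspace_scaleR[OF K(1)])
    fix u v assume uv: "u \<in> K" "v \<in> K"
    define x where "x = u - v"
    have xK: "x \<in> K" using csubspace_closed_ops(3)[OF K(1)] uv by (simp add: x_def)
    have TT: "T' (T x) = T' (T u) - T' (T v)"
      using uv by (simp add: x_def bounded_op_on_diff[OF K(1) T] bounded_op_on_diff[OF K(1) T'] bounded_op_onD(1)[OF T])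
    have "cinner x (T' (T x)) = complex_of_real ((norm (T x))\<^sup>2)"
      using adj[OF xK bounded_op_onD(1)[OF T xK]] by (simp add: cinner_self)
    then have re: "Re (cinner x (T' (T x))) = (norm (T x))\<^sup>2" by simp
    have "(norm (F u - F v))\<^sup>2 = (norm (x - \<epsilon> *\<^sub>R T' (T x)))\<^sup>2"
      by (simp add: F_def x_def TT[unfolded x_def] algebra_simps)
    also have "\<dots> = (norm x)\<^sup>2 - 2 * \<epsilon> * (norm (T x))\<^sup>2 + \<epsilon>\<^sup>2 * (norm (T' (T x)))\<^sup>2"
      using re unfolding norm_diff_sq Re_cinner inner_scaleR_right by (simp add: power_mult_distrib)
    also have "\<dots> \<le> (norm x)\<^sup>2 - 2 * \<epsilon> * (c * norm x)\<^sup>2 + \<epsilon>\<^sup>2 * (C * norm x)\<^sup>2"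
    proof -
      have "(c * norm x)\<^sup>2 \<le> (norm (T x))\<^sup>2" using c(1) c(2)[OF xK] by (intro power_mono) auto
      moreover have "(norm (T' (T x)))\<^sup>2 \<le> (C * norm x)\<^sup>2" using AC[OF xK] by (intro power_mono) auto
      ultimately show ?thesis using \<epsilon> by (intro add_mono diff_mono mult_left_mono) auto
    qed
    also have "\<dots> = q\<^sup>2 * (norm x)\<^sup>2"
      using C q2 by (simp add: q_def \<epsilon>_def field_simps power2_eq_square)
    finally have "(norm (F u - F v))\<^sup>2 \<le> (q * norm x)\<^sup>2" by (simp add: power_mult_distrib)
    then show "dist (F u) (F v) \<le> q * dist u v"
      using q power2_le_imp_le[of "norm (F u - F v)" "q * norm x"] by (simp add: dist_norm x_def)
  qed
  then obtain x where x: "x \<in> K" "F x = x" by blast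
  then have "T' (T x) = y" using \<epsilon> by (simp add: F_def)
  then show ?thesis using bounded_op_onD(1)[OF T x(1)] by blast
qed

text \<open>The range being closed, x is the sum of some r in it and a vector x - r orthogonal to
  it. The latter is killed by T', hence orthogonal to x as well as to r, and so it is zero.\<close>

lemma mem_range_of_orthogonal_kernel:
  fixes K :: "'a :: {complex_inner, banach} set"
  assumes K: "csubspace K" "closed K" and T: "bounded_op_on K T" and T': "\<And>x. x \<in> K \<Longrightarrow> T' x \<in> K"
    and adj: "\<And>x y. x \<in> K \<Longrightarrow> y \<in> K \<Longrightarrow> cinner (T x) y = cinner x (T' y)"
    and R: "closed (T ` K)" and x: "x \<in> K" "\<And>y. y \<in> K \<Longrightarrow> T' y = 0 \<Longrightarrow> cinner x y = 0"
  shows "x \<in> T ` K"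
proof -
  obtain r where r: "r \<in> T ` K" "x - r \<in> orthogonal_complement (T ` K)"
    using projection_exists[OF csubspace_range[OF K(1) T] R] by blast
  have rK: "r \<in> K" using r(1) bounded_op_onD(1)[OF T] by blast
  have dK: "x - r \<in> K" using csubspace_closed_ops(3)[OF K(1) x(1) rK] .
  have "cinner (T' (x - r)) (T' (x - r)) = 0"
  proof -
    have "cinner (T (T' (x - r))) (x - r) = 0"
      using r(2) T'[OF dK] by (subst cinner_commute) (auto simp: orthogonal_complement_def)
    then show ?thesis using adj[OF T'[OF dK] dK] by simp
  qed
  then have "cinner x (x - r) = 0" using x(2)[OF dK] by (simp add: cinner_self)
  moreover have "cinner r (x - r) = 0"
    using r by (subst cinner_commute) (auto simp: orthogonal_complement_def)
  ultimately have "cinner (x - r) (x - r) = 0" by (simp add: cinner_diff_left)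
  then show ?thesis using r(1) by (simp add: cinner_self)
qed

section \<open>Finite-dimensional linear algebra\<close>

text \<open>Gaussian elimination: an unknown occurring in equation j is expressed by the others and
  substituted into the remaining equations.\<close>

lemma homogeneous_system_solution:
  fixes v :: "'i \<Rightarrow> 'j \<Rightarrow> complex"
  assumes "finite J" "finite I" "card J < card I"
  shows "\<exists>r. (\<exists>i\<in>I. r i \<noteq> 0) \<and> (\<forall>j\<in>J. (\<Sum>i\<in>I. r i * v i j) = 0)"
  using assms
proof (induction J arbitrary: I v rule: finite_induct)
  case empty
  then have "I \<noteq> {}" by auto
  then show ?case by (intro exI[of _ "\<lambda>_. 1"]) auto
next
  case (insert j J)
  show ?case
  proof (cases "\<forall>i\<in>I. v i j = 0")
    case True
    obtain r where "\<exists>i\<in>I. r i \<noteq> 0" "\<forall>k\<in>J. (\<Sum>i\<in>I. r i * v i k) = 0"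
      using insert.IH[of I v] insert.prems insert.hyps by auto
    then show ?thesis using True by (intro exI[of _ r]) auto
  next
    case False
    then obtain i0 where i0: "i0 \<in> I" "v i0 j \<noteq> 0" by blast
    define I' where "I' = I - {i0}"
    have fin: "finite I'" "i0 \<notin> I'" "I = insert i0 I'" using insert.prems i0 by (auto simp: I'_def)
    have "card J < card I'" using insert.prems insert.hyps fin by simp
    from insert.IH[OF fin(1) this, of "\<lambda>i k. v i k - v i j / v i0 j * v i0 k"]
    obtain r where r: "\<exists>i\<in>I'. r i \<noteq> 0"
      "\<And>k. k \<in> J \<Longrightarrow> (\<Sum>i\<in>I'. r i * (v i k - v i j / v i0 j * v i0 k)) = 0" by blast
    define r' where "r' = r(i0 := - (\<Sum>i\<in>I'. r i * v i j) / v i0 j)"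
    have eq: "(\<Sum>i\<in>I. r' i * v i k) = (\<Sum>i\<in>I'. r i * v i k) - (\<Sum>i\<in>I'. r i * v i j) / v i0 j * v i0 k" for k
    proof -
      have "(\<Sum>i\<in>I'. r' i * v i k) = (\<Sum>i\<in>I'. r i * v i k)"
        using fin(2) by (intro sum.cong) (auto simp: r'_def)
      then show ?thesis using fin by (simp add: r'_def)
    qed
    have "(\<Sum>i\<in>I. r' i * v i k) = 0" if "k \<in> insert j J" for k
    proof (cases "k = j")
      case True
      then show ?thesis using eq[of j] i0 by simp
    next
      case False
      then have "k \<in> J" using that by simp
      from r(2)[OF this] show ?thesis
        by (simp add: eq algebra_simps sum_subtractf sum_distrib_left sum_distrib_right sum_divide_distrib)
    qed
    moreover have "\<exists>i\<in>I. r' i \<noteq> 0" using r(1) fin by (force simp: r'_def)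
    ultimately show ?thesis by blast
  qed
qed

text \<open>A finite basis is part of the notion, since \<open>cdim V = 0\<close> alone would not
  exclude an infinite-dimensional V.\<close>

definition has_cdim :: "'a::complex_inner set \<Rightarrow> nat \<Rightarrow> bool" where
  "has_cdim V n \<longleftrightarrow> (\<exists>B. finite B \<and> card B = n \<and> \<not> complex_vector.dependent B \<and> cspan B = V)"

lemma has_cdim_cdim: "has_cdim V n \<Longrightarrow> cdim V = n"
  unfolding has_cdim_def
  by (metis complex_vector.dim_eq_card complex_vector.span_span)

lemma has_cdim_0_iff: "has_cdim V 0 \<longleftrightarrow> V = {0}"
proof
  assume "V = {0}"
  then show "has_cdim V 0"
    unfolding has_cdim_def by (intro exI[of _ "{}"]) (simp add: complex_vector.independent_empty)
qed (auto simp: has_cdim_def)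

text \<open>Orthogonality to W amounts to n linear conditions; if m exceeded n, a nonzero vector of
  V would satisfy them all. Dimensions of kernels at nearby points are compared in this way.\<close>

lemma has_cdim_mono:
  assumes V: "has_cdim V m" and W: "has_cdim W n"
    and orth: "\<And>x. x \<in> V \<Longrightarrow> (\<And>y. y \<in> W \<Longrightarrow> cinner x y = 0) \<Longrightarrow> x = 0"
  shows "m \<le> n"
proof (rule ccontr)
  assume "\<not> m \<le> n"
  obtain B where B: "finite B" "card B = m" "\<not> complex_vector.dependent B" "cspan B = V"
    using V by (auto simp: has_cdim_def)
  obtain C where C: "finite C" "card C = n" "cspan C = W"
    using W by (auto simp: has_cdim_def)
  obtain r where r: "\<exists>b\<in>B. r b \<noteq> 0" "\<And>c. c \<in> C \<Longrightarrow> (\<Sum>b\<in>B. r b * cinner b c) = 0"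
    using homogeneous_system_solution[of C B cinner] B(1,2) C(1,2) \<open>\<not> m \<le> n\<close> by auto
  define x where "x = (\<Sum>b\<in>B. r b *\<^sub>C b)"
  have "x \<in> V" unfolding x_def B(4)[symmetric]
    by (intro complex_vector.span_sum complex_vector.span_scale complex_vector.span_base)
  moreover have "cinner x y = 0" if "y \<in> W" for y
  proof -
    have "csubspace {y. cinner x y = 0}" by (rule csubspaceI) (auto simp: cinner_simps)
    moreover have "C \<subseteq> {y. cinner x y = 0}"
      using r(2) by (auto simp: x_def cinner_sum_left cinner_scaleC_left)
    ultimately have "cspan C \<subseteq> {y. cinner x y = 0}"
      by (rule complex_vector.span_minimal[rotated])
    then show ?thesis using that C(3) by auto
  qed
  ultimately have "x = 0" using orth by blast
  then have "complex_vector.dependent B"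
    unfolding x_def complex_vector.dependent_finite[OF B(1)] using r(1) by (intro exI[of _ r]) simp
  then show False using B(3) by blast
qed

text \<open>Rank and nullity with a one-dimensional kernel: lifts of a basis of W together with e
  form a basis. It adds one zero of the fiber at a time to the dimension count.\<close>

lemma has_cdim_preimage:
  assumes V: "csubspace V" and W: "has_cdim W n" and e: "e \<in> V" "e \<noteq> 0"
    and A: "\<And>x y. x \<in> V \<Longrightarrow> y \<in> V \<Longrightarrow> A (x + y) = A x + A y" "\<And>a x. x \<in> V \<Longrightarrow> A (a *\<^sub>C x) = a *\<^sub>C A x"
    and ker: "\<And>x. x \<in> V \<Longrightarrow> A x = 0 \<longleftrightarrow> (\<exists>a. x = a *\<^sub>C e)"
    and surj: "\<And>y. y \<in> W \<Longrightarrow> \<exists>x\<in>V. A x = y"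
  shows "has_cdim {x \<in> V. A x \<in> W} (Suc n)"
proof -
  obtain B where B: "finite B" "card B = n" "\<not> complex_vector.dependent B" "cspan B = W"
    using W by (auto simp: has_cdim_def)
  have BW: "B \<subseteq> W" using B(4) complex_vector.span_superset by blast
  obtain g where g: "\<And>b. b \<in> B \<Longrightarrow> g b \<in> V \<and> A (g b) = b" using surj BW by (metis subsetD)
  have ginj: "inj_on g B" using g by (metis inj_onI)
  have A0: "A 0 = 0" using A(2)[OF csubspace_closed_ops(1)[OF V], of 0] by simp
  have Asum: "A (\<Sum>b\<in>S. u b *\<^sub>C g b) = (\<Sum>b\<in>S. u b *\<^sub>C b)" if "S \<subseteq> B" for S u
    using finite_subset[OF that B(1)] that
  proof (induction S rule: finite_induct)
    case (insert b S)
    have 1: "(\<Sum>b\<in>S. u b *\<^sub>C g b) \<in> V"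
      using insert.prems g by (intro csubspace_sum[OF V] csubspace_closed_ops(4)[OF V]) auto
    have 2: "u b *\<^sub>C g b \<in> V" using insert.prems g csubspace_closed_ops(4)[OF V] by auto
    show ?case using insert g A(1)[OF 2 1] A(2)[of "g b" "u b"] by simp
  qed (simp add: A0)
  define C where "C = insert e (g ` B)"
  have e0: "A e = 0" using ker[OF e(1)] by (metis scaleC_one)
  have "e \<notin> g ` B"
  proof
    assume "e \<in> g ` B"
    then have "0 \<in> B" using g e0 by auto
    then show False using B(3) complex_vector.dependent_zero by blast
  qed
  then have C: "finite C" "card C = Suc n" using B ginj by (auto simp: C_def card_image)
  have CV: "C \<subseteq> {x \<in> V. A x \<in> W}"
    using g BW e e0 complex_vector.span_zero[of B] B(4) by (auto simp: C_def)
  have Wsub: "csubspace W" using B(4) complex_vector.subspace_span by blast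
  have sub: "csubspace {x \<in> V. A x \<in> W}"
    using csubspace_closed_ops[OF V] csubspace_closed_ops[OF Wsub] A A0 by (intro csubspaceI) auto
  have indep: "\<not> complex_vector.dependent C"
  proof
    assume "complex_vector.dependent C"
    then obtain u where u: "\<exists>v\<in>C. u v \<noteq> 0" "(\<Sum>v\<in>C. u v *\<^sub>C v) = 0"
      unfolding complex_vector.dependent_finite[OF C(1)] by blast
    have s: "u e *\<^sub>C e + (\<Sum>b\<in>B. u (g b) *\<^sub>C g b) = 0"
      using u(2) \<open>e \<notin> g ` B\<close> B(1) by (simp add: C_def sum.reindex[OF ginj])
    have 1: "(\<Sum>b\<in>B. u (g b) *\<^sub>C g b) \<in> V"
      using g by (intro csubspace_sum[OF V] csubspace_closed_ops(4)[OF V]) auto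
    have "A (u e *\<^sub>C e + (\<Sum>b\<in>B. u (g b) *\<^sub>C g b)) = (\<Sum>b\<in>B. u (g b) *\<^sub>C b)"
      using A(1)[OF csubspace_closed_ops(4)[OF V e(1)] 1] A(2)[OF e(1)] e0 Asum[OF order.refl, of "\<lambda>b. u (g b)"]
      by simp
    then have "(\<Sum>b\<in>B. u (g b) *\<^sub>C b) = 0" using s A0 by simp
    then have "complex_vector.dependent B" if "b \<in> B" "u (g b) \<noteq> 0" for b
      unfolding complex_vector.dependent_finite[OF B(1)] using that by (intro exI[of _ "\<lambda>b. u (g b)"]) auto
    then have z: "\<And>b. b \<in> B \<Longrightarrow> u (g b) = 0"
      using B(3) by blast
    then have "u e *\<^sub>C e = 0" using s by simp
    then have "u e = 0" using e(2) by simp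
    then show False using u(1) z by (auto simp: C_def)
  qed
  have "cspan C = {x \<in> V. A x \<in> W}"
  proof
    show "cspan C \<subseteq> {x \<in> V. A x \<in> W}"
      using CV sub by (rule complex_vector.span_minimal)
    show "{x \<in> V. A x \<in> W} \<subseteq> cspan C"
    proof safe
      fix x assume x: "x \<in> V" "A x \<in> W"
      then have "A x \<in> cspan B" using B(4) by simp
      then obtain u where u: "A x = (\<Sum>b\<in>B. u b *\<^sub>C b)"
        unfolding complex_vector.span_finite[OF B(1)] by blast
      define y where "y = (\<Sum>b\<in>B. u b *\<^sub>C g b)"
      have yV: "y \<in> V" unfolding y_def
        using g by (intro csubspace_sum[OF V] csubspace_closed_ops(4)[OF V]) auto
      have my: "(-1) *\<^sub>C y \<in> V" using yV by (rule csubspace_closed_ops(4)[OF V])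
      have "A ((-1) *\<^sub>C y + x) = (-1) *\<^sub>C A y + A x"
        unfolding A(1)[OF my x(1)] A(2)[OF yV] ..
      then have "A ((-1) *\<^sub>C y + x) = 0"
        using Asum[OF order.refl, of u] u by (simp add: y_def scaleC_minus_one)
      then obtain a where "(-1) *\<^sub>C y + x = a *\<^sub>C e"
        using ker[OF csubspace_closed_ops(2)[OF V my x(1)]] by blast
      then have "x = y + a *\<^sub>C e" by (simp add: scaleC_minus_one algebra_simps)
      also have "\<dots> \<in> cspan C" unfolding y_def C_def
        by (intro complex_vector.span_add complex_vector.span_sum complex_vector.span_scale complex_vector.span_base) auto
      finally show "x \<in> cspan C" .
    qed
  qed
  then show ?thesis using C indep by (auto simp: has_cdim_def)
qed

section \<open>The Hardy space as a Hilbert space\<close>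

lemma hcoeff_add [simp]: "hcoeff (f + g) k = hcoeff f k + hcoeff g k"
  by (simp add: plus_hardy2.rep_eq)
lemma hcoeff_diff [simp]: "hcoeff (f - g) k = hcoeff f k - hcoeff g k"
  by (simp add: minus_hardy2.rep_eq)
lemma hcoeff_zero [simp]: "hcoeff 0 k = 0"
  by (simp add: zero_hardy2.rep_eq)
lemma hcoeff_scaleC [simp]: "hcoeff (a *\<^sub>C f) k = a * hcoeff f k"
  by (simp add: scaleC_hardy2.rep_eq)
lemma hardy2_eqI: "(\<And>m n. hcoeff f (m, n) = hcoeff g (m, n)) \<Longrightarrow> f = g"
  by (auto simp: hcoeff_inject[symmetric])

lemma sq_summable_hcoeff: "(\<lambda>k. (cmod (hcoeff f k))\<^sup>2) summable_on UNIV"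
  using hcoeff by auto

lemma norm_sq_hardy2: "(norm f)\<^sup>2 = (\<Sum>\<^sub>\<infinity>k. (cmod (hcoeff f k))\<^sup>2)"
proof -
  have "complex_of_real ((norm f)\<^sup>2) = (\<Sum>\<^sub>\<infinity>k. complex_of_real ((cmod (hcoeff f k))\<^sup>2))"
    unfolding cinner_self[symmetric] cinner_hardy2_def complex_norm_square ..
  also have "\<dots> = complex_of_real (\<Sum>\<^sub>\<infinity>k. (cmod (hcoeff f k))\<^sup>2)"
    by (rule infsumI) (intro has_sum_of_real has_sum_infsum sq_summable_hcoeff)
  finally show ?thesis by (simp only: of_real_eq_iff)
qed

lemma sum_hcoeff_le: "finite F \<Longrightarrow> (\<Sum>k\<in>F. (cmod (hcoeff f k))\<^sup>2) \<le> (norm f)\<^sup>2"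
  unfolding norm_sq_hardy2 by (rule finite_sum_le_infsum[OF sq_summable_hcoeff]) auto

lemma norm_hcoeff_le: "cmod (hcoeff f k) \<le> norm f"
  using sum_hcoeff_le[of "{k}" f] power2_le_imp_le[of "cmod (hcoeff f k)" "norm f"] by simp

lemma sq_summable_of_bound:
  assumes "\<And>F. finite F \<Longrightarrow> (\<Sum>k\<in>F. (cmod (a k))\<^sup>2) \<le> B"
  shows "(\<lambda>k. (cmod (a k))\<^sup>2) summable_on UNIV"
  by (rule nonneg_bdd_above_summable_on) (use assms in \<open>auto intro!: bdd_aboveI2[where M = B]\<close>)

lemma norm_sq_le_of_bound:
  assumes "\<And>F. finite F \<Longrightarrow> (\<Sum>k\<in>F. (cmod (hcoeff f k))\<^sup>2) \<le> B"
  shows "(norm f)\<^sup>2 \<le> B"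
  unfolding norm_sq_hardy2 by (rule infsum_le_finite_sums[OF sq_summable_hcoeff assms]) auto

text \<open>Coefficients converge one by one; the Cauchy bound on each finite set of coefficients
  survives the limit and does not depend on that set.\<close>

instance hardy2 :: banach
proof
  fix X :: "nat \<Rightarrow> hardy2" assume X: "Cauchy X"
  have "Cauchy (\<lambda>i. hcoeff (X i) k)" for k
  proof (rule CauchyI)
    fix e :: real assume "e > 0"
    then obtain N where N: "\<And>i j. i \<ge> N \<Longrightarrow> j \<ge> N \<Longrightarrow> norm (X i - X j) < e"
      using CauchyD[OF X] by blast
    have "cmod (hcoeff (X i) k - hcoeff (X j) k) < e" if "i \<ge> N" "j \<ge> N" for i j
      using norm_hcoeff_le[of "X i - X j" k] N[OF that] by simp
    then show "\<exists>M. \<forall>i\<ge>M. \<forall>j\<ge>M. cmod (hcoeff (X i) k - hcoeff (X j) k) < e" by blast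
  qed
  then have "\<forall>k. \<exists>l. (\<lambda>i. hcoeff (X i) k) \<longlonglongrightarrow> l"
    using Cauchy_convergent convergent_def by blast
  then obtain a where a: "\<And>k. (\<lambda>i. hcoeff (X i) k) \<longlonglongrightarrow> a k" by metis
  have bound: "(\<Sum>k\<in>F. (cmod (a k - hcoeff (X j) k))\<^sup>2) \<le> e\<^sup>2"
    if "finite F" "\<And>i. i \<ge> N \<Longrightarrow> norm (X i - X j) < e" for F j e N
  proof (rule LIMSEQ_le_const2)
    show "(\<lambda>i. \<Sum>k\<in>F. (cmod (hcoeff (X i) k - hcoeff (X j) k))\<^sup>2) \<longlonglongrightarrow> (\<Sum>k\<in>F. (cmod (a k - hcoeff (X j) k))\<^sup>2)"
      by (intro tendsto_intros a)
    have "(\<Sum>k\<in>F. (cmod (hcoeff (X i) k - hcoeff (X j) k))\<^sup>2) \<le> e\<^sup>2" if "i \<ge> N" for i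
    proof -
      have "(norm (X i - X j))\<^sup>2 \<le> e\<^sup>2" using that(1) \<open>\<And>i. i \<ge> N \<Longrightarrow> norm (X i - X j) < e\<close>
        by (intro power_mono) (auto intro: less_imp_le)
      then show ?thesis using sum_hcoeff_le[OF \<open>finite F\<close>, of "X i - X j"] by simp
    qed
    then show "\<exists>M. \<forall>i\<ge>M. (\<Sum>k\<in>F. (cmod (hcoeff (X i) k - hcoeff (X j) k))\<^sup>2) \<le> e\<^sup>2" by blast
  qed
  obtain N1 where N1: "\<And>i j. i \<ge> N1 \<Longrightarrow> j \<ge> N1 \<Longrightarrow> norm (X i - X j) < 1"
    using CauchyD[OF X, of 1] by auto
  have "(\<lambda>k. (cmod (a k - hcoeff (X N1) k))\<^sup>2) summable_on UNIV"
    using bound[of _ N1 N1 1] N1 by (intro sq_summable_of_bound[where B = 1]) auto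
  from sq_summable_add[OF this sq_summable_hcoeff[of "X N1"]]
  have "(\<lambda>k. (cmod (a k))\<^sup>2) summable_on UNIV" by simp
  then have x: "hcoeff (Abs_hardy2 a) = a" by (simp add: Abs_hardy2_inverse)
  have "X \<longlonglongrightarrow> Abs_hardy2 a"
  proof (rule LIMSEQ_I)
    fix e :: real assume "e > 0"
    then obtain N where N: "\<And>i j. i \<ge> N \<Longrightarrow> j \<ge> N \<Longrightarrow> norm (X i - X j) < e / 2"
      using CauchyD[OF X, of "e / 2"] by auto
    have "norm (X j - Abs_hardy2 a) < e" if "j \<ge> N" for j
    proof -
      have "(norm (Abs_hardy2 a - X j))\<^sup>2 \<le> (e / 2)\<^sup>2"
        by (rule norm_sq_le_of_bound) (use bound[of _ N j "e / 2"] N that in \<open>simp add: x\<close>)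
      then have "norm (Abs_hardy2 a - X j) \<le> e / 2"
        using \<open>e > 0\<close> power2_le_imp_le[of _ "e / 2"] by simp
      then show ?thesis using \<open>e > 0\<close> by (simp add: norm_minus_commute)
    qed
    then show "\<exists>no. \<forall>n\<ge>no. norm (X n - Abs_hardy2 a) < e" by blast
  qed
  then show "convergent X" by (auto simp: convergent_def)
qed

lift_definition monomial_zw :: "nat \<times> nat \<Rightarrow> hardy2" is "\<lambda>k l. if l = k then 1 else 0"
proof -
  fix k :: "nat \<times> nat"
  have "(\<lambda>l. (cmod (if l = k then 1 else 0))\<^sup>2) summable_on {k}" by simp
  then show "(\<lambda>l. (cmod (if l = k then 1 else 0))\<^sup>2) summable_on UNIV"
    by (rule summable_on_cong_neutral[THEN iffD1, rotated -1]) auto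
qed

lemma cinner_monomial: "cinner f (monomial_zw k) = hcoeff f k"
proof -
  have "cinner f (monomial_zw k) = (\<Sum>\<^sub>\<infinity>l\<in>{k}. hcoeff f l * cnj (hcoeff (monomial_zw k) l))"
    unfolding cinner_hardy2_def by (rule infsum_cong_neutral) (auto simp: monomial_zw.rep_eq)
  then show ?thesis by (simp add: monomial_zw.rep_eq)
qed

text \<open>Finite combinations of monomials with coefficients from a countable dense set. Their
  closure is a complex subspace containing all monomials, and only 0 is orthogonal to every
  monomial.\<close>

lemma separable_hardy2: "separable_space (euclidean :: hardy2 topology)"
proof -
  obtain D :: "complex set" where D: "countable D" "\<And>X. open X \<Longrightarrow> X \<noteq> {} \<Longrightarrow> \<exists>d\<in>D. d \<in> X"
    using countable_dense_setE by blast
  define S where "S = rec_nat {0 :: hardy2} (\<lambda>_ X. (\<lambda>(x, q, k). x + q *\<^sub>C monomial_zw k) ` (X \<times> D \<times> UNIV))"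
  have S0: "S 0 = {0}" and SS: "S (Suc n) = (\<lambda>(x, q, k). x + q *\<^sub>C monomial_zw k) ` (S n \<times> D \<times> UNIV)" for n
    by (simp_all add: S_def)
  have cS: "countable (S n)" for n
    by (induction n) (use D(1) in \<open>auto simp: S0 SS intro!: countable_image countable_SIGMA\<close>)
  define C where "C = (\<Union>n. S n)"
  have zC: "0 \<in> C" using S0 by (auto simp: C_def)
  have add: "x + y \<in> S (m + n)" if "x \<in> S m" "y \<in> S n" for x y m n
    using that(2)
  proof (induction n arbitrary: y)
    case (Suc n)
    then obtain y' q k where y': "y' \<in> S n" "q \<in> D" "y = y' + q *\<^sub>C monomial_zw k" by (auto simp: SS)
    have "x + y' \<in> S (m + n)" using Suc.IH[OF y'(1)] .
    then show ?case unfolding add_Suc_right SS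
      by (intro image_eqI[of _ _ "(x + y', q, k)"]) (use y' in \<open>auto simp: add.assoc\<close>)
  qed (use that in \<open>simp add: S0\<close>)
  have clC_add: "x + y \<in> closure C" if "x \<in> closure C" "y \<in> closure C" for x y
  proof -
    obtain X where X: "\<And>n. X n \<in> C" "X \<longlonglongrightarrow> x" using \<open>x \<in> closure C\<close> unfolding closure_sequential by blast
    obtain Y where Y: "\<And>n. Y n \<in> C" "Y \<longlonglongrightarrow> y" using \<open>y \<in> closure C\<close> unfolding closure_sequential by blast
    have "X n + Y n \<in> C" for n using X(1)[of n] Y(1)[of n] add unfolding C_def by blast
    then show ?thesis using tendsto_add[OF X(2) Y(2)] unfolding closure_sequential
      by (intro exI[of _ "\<lambda>n. X n + Y n"]) simp
  qed
  have mono: "a *\<^sub>C monomial_zw k \<in> closure C" for a k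
  proof -
    have "\<exists>q\<in>D. cmod (q - a) * norm (monomial_zw k) < e" if "e > 0" for e
    proof -
      have "0 < e / (norm (monomial_zw k) + 1)" using that by (intro divide_pos_pos add_nonneg_pos) auto
      then obtain q where "q \<in> D" "q \<in> ball a (e / (norm (monomial_zw k) + 1))"
        using D(2)[OF open_ball, of a "e / (norm (monomial_zw k) + 1)"] centre_in_ball by blast
      then have "cmod (q - a) * (norm (monomial_zw k) + 1) < e"
        by (simp add: dist_norm norm_minus_commute pos_less_divide_eq add_nonneg_pos)
      moreover have "cmod (q - a) * norm (monomial_zw k) \<le> cmod (q - a) * (norm (monomial_zw k) + 1)"
        by (intro mult_left_mono) auto
      ultimately show ?thesis using \<open>q \<in> D\<close> by force
    qed
    moreover have "q *\<^sub>C monomial_zw k \<in> C" if "q \<in> D" for q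
    proof -
      have "q *\<^sub>C monomial_zw k \<in> S (Suc 0)" using that by (force simp: SS S0)
      then show ?thesis unfolding C_def by blast
    qed
    ultimately show ?thesis unfolding closure_approachable dist_norm
      by (metis complex_vector.scale_left_diff_distrib norm_scaleC)
  qed
  have scl: "a *\<^sub>C x \<in> closure C" if "x \<in> S n" for a x n
    using that
  proof (induction n arbitrary: x)
    case 0
    then show ?case using zC closure_subset by (auto simp: S0)
  next
    case (Suc n)
    then obtain x' q k where x': "x' \<in> S n" "x = x' + q *\<^sub>C monomial_zw k" by (auto simp: SS)
    have "a *\<^sub>C x = a *\<^sub>C x' + (a * q) *\<^sub>C monomial_zw k"
      by (simp add: x' scaleC_add_right scaleC_scaleC)
    then show ?case using clC_add[OF Suc.IH[OF x'(1)] mono[of "a * q" k]] by simp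
  qed
  have sub: "csubspace (closure C)"
  proof (rule csubspaceI)
    show "0 \<in> closure C" using zC closure_subset by blast
    fix a x assume "x \<in> closure C"
    then obtain X where X: "\<And>n. X n \<in> C" "X \<longlonglongrightarrow> x" unfolding closure_sequential by metis
    have "(\<lambda>n. a *\<^sub>C X n) \<longlonglongrightarrow> a *\<^sub>C x" by (rule tendsto_scaleC[OF X(2)])
    moreover have "a *\<^sub>C X n \<in> closure C" for n using X(1)[of n] scl by (auto simp: C_def)
    ultimately show "a *\<^sub>C x \<in> closure C"
      by (rule closed_sequentially[OF closed_closure, rotated])
  qed (rule clC_add)
  have "x \<in> closure C" for x
  proof -
    obtain y where y: "y \<in> closure C" "x - y \<in> orthogonal_complement (closure C)"
      using projection_exists[OF sub closed_closure] by blast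
    have "hcoeff (x - y) k = 0" for k
      using y(2) mono[of 1 k] cinner_monomial[of "x - y" k] by (auto simp: orthogonal_complement_def)
    then have "x - y = 0" by (intro hardy2_eqI) simp
    then show ?thesis using y(1) by simp
  qed
  then have "euclidean closure_of C = topspace euclidean" by auto
  moreover have "countable C" using cS by (auto simp: C_def)
  ultimately show ?thesis unfolding separable_space_def by (intro exI[of _ C]) auto
qed

section \<open>Shifts and backward shifts\<close>

lift_definition swap_zw :: "hardy2 \<Rightarrow> hardy2" is "\<lambda>a (m, n). a (n, m)"
proof -
  fix a :: "nat \<times> nat \<Rightarrow> complex"
  assume "(\<lambda>k. (cmod (a k))\<^sup>2) summable_on UNIV"
  then have "(\<lambda>k. (cmod (a k))\<^sup>2) summable_on prod.swap ` UNIV" by simp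
  then have "((\<lambda>k. (cmod (a k))\<^sup>2) \<circ> prod.swap) summable_on UNIV"
    by (subst (asm) summable_on_reindex) auto
  then show "(\<lambda>k. (cmod (case k of (m, n) \<Rightarrow> a (n, m)))\<^sup>2) summable_on UNIV"
    by (simp add: o_def case_prod_beta prod.swap_def)
qed

lift_definition back_z :: "hardy2 \<Rightarrow> hardy2" is "\<lambda>a (m, n). a (Suc m, n)"
proof -
  fix a :: "nat \<times> nat \<Rightarrow> complex"
  assume "(\<lambda>k. (cmod (a k))\<^sup>2) summable_on UNIV"
  then have "(\<lambda>k. (cmod (a k))\<^sup>2) summable_on (\<lambda>(m, n). (Suc m, n)) ` UNIV"
    by (rule summable_on_subset_banach) simp
  then have "((\<lambda>k. (cmod (a k))\<^sup>2) \<circ> (\<lambda>(m, n). (Suc m, n))) summable_on UNIV"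
    by (subst (asm) summable_on_reindex) (auto simp: inj_on_def)
  then show "(\<lambda>k. (cmod (case k of (m, n) \<Rightarrow> a (Suc m, n)))\<^sup>2) summable_on UNIV"
    by (simp add: o_def case_prod_beta)
qed

definition mult_w :: "hardy2 \<Rightarrow> hardy2" where "mult_w f = swap_zw (mult_z (swap_zw f))"
definition back_w :: "hardy2 \<Rightarrow> hardy2" where "back_w f = swap_zw (back_z (swap_zw f))"

lemma hcoeff_swap [simp]: "hcoeff (swap_zw f) (m, n) = hcoeff f (n, m)"
  by (simp add: swap_zw.rep_eq)
lemma hcoeff_mult_z [simp]: "hcoeff (mult_z f) (m, n) = (if m = 0 then 0 else hcoeff f (m - 1, n))"
  by (simp add: mult_z.rep_eq)
lemma hcoeff_back_z [simp]: "hcoeff (back_z f) (m, n) = hcoeff f (Suc m, n)"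
  by (simp add: back_z.rep_eq)
lemma hcoeff_mult_w [simp]: "hcoeff (mult_w f) (m, n) = (if n = 0 then 0 else hcoeff f (m, n - 1))"
  by (simp add: mult_w_def)
lemma hcoeff_back_w [simp]: "hcoeff (back_w f) (m, n) = hcoeff f (m, Suc n)"
  by (simp add: back_w_def)

lemma swap_swap [simp]: "swap_zw (swap_zw f) = f"
  by (rule hardy2_eqI) simp

lemma shift_linear:
  "mult_z (f + g) = mult_z f + mult_z g" "mult_z (f - g) = mult_z f - mult_z g" "mult_z (a *\<^sub>C f) = a *\<^sub>C mult_z f"
  "back_z (f + g) = back_z f + back_z g" "back_z (f - g) = back_z f - back_z g" "back_z (a *\<^sub>C f) = a *\<^sub>C back_z f"
  "mult_w (f + g) = mult_w f + mult_w g" "mult_w (f - g) = mult_w f - mult_w g" "mult_w (a *\<^sub>C f) = a *\<^sub>C mult_w f"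
  "back_w (f + g) = back_w f + back_w g" "back_w (f - g) = back_w f - back_w g" "back_w (a *\<^sub>C f) = a *\<^sub>C back_w f"
  "swap_zw (f + g) = swap_zw f + swap_zw g" "swap_zw (f - g) = swap_zw f - swap_zw g" "swap_zw (a *\<^sub>C f) = a *\<^sub>C swap_zw f"
  "back_z 0 = 0" "back_w 0 = 0" "mult_z 0 = 0" "mult_w 0 = 0"
  by (rule hardy2_eqI; simp)+

lemma back_mult_z [simp]: "back_z (mult_z f) = f" "back_w (mult_w f) = f"
  by (rule hardy2_eqI; simp)+

lemma shift_commute:
  "mult_w (mult_z f) = mult_z (mult_w f)" "back_z (mult_w f) = mult_w (back_z f)"
  "back_w (back_z f) = back_z (back_w f)"
  by (rule hardy2_eqI; simp)+

lemma cinner_mult_z: "cinner (mult_z f) g = cinner f (back_z g)"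
proof -
  let ?s = "\<lambda>(m :: nat, n :: nat). (Suc m, n)"
  have "cinner (mult_z f) g = (\<Sum>\<^sub>\<infinity>k\<in>range ?s. hcoeff (mult_z f) k * cnj (hcoeff g k))"
    unfolding cinner_hardy2_def
  proof (rule infsum_cong_neutral)
    fix k assume "k \<in> UNIV - range ?s"
    then have "fst k = 0" by (cases k; cases "fst k") auto
    then show "hcoeff (mult_z f) k * cnj (hcoeff g k) = 0"
      by (cases k) simp
  qed auto
  also have "\<dots> = cinner f (back_z g)"
    unfolding cinner_hardy2_def
    by (subst infsum_reindex) (auto simp: inj_on_def o_def case_prod_beta intro!: infsum_cong)
  finally show ?thesis .
qed

lemma cinner_swap: "cinner (swap_zw f) g = cinner f (swap_zw g)"
proof -
  have "cinner (swap_zw f) g = (\<Sum>\<^sub>\<infinity>k\<in>range prod.swap. hcoeff (swap_zw f) k * cnj (hcoeff g k))"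
    by (simp add: cinner_hardy2_def)
  also have "\<dots> = cinner f (swap_zw g)"
    unfolding cinner_hardy2_def
    by (subst infsum_reindex) (auto simp: o_def prod.swap_def swap_zw.rep_eq case_prod_beta intro!: infsum_cong)
  finally show ?thesis .
qed

lemma cinner_mult_w: "cinner (mult_w f) g = cinner f (back_w g)"
  by (simp add: mult_w_def back_w_def cinner_swap cinner_mult_z)

lemma norm_eq_of_cinner: "cinner x x = cinner y y \<Longrightarrow> norm x = norm y"
  by (metis cinner_self of_real_eq_iff norm_ge_zero power2_eq_iff_nonneg)

lemma norm_shift [simp]: "norm (mult_z f) = norm f" "norm (mult_w f) = norm f" "norm (swap_zw f) = norm f"
  by (rule norm_eq_of_cinner; simp add: cinner_mult_z cinner_mult_w cinner_swap)+

text \<open>Meant for y a backward shift of f and x the forward shift of y: the adjoint of an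
  isometry is a contraction.\<close>

lemma norm_le_of_cinner_self:
  assumes "cinner y y = cinner x f" "norm x = norm y"
  shows "norm y \<le> norm f"
proof (cases "norm y = 0")
  case False
  have "(norm y)\<^sup>2 = cmod (cinner y y)" by (simp add: cinner_self norm_power)
  also have "\<dots> \<le> norm y * norm f" using norm_cinner_le[of x f] assms by simp
  finally show ?thesis using False by (simp add: power2_eq_square)
qed simp

lemma norm_back_le: "norm (back_z f) \<le> norm f" "norm (back_w f) \<le> norm f"
  by (rule norm_le_of_cinner_self[of _ "mult_z (back_z f)"]; simp add: cinner_mult_z)
    (rule norm_le_of_cinner_self[of _ "mult_w (back_w f)"]; simp add: cinner_mult_w)

section \<open>Point evaluations\<close>

lemma szego_sq_summable:
  assumes "z \<in> unit_disk" "w \<in> unit_disk"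
  shows "((\<lambda>(m, n). (cmod (z ^ m * w ^ n))\<^sup>2) has_sum (1 / (1 - (cmod z)\<^sup>2) * (1 / (1 - (cmod w)\<^sup>2)))) UNIV"
proof -
  have g: "((\<lambda>n. (cmod u ^ 2) ^ n) has_sum (1 / (1 - cmod u ^ 2))) UNIV" if "u \<in> unit_disk" for u
    by (rule norm_summable_imp_has_sum)
      (use that in \<open>auto intro!: geometric_sums summable_geometric simp: abs_square_less_1 power_less_one_iff\<close>)
  let ?f = "\<lambda>(m, n). (cmod z ^ 2) ^ m * (cmod w ^ 2) ^ n" and ?g = "\<lambda>m. (cmod z ^ 2) ^ m * (1 / (1 - cmod w ^ 2))"
  have 1: "((\<lambda>n. ?f (m, n)) has_sum ?g m) UNIV" for m
    using has_sum_cmult_right[OF g[OF assms(2)]] by simp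
  have 2: "(?g has_sum (1 / (1 - cmod z ^ 2) * (1 / (1 - cmod w ^ 2)))) UNIV"
    by (rule has_sum_cmult_left[OF g[OF assms(1)]])
  have "(?f has_sum (1 / (1 - cmod z ^ 2) * (1 / (1 - cmod w ^ 2)))) (UNIV \<times> UNIV)"
    by (rule has_sum_SigmaI[OF 1 2], rule summable_on_SigmaI[OF 1 has_sum_imp_summable[OF 2]]) auto
  then show ?thesis
    by (simp add: norm_mult norm_power power_mult_distrib power_mult[symmetric] mult.commute[of 2])
qed

text \<open>The reproducing kernel of the point (z, w), with generating function 1 / ((1 - cnj z Z)
  (1 - cnj w W)).\<close>

definition szego :: "complex \<Rightarrow> complex \<Rightarrow> hardy2" where
  "szego z w = Abs_hardy2 (\<lambda>(m, n). cnj z ^ m * cnj w ^ n)"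

lemma hcoeff_szego:
  assumes "z \<in> unit_disk" "w \<in> unit_disk"
  shows "hcoeff (szego z w) (m, n) = cnj z ^ m * cnj w ^ n"
proof -
  have "(\<lambda>k. (cmod (case k of (m, n) \<Rightarrow> cnj z ^ m * cnj w ^ n))\<^sup>2) summable_on UNIV"
    using has_sum_imp_summable[OF szego_sq_summable[OF assms]]
    unfolding case_prod_unfold by (simp add: norm_mult norm_power)
  then show ?thesis by (simp add: szego_def Abs_hardy2_inverse)
qed

lemma heval_eq_cinner:
  assumes "z \<in> unit_disk" "w \<in> unit_disk"
  shows "heval f z w = cinner f (szego z w)"
  unfolding heval_def cinner_hardy2_def
  by (rule infsum_cong) (auto simp: hcoeff_szego[OF assms])

lemma norm_szego:
  assumes "z \<in> unit_disk" "w \<in> unit_disk"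
  shows "(norm (szego z w))\<^sup>2 = 1 / (1 - (cmod z)\<^sup>2) * (1 / (1 - (cmod w)\<^sup>2))"
  unfolding norm_sq_hardy2 infsumI[OF szego_sq_summable[OF assms], symmetric]
  by (rule infsum_cong) (auto simp: hcoeff_szego[OF assms] norm_mult norm_power)

text \<open>The norm of \<open>szego z w\<close>.\<close>

definition eval_bound :: "complex \<Rightarrow> complex \<Rightarrow> real" where
  "eval_bound z w = sqrt (1 / (1 - (cmod z)\<^sup>2) * (1 / (1 - (cmod w)\<^sup>2)))"

lemma norm_heval_le:
  assumes "z \<in> unit_disk" "w \<in> unit_disk"
  shows "cmod (heval f z w) \<le> norm f * eval_bound z w"
  using norm_cinner_le[of f "szego z w"]
  unfolding heval_eq_cinner[OF assms] eval_bound_def norm_szego[OF assms, symmetric] by simp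

lemma heval_linear:
  assumes "z \<in> unit_disk" "w \<in> unit_disk"
  shows "heval (f + g) z w = heval f z w + heval g z w"
    "heval (f - g) z w = heval f z w - heval g z w"
    "heval (a *\<^sub>C f) z w = a * heval f z w" "heval 0 z w = 0"
  by (simp_all add: heval_eq_cinner[OF assms] cinner_simps)

lemma heval_swap: "heval (swap_zw f) z w = heval f w z"
proof -
  have "heval (swap_zw f) z w = (\<Sum>\<^sub>\<infinity>(m, n)\<in>range prod.swap. hcoeff (swap_zw f) (m, n) * (z ^ m * w ^ n))"
    by (simp add: heval_def)
  also have "\<dots> = heval f w z"
    unfolding heval_def
    by (subst infsum_reindex) (auto simp: o_def prod.swap_def case_prod_beta mult.commute intro!: infsum_cong)
  finally show ?thesis .
qed

lemma heval_mult_w: "heval (mult_w f) z w = w * heval f z w"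
  by (simp add: mult_w_def heval_swap heval_mult_z)

text \<open>\<open>back_z h = 0\<close> is how independence of z is expressed from here on.\<close>

lemma heval_indep_z:
  assumes "back_z h = 0"
  shows "heval h z w = heval h z' w"
proof -
  have "hcoeff h (Suc m, n) = 0" for m n using hcoeff_back_z[of h m n] assms by simp
  then have "hcoeff h (m, n) * (z ^ m * w ^ n) = hcoeff h (m, n) * (z' ^ m * w ^ n)" for m n
    by (cases m) auto
  then show ?thesis unfolding heval_def by (intro infsum_cong) auto
qed

text \<open>\<open>Az c\<close> and \<open>Aw c\<close> are multiplication by \<open>z - c\<close> and \<open>w - c\<close>; \<open>Bz c\<close> and \<open>Bw c\<close> are their
  adjoints.\<close>

definition Az :: "complex \<Rightarrow> hardy2 \<Rightarrow> hardy2" where "Az c x = mult_z x - c *\<^sub>C x"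
definition Bz :: "complex \<Rightarrow> hardy2 \<Rightarrow> hardy2" where "Bz c x = back_z x - cnj c *\<^sub>C x"
definition Aw :: "complex \<Rightarrow> hardy2 \<Rightarrow> hardy2" where "Aw c x = mult_w x - c *\<^sub>C x"
definition Bw :: "complex \<Rightarrow> hardy2 \<Rightarrow> hardy2" where "Bw c x = back_w x - cnj c *\<^sub>C x"

lemma cinner_Az: "cinner (Az c x) y = cinner x (Bz c y)"
  and cinner_Aw: "cinner (Aw c x) y = cinner x (Bw c y)"
  by (simp_all add: Az_def Bz_def Aw_def Bw_def cinner_simps cinner_mult_z cinner_mult_w)

lemma A_linear:
  "Az c (x + y) = Az c x + Az c y" "Az c (x - y) = Az c x - Az c y" "Az c (a *\<^sub>C x) = a *\<^sub>C Az c x" "Az c 0 = 0"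
  "Bz c (x + y) = Bz c x + Bz c y" "Bz c (x - y) = Bz c x - Bz c y" "Bz c (a *\<^sub>C x) = a *\<^sub>C Bz c x" "Bz c 0 = 0"
  "Aw c (x + y) = Aw c x + Aw c y" "Aw c (x - y) = Aw c x - Aw c y" "Aw c (a *\<^sub>C x) = a *\<^sub>C Aw c x" "Aw c 0 = 0"
  "Bw c (x + y) = Bw c x + Bw c y" "Bw c (x - y) = Bw c x - Bw c y" "Bw c (a *\<^sub>C x) = a *\<^sub>C Bw c x" "Bw c 0 = 0"
  by (rule hardy2_eqI; simp add: Az_def Bz_def Aw_def Bw_def algebra_simps)+

lemma A_commute: "Aw a (Az c x) = Az c (Aw a x)" "Bw a (Bz c x) = Bz c (Bw a x)" "Aw a (Aw b x) = Aw b (Aw a x)"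
  by (simp_all add: Az_def Bz_def Aw_def Bw_def shift_linear shift_commute
      complex_vector.scale_right_diff_distrib scaleC_scaleC mult.commute algebra_simps)

lemma heval_Az:
  assumes "z \<in> unit_disk" "w \<in> unit_disk"
  shows "heval (Az c x) z w = (z - c) * heval x z w" "heval (Aw c x) z w = (w - c) * heval x z w"
  by (simp_all add: Az_def Aw_def heval_linear[OF assms] heval_mult_z heval_mult_w algebra_simps)

lemma swap_Aw: "swap_zw (Aw c x) = Az c (swap_zw x)" "swap_zw (Bw c x) = Bz c (swap_zw x)"
  by (rule hardy2_eqI; simp add: Az_def Bz_def Aw_def Bw_def)+

lemma norm_Aw_ge: "\<bar>1 - cmod c\<bar> * norm x \<le> norm (Aw c x)"
  and norm_Az_ge: "\<bar>1 - cmod c\<bar> * norm x \<le> norm (Az c x)"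
proof -
  have *: "\<bar>1 - cmod c\<bar> * norm x = \<bar>norm y - norm (c *\<^sub>C x)\<bar>" if "norm y = norm x" for y :: hardy2
  proof -
    have "norm y - norm (c *\<^sub>C x) = (1 - cmod c) * norm x" by (simp add: that norm_scaleC left_diff_distrib)
    then show ?thesis by (simp add: abs_mult)
  qed
  show "\<bar>1 - cmod c\<bar> * norm x \<le> norm (Aw c x)" "\<bar>1 - cmod c\<bar> * norm x \<le> norm (Az c x)"
    unfolding Aw_def Az_def
    using *[of "mult_w x"] *[of "mult_z x"] norm_triangle_ineq3[of "mult_w x" "c *\<^sub>C x"]
      norm_triangle_ineq3[of "mult_z x" "c *\<^sub>C x"] by simp_all
qed

lemma norm_Aw_le: "norm (Aw c x) \<le> (1 + cmod c) * norm x"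
  using norm_triangle_ineq4[of "mult_w x" "c *\<^sub>C x"] by (simp add: Aw_def norm_scaleC algebra_simps)

text \<open>Along each row in z the coefficients of an eigenvector form a geometric sequence of
  ratio \<open>cnj c\<close>. Their moduli do not decrease, so square summability leaves only
  zero.\<close>

lemma Bz_injective:
  assumes "Bz c x = 0" "cmod c \<ge> 1"
  shows "x = 0"
proof -
  have step: "hcoeff x (Suc m, n) = cnj c * hcoeff x (m, n)" for m n
  proof -
    have "hcoeff (Bz c x) (m, n) = 0" by (simp add: assms(1))
    then show ?thesis by (simp add: Bz_def)
  qed
  have ge: "cmod (hcoeff x (m, n)) \<le> cmod (hcoeff x (m + k, n))" for m n k
  proof (induction k)
    case (Suc k)
    have "1 * cmod (hcoeff x (m + k, n)) \<le> cmod c * cmod (hcoeff x (m + k, n))"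
      using assms(2) by (intro mult_right_mono) auto
    then show ?case using Suc by (simp add: step norm_mult)
  qed simp
  have "hcoeff x (m, n) = 0" for m n
  proof (rule ccontr)
    assume ne: "hcoeff x (m, n) \<noteq> 0"
    let ?e = "(cmod (hcoeff x (m, n)))\<^sup>2"
    have "real N * ?e \<le> (norm x)\<^sup>2" for N
    proof -
      have inj: "inj_on (\<lambda>k. (m + k, n)) {..<N}" by (auto simp: inj_on_def)
      have "real N * ?e = (\<Sum>k<N. ?e)" by simp
      also have "\<dots> \<le> (\<Sum>k<N. (cmod (hcoeff x (m + k, n)))\<^sup>2)"
        by (intro sum_mono power_mono ge) auto
      also have "\<dots> = (\<Sum>k\<in>(\<lambda>k. (m + k, n)) ` {..<N}. (cmod (hcoeff x k))\<^sup>2)"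
        by (simp add: sum.reindex[OF inj])
      also have "\<dots> \<le> (norm x)\<^sup>2" by (rule sum_hcoeff_le) auto
      finally show ?thesis .
    qed
    moreover obtain N where "(norm x)\<^sup>2 < real N * ?e"
      using reals_Archimedean3[of ?e] ne by auto
    ultimately show False by (meson not_le)
  qed
  then show ?thesis by (intro hardy2_eqI) simp
qed

lemma Bw_injective:
  assumes "Bw c x = 0" "cmod c \<ge> 1"
  shows "x = 0"
proof -
  have "Bz c (swap_zw x) = 0" using assms(1) by (simp add: shift_linear flip: swap_Aw) (rule hardy2_eqI; simp)
  from Bz_injective[OF this assms(2)] have "swap_zw (swap_zw x) = swap_zw 0" by simp
  then show ?thesis by (metis hardy2_eqI hcoeff_swap hcoeff_zero)
qed

text \<open>The fixed point \<open>k\<close> of \<open>k \<mapsto> back_z u + c back_z k\<close> is the difference quotient of \<open>u\<close>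
  at \<open>z = c\<close>, and \<open>h\<close> is the restriction of \<open>u\<close> to \<open>z = c\<close>.\<close>

lemma difference_quotient:
  assumes c: "cmod c < 1"
  shows "\<exists>k h. u = Az c k + h \<and> back_z h = 0 \<and> norm h \<le> (1 + 2 / (1 - cmod c)) * norm u"
proof -
  have "\<exists>!k\<in>UNIV. back_z u + c *\<^sub>C back_z k = k"
  proof (rule Banach_fix[OF complete_UNIV _ _ c])
    fix x y :: hardy2
    have "norm (c *\<^sub>C back_z x - c *\<^sub>C back_z y) = cmod c * norm (back_z (x - y))"
      by (simp add: shift_linear norm_scaleC flip: complex_vector.scale_right_diff_distrib)
    also have "\<dots> \<le> cmod c * norm (x - y)" by (intro mult_left_mono norm_back_le) auto
    finally show "dist (back_z u + c *\<^sub>C back_z x) (back_z u + c *\<^sub>C back_z y) \<le> cmod c * dist x y"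
      by (simp add: dist_norm)
  qed auto
  then obtain k where k: "k = back_z u + c *\<^sub>C back_z k" by metis
  define h where "h = u + c *\<^sub>C k - mult_z k"
  have "norm k \<le> norm u + cmod c * norm k"
  proof -
    have "norm k \<le> norm (back_z u) + norm (c *\<^sub>C back_z k)" by (subst k) (rule norm_triangle_ineq)
    also have "\<dots> \<le> norm u + cmod c * norm k"
      unfolding norm_scaleC by (intro add_mono mult_left_mono norm_back_le) auto
    finally show ?thesis .
  qed
  then have kn: "norm k \<le> norm u / (1 - cmod c)" using c by (simp add: field_simps)
  have "norm h \<le> norm u + cmod c * norm k + norm k"
    unfolding h_def using norm_triangle_ineq4[of "u + c *\<^sub>C k" "mult_z k"] norm_triangle_ineq[of u "c *\<^sub>C k"]
    by (simp add: norm_scaleC)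
  also have "\<dots> \<le> norm u + 2 * norm k"
    using mult_right_mono[of "cmod c" 1 "norm k"] c by simp
  also have "\<dots> \<le> (1 + 2 / (1 - cmod c)) * norm u" using mult_left_mono[OF kn, of 2] by (simp add: algebra_simps)
  finally have "norm h \<le> (1 + 2 / (1 - cmod c)) * norm u" .
  moreover have "back_z h = 0" using k by (simp add: h_def shift_linear)
  moreover have "u = Az c k + h" by (simp add: h_def Az_def)
  ultimately show ?thesis by blast
qed

lemma heval_const_z_zero:
  assumes "back_z h = 0" "c \<in> unit_disk" "\<And>w. w \<in> unit_disk \<Longrightarrow> heval h c w = 0"
  shows "h = 0"
proof (rule heval_inject)
  fix z w :: complex assume "z \<in> unit_disk" "w \<in> unit_disk"
  then show "heval h z w = heval 0 z w"
    using assms(3) heval_indep_z[OF assms(1), of z w c] by (simp add: heval_linear(4))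
qed

text \<open>The remainder of division by z - c does not depend on z, so vanishing on the fiber z = c
  makes it zero.\<close>

lemma vanish_imp_Az:
  assumes "c \<in> unit_disk" "\<And>w. w \<in> unit_disk \<Longrightarrow> heval u c w = 0"
  shows "\<exists>k. u = Az c k"
proof -
  obtain k h where kh: "u = Az c k + h" "back_z h = 0"
    using difference_quotient[of c u] assms(1) by auto
  have "h = 0"
    by (rule heval_const_z_zero[OF kh(2) assms(1)])
      (use assms kh(1) in \<open>simp add: heval_linear heval_Az\<close>)
  then show ?thesis using kh by auto
qed

lemma heval_difference:
  assumes "c \<in> unit_disk"
  shows "\<exists>k. \<forall>z\<in>unit_disk. \<forall>w\<in>unit_disk. heval u z w - heval u c w = (z - c) * heval k z w"
proof -
  obtain k h where kh: "u = Az c k + h" "back_z h = 0"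
    using difference_quotient[of c u] assms(1) by auto
  have "heval u z w - heval u c w = (z - c) * heval k z w" if "z \<in> unit_disk" "w \<in> unit_disk" for z w
    using heval_indep_z[OF kh(2), of z w c] that assms by (simp add: kh(1) heval_linear heval_Az)
  then show ?thesis by blast
qed

lemma heval_difference_w:
  assumes "c \<in> unit_disk"
  shows "\<exists>k. \<forall>z\<in>unit_disk. \<forall>w\<in>unit_disk. heval u z w - heval u z c = (w - c) * heval k z w"
proof -
  obtain k where "\<forall>z\<in>unit_disk. \<forall>w\<in>unit_disk. heval (swap_zw u) z w - heval (swap_zw u) c w = (z - c) * heval k z w"
    using heval_difference[OF assms] by blast
  then show ?thesis by (intro exI[of _ "swap_zw k"]) (simp add: heval_swap)
qed

text \<open>The increment splits into one in z and one in w. Each is the increment of the variable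
  times a difference quotient in the Hardy space, which \<open>eval_bound\<close> controls near (c,
  a).\<close>

lemma continuous_heval: "continuous_on (unit_disk \<times> unit_disk) (\<lambda>(z, w). heval f z w)"
proof (subst continuous_on_eq_continuous_at)
  show "open (unit_disk \<times> unit_disk :: (complex \<times> complex) set)" by (intro open_Times) auto
  show "\<forall>x\<in>unit_disk \<times> unit_disk. isCont (\<lambda>(z, w). heval f z w) x"
  proof clarify
    fix c a :: complex assume c: "c \<in> unit_disk" and a: "a \<in> unit_disk"
    obtain k where k: "\<forall>z\<in>unit_disk. \<forall>w\<in>unit_disk. heval f z w - heval f c w = (z - c) * heval k z w"
      using heval_difference[OF c] by blast
    obtain k' where k': "\<forall>z\<in>unit_disk. \<forall>w\<in>unit_disk. heval f z w - heval f z a = (w - a) * heval k' z w"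
      using heval_difference_w[OF a] by blast
    let ?b = "\<lambda>p. cmod (fst p - c) * (norm k * eval_bound (fst p) (snd p))
                  + cmod (snd p - a) * (norm k' * eval_bound c (snd p))"
    have lim: "((\<lambda>p. cmod (fst p - c) * (norm k * eval_bound (fst p) (snd p))
                  + cmod (snd p - a) * (norm k' * eval_bound c (snd p))) \<longlongrightarrow>
                cmod (fst (c, a) - c) * (norm k * eval_bound (fst (c, a)) (snd (c, a)))
                  + cmod (snd (c, a) - a) * (norm k' * eval_bound c (snd (c, a)))) (at (c, a))"
    proof -
      have "(cmod c)\<^sup>2 \<noteq> 1" "(cmod a)\<^sup>2 \<noteq> 1" using a c abs_square_less_1[of "cmod c"] abs_square_less_1[of "cmod a"] by auto
      then show ?thesis unfolding eval_bound_def by (intro tendsto_intros) auto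
    qed
    have "\<forall>\<^sub>F p in at (c, a). p \<in> unit_disk \<times> unit_disk"
      using c a by (intro eventually_at_in_open') (auto intro!: open_Times)
    then have "\<forall>\<^sub>F p in at (c, a). norm ((case p of (z, w) \<Rightarrow> heval f z w) - heval f c a) \<le> ?b p"
    proof eventually_elim
      case (elim p)
      obtain z w where p: "p = (z, w)" by (cases p)
      have zw: "z \<in> unit_disk" "w \<in> unit_disk" using elim by (auto simp: p)
      have "heval f z w - heval f c a = (heval f z w - heval f c w) + (heval f c w - heval f c a)" by simp
      also have "\<dots> = (z - c) * heval k z w + (w - a) * heval k' c w"
        unfolding k[rule_format, OF zw] k'[rule_format, OF c zw(2)] ..
      also have "cmod \<dots> \<le> cmod (z - c) * cmod (heval k z w) + cmod (w - a) * cmod (heval k' c w)"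
        unfolding norm_mult[symmetric] by (rule norm_triangle_ineq)
      also have "\<dots> \<le> ?b p" unfolding p fst_conv snd_conv
        by (intro add_mono mult_left_mono norm_heval_le zw c) auto
      finally show ?case by (simp add: p)
    qed
    from Lim_null_comparison[OF this] lim
    have "((\<lambda>p. (case p of (z, w) \<Rightarrow> heval f z w) - heval f c a) \<longlongrightarrow> 0) (at (c, a))" by simp
    then show "isCont (\<lambda>(z, w). heval f z w) (c, a)" by (simp add: isCont_def LIM_zero_iff)
  qed
qed

lemma continuous_heval_comp:
  assumes "continuous_on S g" "continuous_on S h" "\<And>x. x \<in> S \<Longrightarrow> g x \<in> unit_disk" "\<And>x. x \<in> S \<Longrightarrow> h x \<in> unit_disk"
  shows "continuous_on S (\<lambda>x. heval f (g x) (h x))"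
proof -
  have "continuous_on S ((\<lambda>(z, w). heval f z w) \<circ> (\<lambda>x. (g x, h x)))"
    by (intro continuous_on_compose continuous_on_Pair assms(1,2) continuous_on_subset[OF continuous_heval])
      (use assms(3,4) in auto)
  then show ?thesis by (simp add: o_def)
qed

lemma holomorphic_heval_z:
  assumes w: "w \<in> unit_disk"
  shows "(\<lambda>z. heval f z w) holomorphic_on unit_disk"
proof (rule holomorphic_onI)
  fix c assume c: "c \<in> unit_disk"
  obtain k where k: "\<forall>z\<in>unit_disk. \<forall>w\<in>unit_disk. heval f z w - heval f c w = (z - c) * heval k z w"
    using heval_difference[OF c] by blast
  have "continuous_on unit_disk (\<lambda>z. heval k z w)"
    by (intro continuous_heval_comp) (use w in auto)
  then have "isCont (\<lambda>z. heval k z w) c" using c by (simp add: continuous_on_eq_continuous_at)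
  then have lim: "((\<lambda>z. heval k z w) \<longlongrightarrow> heval k c w) (at c)" by (simp add: isCont_def)
  have "\<forall>\<^sub>F z in at c. z \<in> unit_disk - {c}" using c by (intro eventually_at_in_open) auto
  then have "\<forall>\<^sub>F z in at c. (heval f z w - heval f c w) / (z - c) = heval k z w"
    by eventually_elim (use k w in auto)
  then have "((\<lambda>z. (heval f z w - heval f c w) / (z - c)) \<longlongrightarrow> heval k c w) (at c)"
    using lim by (simp cong: filterlim_cong)
  then have "((\<lambda>z. heval f z w) has_field_derivative heval k c w) (at c)"
    by (simp add: has_field_derivative_iff)
  then show "(\<lambda>z. heval f z w) field_differentiable at c within unit_disk"
    by (meson field_differentiable_def field_differentiable_at_within)
qed

lemma holomorphic_heval_w: "z \<in> unit_disk \<Longrightarrow> (\<lambda>w. heval f z w) holomorphic_on unit_disk"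
  using holomorphic_heval_z[of z "swap_zw f"] by (simp add: heval_swap)

section \<open>Parseval's formula on the circle\<close>

lemma cis_orthogonality:
  "((\<lambda>s. cis s ^ n * cnj (cis s ^ m)) has_integral (if n = m then 2 * pi else 0)) {0..2*pi}"
proof -
  have eq: "cis s ^ n * cnj (cis s ^ m) = cis ((real n - real m) * s)" for s
    by (simp only: Complex.DeMoivre cis_cnj cis_mult) (simp add: algebra_simps)
  show ?thesis
  proof (cases "n = m")
    case True
    then show ?thesis
      unfolding eq using has_integral_const_real[of "1 :: complex" 0 "2 * pi"] by (simp add: scaleR_conv_of_real)
  next
    case False
    define k where "k = real n - real m"
    have k: "k \<noteq> 0" "k \<in> \<int>" using False by (auto simp: k_def)
    have "((\<lambda>s. cis (k * s)) has_integral (cis (k * (2 * pi)) / (\<i> * k) - cis (k * 0) / (\<i> * k))) {0..2*pi}"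
    proof (rule fundamental_theorem_of_calculus)
      fix s
      have "((\<lambda>s. cis (k * s) / (\<i> * k)) has_derivative (\<lambda>t. (t * k) *\<^sub>R (\<i> * cis (k * s)) / (\<i> * k))) (at s within {0..2*pi})"
        by (rule derivative_eq_intros refl | use k in \<open>simp add: mult.commute\<close>)+
      moreover have "(t * k) *\<^sub>R (\<i> * cis (k * s)) / (\<i> * k) = t *\<^sub>R cis (k * s)" for t
        using k by (simp add: scaleR_conv_of_real field_simps)
      ultimately show "((\<lambda>s. cis (k * s) / (\<i> * k)) has_vector_derivative cis (k * s)) (at s within {0..2*pi})"
        by (simp add: has_vector_derivative_def)
    qed simp
    moreover have "cis (k * (2 * pi)) = 1" using cis_multiple_2pi[OF k(2)] by (simp add: mult_ac)
    ultimately show ?thesis using False unfolding eq k_def by simp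
  qed
qed

lemma parseval_finite:
  "((\<lambda>s. (cmod (\<Sum>n<N. c n * cis s ^ n))\<^sup>2) has_integral (2 * pi * (\<Sum>n<N. (cmod (c n))\<^sup>2))) {0..2*pi}"
proof -
  have "((\<lambda>s. \<Sum>n<N. \<Sum>m<N. (c n * cnj (c m)) * (cis s ^ n * cnj (cis s ^ m))) has_integral
      (\<Sum>n<N. \<Sum>m<N. (c n * cnj (c m)) * (if n = m then 2 * pi else 0))) {0..2*pi}"
    by (intro has_integral_sum has_integral_mult_right cis_orthogonality) auto
  from has_integral_linear[OF this bounded_linear_Re]
  have "((\<lambda>s. Re (\<Sum>n<N. \<Sum>m<N. (c n * cnj (c m)) * (cis s ^ n * cnj (cis s ^ m)))) has_integral
      Re (\<Sum>n<N. \<Sum>m<N. (c n * cnj (c m)) * (if n = m then 2 * pi else 0))) {0..2*pi}"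
    by (simp add: o_def)
  moreover have "(\<Sum>n<N. \<Sum>m<N. (c n * cnj (c m)) * (cis s ^ n * cnj (cis s ^ m)))
      = complex_of_real ((cmod (\<Sum>n<N. c n * cis s ^ n))\<^sup>2)" for s
    unfolding complex_norm_square cnj_sum sum_product complex_cnj_mult by (intro sum.cong) (simp_all add: mult_ac)
  moreover have "(\<Sum>n<N. \<Sum>m<N. (c n * cnj (c m)) * (if n = m then 2 * pi else 0))
      = complex_of_real (2 * pi * (\<Sum>n<N. (cmod (c n))\<^sup>2))"
  proof -
    have "(\<Sum>m<N. (c n * cnj (c m)) * (if n = m then 2 * pi else 0)) = complex_of_real (2 * pi * (cmod (c n))\<^sup>2)"
      if "n < N" for n
    proof -
      have "(\<Sum>m<N. (c n * cnj (c m)) * (if n = m then 2 * pi else 0))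
          = (\<Sum>m<N. if n = m then (c n * cnj (c m)) * complex_of_real (2 * pi) else 0)"
        by (intro sum.cong) auto
      also have "\<dots> = (c n * cnj (c n)) * complex_of_real (2 * pi)" using that by simp
      finally show ?thesis unfolding cnj_mult_self by simp
    qed
    then show ?thesis by (simp add: sum_distrib_left)
  qed
  ultimately show ?thesis by (simp only: Re_complex_of_real)
qed

text \<open>The sum of the moduli is a constant majorant of all partial sums, so the finite formula
  passes to the limit.\<close>

lemma parseval_series:
  assumes "summable (\<lambda>k. cmod (a k))"
  shows "((\<lambda>s. (cmod (\<Sum>k. a k * cis s ^ k))\<^sup>2) has_integral (2 * pi * (\<Sum>k. (cmod (a k))\<^sup>2))) {0..2*pi}"
    and "summable (\<lambda>k. (cmod (a k))\<^sup>2)"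
proof -
  let ?A = "\<Sum>k. cmod (a k)"
  have smk: "summable (\<lambda>k. cmod (a k * cis s ^ k))" for s
    using assms by (simp add: norm_mult norm_power)
  show sq: "summable (\<lambda>k. (cmod (a k))\<^sup>2)"
  proof (rule summable_comparison_test'[OF summable_mult[OF assms, of ?A]])
    fix k
    have "cmod (a k) \<le> ?A" using sum_le_suminf[OF assms, of "{k}"] by simp
    then show "norm ((cmod (a k))\<^sup>2) \<le> ?A * cmod (a k)"
      by (simp add: power2_eq_square mult_right_mono)
  qed
  show "((\<lambda>s. (cmod (\<Sum>k. a k * cis s ^ k))\<^sup>2) has_integral (2 * pi * (\<Sum>k. (cmod (a k))\<^sup>2))) {0..2*pi}"
  proof (rule has_integral_dominated_convergence[OF parseval_finite])
    show "(\<lambda>s. ?A\<^sup>2) integrable_on {0..2*pi}" by (rule integrable_const_ivl)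
    show "\<forall>s\<in>{0..2*pi}. norm ((cmod (\<Sum>n<N. a n * cis s ^ n))\<^sup>2) \<le> ?A\<^sup>2" for N
    proof
      fix s
      have "cmod (\<Sum>n<N. a n * cis s ^ n) \<le> (\<Sum>n<N. cmod (a n * cis s ^ n))" by (rule norm_sum)
      also have "\<dots> \<le> ?A" using sum_le_suminf[OF assms, of "{..<N}"] by (simp add: norm_mult norm_power)
      finally show "norm ((cmod (\<Sum>n<N. a n * cis s ^ n))\<^sup>2) \<le> ?A\<^sup>2" by (simp add: power_mono)
    qed
    show "\<forall>s\<in>{0..2*pi}. (\<lambda>N. (cmod (\<Sum>n<N. a n * cis s ^ n))\<^sup>2) \<longlonglongrightarrow> (cmod (\<Sum>k. a k * cis s ^ k))\<^sup>2"
      using summable_LIMSEQ[OF summable_norm_cancel[OF smk]] by (intro ballI tendsto_intros)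
    show "(\<lambda>N. 2 * pi * (\<Sum>n<N. (cmod (a n))\<^sup>2)) \<longlonglongrightarrow> 2 * pi * (\<Sum>k. (cmod (a k))\<^sup>2)"
      by (intro tendsto_intros summable_LIMSEQ[OF sq])
  qed
qed

lemma power_series_abs_summable:
  fixes x :: "nat \<Rightarrow> complex"
  assumes "\<And>t. cmod t < 1 \<Longrightarrow> summable (\<lambda>k. x k * t ^ k)" "0 \<le> r" "r < 1"
  shows "summable (\<lambda>k. cmod (x k * of_real r ^ k))"
proof -
  obtain r' where r': "r < r'" "r' < 1" using assms(3) dense by blast
  show ?thesis
    by (rule powser_insidea[OF assms(1)[of "of_real r'"]]) (use r' assms in auto)
qed

text \<open>Compare the integral means of \<open>X\<close> and \<open>Y\<close> over the circle of radius \<open>r\<close> and let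
  \<open>r\<close> tend to 1.\<close>

lemma hardy_norm_mono:
  fixes x y :: "nat \<Rightarrow> complex"
  assumes X: "\<And>t. cmod t < 1 \<Longrightarrow> (\<lambda>k. x k * t ^ k) sums X t"
    and Y: "\<And>t. cmod t < 1 \<Longrightarrow> (\<lambda>k. y k * t ^ k) sums Y t"
    and le: "\<And>\<epsilon>. \<epsilon> > 0 \<Longrightarrow> \<exists>\<rho><1. \<forall>t. \<rho> \<le> cmod t \<longrightarrow> cmod t < 1 \<longrightarrow> (cmod (Y t))\<^sup>2 \<le> (1 + \<epsilon>) * (cmod (X t))\<^sup>2"
  shows "(\<Sum>k. ennreal ((cmod (y k))\<^sup>2)) \<le> (\<Sum>k. ennreal ((cmod (x k))\<^sup>2))"
proof (cases "(\<Sum>k. ennreal ((cmod (x k))\<^sup>2)) = top")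
  case False
  have sx: "summable (\<lambda>k. (cmod (x k))\<^sup>2)"
    by (rule summable_suminf_not_top) (use False in auto)
  let ?S = "\<Sum>k. (cmod (x k))\<^sup>2"
  have fin: "(\<Sum>k<N. (cmod (y k))\<^sup>2) \<le> ?S" for N
  proof (rule field_le_epsilon)
    fix e :: real assume "e > 0"
    \<comment> \<open>Makes \<open>\<epsilon> * ?S\<close> at most e; adding 1 covers the case that
      the sum is zero.\<close>
    define \<epsilon> where "\<epsilon> = e / (?S + 1)"
    have S0: "?S \<ge> 0" by (intro suminf_nonneg sx) auto
    have \<epsilon>: "\<epsilon> > 0" "\<epsilon> * ?S \<le> e"
      using \<open>e > 0\<close> S0 by (auto simp: \<epsilon>_def field_simps intro!: mult_nonneg_nonneg)
    obtain \<rho> where \<rho>: "\<rho> < 1" "\<And>t. \<rho> \<le> cmod t \<Longrightarrow> cmod t < 1 \<Longrightarrow> (cmod (Y t))\<^sup>2 \<le> (1 + \<epsilon>) * (cmod (X t))\<^sup>2"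
      using le[OF \<epsilon>(1)] by blast
    have r: "(\<Sum>k<N. (cmod (y k))\<^sup>2 * r ^ (2 * k)) \<le> (1 + \<epsilon>) * ?S" if r: "max 0 \<rho> \<le> r" "r < 1" for r
    proof -
      have smx: "summable (\<lambda>k. cmod (x k * of_real r ^ k))"
        by (rule power_series_abs_summable) (use X r in \<open>auto intro: sums_summable\<close>)
      have smy: "summable (\<lambda>k. cmod (y k * of_real r ^ k))"
        by (rule power_series_abs_summable) (use Y r in \<open>auto intro: sums_summable\<close>)
      have Xr: "(\<Sum>k. x k * of_real r ^ k * cis s ^ k) = X (of_real r * cis s)" for s
        using sums_unique[OF X[of "of_real r * cis s"]] r by (simp add: norm_mult power_mult_distrib mult.assoc)
      have Yr: "(\<Sum>k. y k * of_real r ^ k * cis s ^ k) = Y (of_real r * cis s)" for s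
        using sums_unique[OF Y[of "of_real r * cis s"]] r by (simp add: norm_mult power_mult_distrib mult.assoc)
      have IX: "((\<lambda>s. (1 + \<epsilon>) * (cmod (X (of_real r * cis s)))\<^sup>2) has_integral ((1 + \<epsilon>) * (2 * pi * (\<Sum>k. (cmod (x k * of_real r ^ k))\<^sup>2)))) {0..2*pi}"
        using has_integral_mult_right[OF parseval_series(1)[OF smx], of "1 + \<epsilon>"] unfolding Xr .
      have "2 * pi * (\<Sum>k. (cmod (y k * of_real r ^ k))\<^sup>2) \<le> (1 + \<epsilon>) * (2 * pi * (\<Sum>k. (cmod (x k * of_real r ^ k))\<^sup>2))"
      proof (rule has_integral_le[OF parseval_series(1)[OF smy] IX])
        show "(cmod (\<Sum>k. y k * complex_of_real r ^ k * cis s ^ k))\<^sup>2 \<le> (1 + \<epsilon>) * (cmod (X (complex_of_real r * cis s)))\<^sup>2" for s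
          unfolding Yr using r by (intro \<rho>(2)) (auto simp: norm_mult)
      qed
      then have 1: "(\<Sum>k. (cmod (y k * of_real r ^ k))\<^sup>2) \<le> (1 + \<epsilon>) * (\<Sum>k. (cmod (x k * of_real r ^ k))\<^sup>2)"
        by (simp add: mult.left_commute[of _ "2 * pi"] mult.assoc)
      have "(\<Sum>k<N. (cmod (y k))\<^sup>2 * r ^ (2 * k)) = (\<Sum>k<N. (cmod (y k * of_real r ^ k))\<^sup>2)"
        using r by (simp add: norm_mult norm_power power_mult_distrib power_mult power2_eq_square power_even_eq mult_ac)
      also have "\<dots> \<le> (\<Sum>k. (cmod (y k * of_real r ^ k))\<^sup>2)"
        by (intro sum_le_suminf parseval_series(2)[OF smy]) auto
      also note 1
      also have "(\<Sum>k. (cmod (x k * of_real r ^ k))\<^sup>2) \<le> ?S"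
      proof (rule suminf_le[OF _ parseval_series(2)[OF smx] sx])
        fix k
        have "r ^ k \<le> 1" using r by (simp add: power_le_one)
        then show "(cmod (x k * of_real r ^ k))\<^sup>2 \<le> (cmod (x k))\<^sup>2"
          using r by (intro power_mono) (auto simp: norm_mult norm_power intro!: mult_left_le)
      qed
      finally show ?thesis using \<epsilon>(1) by (simp add: mult_left_mono)
    qed
    have "(\<Sum>k<N. (cmod (y k))\<^sup>2 * 1 ^ (2 * k)) \<le> (1 + \<epsilon>) * ?S"
    proof (rule tendsto_upperbound)
      show "((\<lambda>r. \<Sum>k<N. (cmod (y k))\<^sup>2 * r ^ (2 * k)) \<longlongrightarrow> (\<Sum>k<N. (cmod (y k))\<^sup>2 * 1 ^ (2 * k))) (at_left 1)"
        by (intro tendsto_intros)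
      show "\<forall>\<^sub>F r in at_left 1. (\<Sum>k<N. (cmod (y k))\<^sup>2 * r ^ (2 * k)) \<le> (1 + \<epsilon>) * ?S"
      proof -
        have "\<forall>\<^sub>F r in at_left 1. r \<in> {max 0 \<rho><..<1}" using \<rho>(1) by (intro eventually_at_left_real) simp
        then show ?thesis by eventually_elim (use r in auto)
      qed
    qed simp
    then show "(\<Sum>k<N. (cmod (y k))\<^sup>2) \<le> ?S + e" using \<epsilon>(2) by (simp add: algebra_simps)
  qed
  have "(\<Sum>k. ennreal ((cmod (y k))\<^sup>2)) \<le> ennreal ?S"
  proof (rule suminf_le_const)
    show "(\<Sum>k<N. ennreal ((cmod (y k))\<^sup>2)) \<le> ennreal ?S" for N
      using fin[of N] by (simp add: ennreal_leI)
  qed simp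
  also have "\<dots> = (\<Sum>k. ennreal ((cmod (x k))\<^sup>2))"
    by (rule suminf_ennreal2[symmetric]) (use sx in auto)
  finally show ?thesis .
qed simp

text \<open>By uniform continuity |b| is close to 1 on a whole annulus next to the circle. There X
  and Y dominate each other up to a factor 1 + \<epsilon>, and only radii near 1 matter for the
  norms; zeros of b further inside do no harm.\<close>

lemma hardy_norm_unimodular_mult:
  fixes x y :: "nat \<Rightarrow> complex"
  assumes X: "\<And>t. cmod t < 1 \<Longrightarrow> (\<lambda>k. x k * t ^ k) sums X t"
    and Y: "\<And>t. cmod t < 1 \<Longrightarrow> (\<lambda>k. y k * t ^ k) sums Y t"
    and YX: "\<And>t. cmod t < 1 \<Longrightarrow> Y t = b t * X t"
    and b: "continuous_on (cball 0 1) b" "\<And>t. cmod t = 1 \<Longrightarrow> cmod (b t) = 1"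
  shows "(\<Sum>k. ennreal ((cmod (y k))\<^sup>2)) = (\<Sum>k. ennreal ((cmod (x k))\<^sup>2))"
proof -
  have uc: "uniformly_continuous_on (cball 0 1) b" by (rule compact_uniformly_continuous[OF b(1)]) simp
  have near: "\<exists>\<rho><1. \<forall>t. \<rho> \<le> cmod t \<longrightarrow> cmod t < 1 \<longrightarrow> \<bar>cmod (b t) - 1\<bar> < \<delta>" if "\<delta> > 0" for \<delta>
  proof -
    obtain d where d: "d > 0" "\<And>t u. t \<in> cball 0 1 \<Longrightarrow> u \<in> cball 0 1 \<Longrightarrow> dist u t < d \<Longrightarrow> dist (b u) (b t) < \<delta>"
      using uc \<open>\<delta> > 0\<close> unfolding uniformly_continuous_on_def by metis
    have "\<bar>cmod (b t) - 1\<bar> < \<delta>" if t: "max (1/2) (1 - d/2) \<le> cmod t" "cmod t < 1" for t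
    proof -
      have t0: "cmod t > 0" using t by auto
      define u where "u = sgn t"
      have u: "cmod u = 1" using t0 by (simp add: u_def norm_sgn)
      have "u - t = complex_of_real (1 - cmod t) * u"
        using t0 by (simp add: u_def sgn_eq field_simps)
      then have "dist t u = 1 - cmod t" using t u by (simp add: dist_norm norm_minus_commute[of t] norm_mult flip: of_real_diff)
      then have "dist t u < d" using t d(1) by auto
      then have "dist (b t) (b u) < \<delta>" using d(2)[of u t] u t by auto
      moreover have "\<bar>cmod (b t) - cmod (b u)\<bar> \<le> dist (b t) (b u)" unfolding dist_norm by (rule norm_triangle_ineq3)
      ultimately show ?thesis using b(2)[OF u] by linarith
    qed
    then show ?thesis using d(1) by (intro exI[of _ "max (1/2) (1 - d/2)"]) auto
  qed
  show ?thesis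
  proof (rule antisym)
    show "(\<Sum>k. ennreal ((cmod (y k))\<^sup>2)) \<le> (\<Sum>k. ennreal ((cmod (x k))\<^sup>2))"
    proof (rule hardy_norm_mono[OF X Y])
      fix \<epsilon> :: real assume e: "\<epsilon> > 0"
      obtain \<rho> where \<rho>: "\<rho> < 1" "\<And>t. \<rho> \<le> cmod t \<Longrightarrow> cmod t < 1 \<Longrightarrow> \<bar>cmod (b t) - 1\<bar> < sqrt (1 + \<epsilon>) - 1"
        using near[of "sqrt (1 + \<epsilon>) - 1"] e by auto
      have "(cmod (Y t))\<^sup>2 \<le> (1 + \<epsilon>) * (cmod (X t))\<^sup>2" if t: "\<rho> \<le> cmod t" "cmod t < 1" for t
      proof -
        have "cmod (b t) \<le> sqrt (1 + \<epsilon>)" using \<rho>(2)[OF t] by linarith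
        then have "(cmod (b t))\<^sup>2 \<le> (sqrt (1 + \<epsilon>))\<^sup>2" by (intro power_mono) auto
        then show ?thesis using e by (simp add: YX[OF t(2)] norm_mult power_mult_distrib mult_right_mono)
      qed
      then show "\<exists>\<rho><1. \<forall>t. \<rho> \<le> cmod t \<longrightarrow> cmod t < 1 \<longrightarrow> (cmod (Y t))\<^sup>2 \<le> (1 + \<epsilon>) * (cmod (X t))\<^sup>2"
        using \<rho>(1) by blast
    qed
    show "(\<Sum>k. ennreal ((cmod (x k))\<^sup>2)) \<le> (\<Sum>k. ennreal ((cmod (y k))\<^sup>2))"
    proof (rule hardy_norm_mono[OF Y X])
      fix \<epsilon> :: real assume e: "\<epsilon> > 0"
      \<comment> \<open>The lower bound for |b| with
        \<open>(1 + \<epsilon>) * \<delta>\<^sup>2 = 1\<close>, which is just what the domination of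
        X by Y requires.\<close>
      define \<delta> where "\<delta> = 1 / sqrt (1 + \<epsilon>)"
      have \<delta>: "0 < \<delta>" "\<delta> < 1" "(1 + \<epsilon>) * \<delta>\<^sup>2 = 1" using e by (auto simp: \<delta>_def power_divide)
      obtain \<rho> where \<rho>: "\<rho> < 1" "\<And>t. \<rho> \<le> cmod t \<Longrightarrow> cmod t < 1 \<Longrightarrow> \<bar>cmod (b t) - 1\<bar> < 1 - \<delta>"
        using near[of "1 - \<delta>"] \<delta> by auto
      have "(cmod (X t))\<^sup>2 \<le> (1 + \<epsilon>) * (cmod (Y t))\<^sup>2" if t: "\<rho> \<le> cmod t" "cmod t < 1" for t
      proof -
        have "\<delta> \<le> cmod (b t)" using \<rho>(2)[OF t] by linarith
        then have "\<delta>\<^sup>2 \<le> (cmod (b t))\<^sup>2" using \<delta> by (intro power_mono) auto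
        then have "1 \<le> (1 + \<epsilon>) * (cmod (b t))\<^sup>2" using \<delta>(3) mult_left_mono[of "\<delta>\<^sup>2" "(cmod (b t))\<^sup>2" "1 + \<epsilon>"] e by simp
        from mult_right_mono[OF this, of "(cmod (X t))\<^sup>2"] show ?thesis
          by (simp add: YX[OF t(2)] norm_mult power_mult_distrib mult.assoc)
      qed
      then show "\<exists>\<rho><1. \<forall>t. \<rho> \<le> cmod t \<longrightarrow> cmod t < 1 \<longrightarrow> (cmod (X t))\<^sup>2 \<le> (1 + \<epsilon>) * (cmod (Y t))\<^sup>2"
        using \<rho>(1) by blast
    qed
  qed
qed

section \<open>Homogeneous expansion and slices\<close>

text \<open>\<open>f (t, t \<omega>) = (\<Sum>k. poly (hpoly f k) \<omega> * t\<^sup>k)\<close>: the polynomial \<open>hpoly f k\<close> is the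
  dehomogenized component of degree \<open>k\<close>.\<close>

definition hpoly :: "hardy2 \<Rightarrow> nat \<Rightarrow> complex poly" where
  "hpoly f k = (\<Sum>n\<le>k. monom (hcoeff f (k - n, n)) n)"

lemma coeff_hpoly: "coeff (hpoly f k) n = (if n \<le> k then hcoeff f (k - n, n) else 0)"
  by (simp add: hpoly_def coeff_sum)

lemma degree_hpoly: "degree (hpoly f k) \<le> k"
  by (rule degree_le) (simp add: coeff_hpoly)

lemma poly_hpoly: "poly (hpoly f k) \<omega> = (\<Sum>n\<le>k. hcoeff f (k - n, n) * \<omega> ^ n)"
  by (simp add: hpoly_def poly_sum poly_monom)

lemma bij_triangle: "bij_betw (\<lambda>(k, n). (k - n, n)) (SIGMA k:UNIV. {..k}) (UNIV :: (nat \<times> nat) set)"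
  by (rule bij_betwI[where g = "\<lambda>(m, n). (m + n, n)"]) auto

lemma heval_slice_has_sum:
  assumes "t \<in> unit_disk" "t * \<omega> \<in> unit_disk"
  shows "((\<lambda>k. poly (hpoly f k) \<omega> * t ^ k) has_sum heval f t (t * \<omega>)) UNIV"
proof -
  let ?F = "\<lambda>(m, n). hcoeff f (m, n) * (t ^ m * (t * \<omega>) ^ n)"
  have "?F summable_on UNIV"
    by (rule abs_summable_summable)
      (use heval_abs_summable[OF assms, of f] in \<open>simp add: case_prod_unfold\<close>)
  then have "(?F has_sum heval f t (t * \<omega>)) UNIV"
    unfolding heval_def by (rule has_sum_infsum)
  then have "((\<lambda>x. ?F (case x of (k, n) \<Rightarrow> (k - n, n))) has_sum heval f t (t * \<omega>)) (SIGMA k:UNIV. {..k})"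
    by (subst has_sum_reindex_bij_betw[OF bij_triangle])
  then have "((\<lambda>k. \<Sum>n\<le>k. ?F (k - n, n)) has_sum heval f t (t * \<omega>)) UNIV"
    by (rule has_sum_SigmaD) (auto intro!: has_sum_finiteI)
  moreover have "(\<Sum>n\<le>k. ?F (k - n, n)) = poly (hpoly f k) \<omega> * t ^ k" for k
    unfolding poly_hpoly sum_distrib_right
  proof (rule sum.cong)
    fix n assume "n \<in> {..k}"
    then have "t ^ k = t ^ (k - n) * t ^ n" by (simp flip: power_add)
    then show "?F (k - n, n) = hcoeff f (k - n, n) * \<omega> ^ n * t ^ k" by (simp add: power_mult_distrib)
  qed simp
  ultimately show ?thesis by simp
qed

lemma heval_slice:
  assumes "t \<in> unit_disk" "t * \<omega> \<in> unit_disk"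
  shows "(\<lambda>k. poly (hpoly f k) \<omega> * t ^ k) sums heval f t (t * \<omega>)"
    and "summable (\<lambda>k. cmod (poly (hpoly f k) \<omega> * t ^ k))"
proof -
  show "(\<lambda>k. poly (hpoly f k) \<omega> * t ^ k) sums heval f t (t * \<omega>)"
    by (rule has_sum_imp_sums[OF heval_slice_has_sum[OF assms]])
  have "(\<lambda>k. poly (hpoly f k) \<omega> * t ^ k) summable_on UNIV"
    using heval_slice_has_sum[OF assms] by (rule has_sum_imp_summable)
  then show "summable (\<lambda>k. cmod (poly (hpoly f k) \<omega> * t ^ k))"
    unfolding summable_on_iff_abs_summable_on_complex by (rule summable_on_imp_summable)
qed

text \<open>For c = \<open>hpoly f\<close> this is 2 pi times the squared norm of f. Values in
  \<open>ennreal\<close> allow finiteness to be a conclusion, for series not yet known to belong to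
  the Hardy space.\<close>

definition slice_energy :: "(nat \<Rightarrow> complex poly) \<Rightarrow> ennreal" where
  "slice_energy c = (\<integral>\<^sup>+s\<in>{0..2*pi}. (\<Sum>k. ennreal ((cmod (poly (c k) (cis s)))\<^sup>2)) \<partial>lborel)"

lemma nn_integral_poly_cis:
  assumes "degree p \<le> N"
  shows "(\<integral>\<^sup>+s\<in>{0..2*pi}. ennreal ((cmod (poly p (cis s)))\<^sup>2) \<partial>lborel) = ennreal (2 * pi * (\<Sum>n\<le>N. (cmod (coeff p n))\<^sup>2))"
proof -
  have meas: "(\<lambda>s. (cmod (poly p (cis s)))\<^sup>2) \<in> borel_measurable borel"
    by (intro borel_measurable_continuous_onI continuous_intros)
  have pp: "poly p (cis s) = (\<Sum>n<Suc N. coeff p n * cis s ^ n)" for s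
    unfolding lessThan_Suc_atMost poly_altdef
    using assms by (intro sum.mono_neutral_left) (auto simp: coeff_eq_0)
  have "((\<lambda>s. (cmod (poly p (cis s)))\<^sup>2) has_integral (2 * pi * (\<Sum>n\<le>N. (cmod (coeff p n))\<^sup>2))) {0..2*pi}"
    using parseval_finite[where N = "Suc N" and c = "coeff p"] unfolding pp lessThan_Suc_atMost .
  then have I: "((\<lambda>s. (cmod (poly p (cis s)))\<^sup>2 * indicator {0..2*pi} s) has_integral (2 * pi * (\<Sum>n\<le>N. (cmod (coeff p n))\<^sup>2))) UNIV"
    unfolding has_integral_restrict_UNIV[symmetric, of _ _ "{0..2*pi}"]
    by (rule has_integral_eq[rotated]) (auto simp: indicator_def)
  have "(\<integral>\<^sup>+s. ennreal ((cmod (poly p (cis s)))\<^sup>2 * indicator {0..2*pi} s) \<partial>lborel) = ennreal (2 * pi * (\<Sum>n\<le>N. (cmod (coeff p n))\<^sup>2))"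
  proof (rule nn_integral_has_integral_lborel[OF _ _ I])
    show "(\<lambda>s. (cmod (poly p (cis s)))\<^sup>2 * indicator {0..2*pi} s) \<in> borel_measurable borel"
      by (intro borel_measurable_times meas borel_measurable_indicator) simp
  qed simp
  moreover have "ennreal ((cmod (poly p (cis s)))\<^sup>2) * indicator {0..2*pi} s = ennreal ((cmod (poly p (cis s)))\<^sup>2 * indicator {0..2*pi} s)" for s
    by (simp add: indicator_def)
  ultimately show ?thesis by simp
qed

lemma slice_energy_eq:
  assumes "\<And>k. degree (c k) \<le> k"
  shows "slice_energy c = (\<Sum>k. ennreal (2 * pi * (\<Sum>n\<le>k. (cmod (coeff (c k) n))\<^sup>2)))"
proof -
  have meas: "(\<lambda>s. (cmod (poly (c k) (cis s)))\<^sup>2) \<in> borel_measurable borel" for k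
    by (intro borel_measurable_continuous_onI continuous_intros)
  have "slice_energy c = (\<integral>\<^sup>+s. (\<Sum>k. ennreal ((cmod (poly (c k) (cis s)))\<^sup>2) * indicator {0..2*pi} s) \<partial>lborel)"
    unfolding slice_energy_def by (simp add: ennreal_suminf_multc)
  also have "\<dots> = (\<Sum>k. \<integral>\<^sup>+s\<in>{0..2*pi}. ennreal ((cmod (poly (c k) (cis s)))\<^sup>2) \<partial>lborel)"
    by (rule nn_integral_suminf)
      (use meas in measurable)
  also have "\<dots> = (\<Sum>k. ennreal (2 * pi * (\<Sum>n\<le>k. (cmod (coeff (c k) n))\<^sup>2)))"
    using nn_integral_poly_cis[OF assms] by simp
  finally show ?thesis .
qed

text \<open>Finitely many slopes come from finitely many angles, a null set. The endpoint 2 pi is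
  set aside, \<open>cis\<close> being injective only on the half-open interval.\<close>

lemma slice_energy_cong:
  assumes "finite Z" "\<And>s. cis s \<notin> Z \<Longrightarrow> (\<Sum>k. ennreal ((cmod (poly (c k) (cis s)))\<^sup>2)) = (\<Sum>k. ennreal ((cmod (poly (d k) (cis s)))\<^sup>2))"
  shows "slice_energy c = slice_energy d"
  unfolding slice_energy_def
proof (rule nn_integral_cong_AE)
  have "finite {s \<in> {0..<2*pi}. cis s \<in> Z}"
  proof (rule finite_imageD)
    show "finite (cis ` {s \<in> {0..<2*pi}. cis s \<in> Z})" using assms(1) by (rule finite_subset[rotated]) auto
    show "inj_on cis {s \<in> {0..<2*pi}. cis s \<in> Z}"
    proof (rule inj_on_inverseI)
      fix s assume "s \<in> {s \<in> {0..<2*pi}. cis s \<in> Z}"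
      then show "Arg2pi (cis s) = s" by (intro Arg2pi_unique[of 1]) (auto simp: cis_conv_exp)
    qed
  qed
  then have "finite ({s \<in> {0..<2*pi}. cis s \<in> Z} \<union> {2*pi})" by simp
  then have "AE s in lborel. s \<notin> {s \<in> {0..<2*pi}. cis s \<in> Z} \<union> {2*pi}"
    by (intro AE_not_in finite_imp_null_set_lborel)
  then show "AE s in lborel. (\<Sum>k. ennreal ((cmod (poly (c k) (cis s)))\<^sup>2)) * indicator {0..2*pi} s = (\<Sum>k. ennreal ((cmod (poly (d k) (cis s)))\<^sup>2)) * indicator {0..2*pi} s"
  proof eventually_elim
    case (elim s)
    show ?case
    proof (cases "s \<in> {0..2*pi}")
      case True
      then have "cis s \<notin> Z" using elim by auto
      from assms(2)[OF this] show ?thesis by (rule arg_cong)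
    next
      case False
      show ?thesis unfolding indicator_simps(2)[OF False] mult_zero_right ..
    qed
  qed
qed

lemma sum_triangle_subset:
  fixes g :: "nat \<times> nat \<Rightarrow> real"
  assumes "finite F" "\<And>x. g x \<ge> 0"
  shows "\<exists>N. (\<Sum>x\<in>F. g x) \<le> (\<Sum>k<N. \<Sum>n\<le>k. g (k - n, n))"
proof -
  define N where "N = Suc (Max (insert 0 ((\<lambda>(m, n). m + n) ` F)))"
  have N: "m + n < N" if "(m, n) \<in> F" for m n
  proof -
    have "m + n \<in> insert 0 ((\<lambda>(m, n). m + n) ` F)" using that by force
    then show ?thesis unfolding N_def using assms(1) by (simp only: less_Suc_eq_le) (rule Max_ge; simp)
  qed
  have inj: "inj_on (\<lambda>(k, n). (k - n, n)) (SIGMA k:{..<N}. {..k})" by (auto simp: inj_on_def)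
  have "(\<Sum>x\<in>F. g x) \<le> (\<Sum>x\<in>(\<lambda>(k, n). (k - n, n)) ` (SIGMA k:{..<N}. {..k}). g x)"
  proof (rule sum_mono2)
    show "F \<subseteq> (\<lambda>(k, n). (k - n, n)) ` (SIGMA k:{..<N}. {..k})"
    proof clarify
      fix m n assume "(m, n) \<in> F"
      then show "(m, n) \<in> (\<lambda>(k, n). (k - n, n)) ` (SIGMA k:{..<N}. {..k})"
        using N by (intro image_eqI[of _ _ "(m + n, n)"]) auto
    qed
  qed (use assms(2) in auto)
  also have "\<dots> = (\<Sum>k<N. \<Sum>n\<le>k. g (k - n, n))"
    by (subst sum.reindex[OF inj]) (simp add: sum.Sigma case_prod_unfold)
  finally show ?thesis by blast
qed

lemma slice_energy_hpoly: "slice_energy (hpoly f) = ennreal (2 * pi * (norm f)\<^sup>2)"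
proof -
  let ?a = "\<lambda>k. \<Sum>n\<le>k. (cmod (hcoeff f (k - n, n)))\<^sup>2"
  have "(\<lambda>k. (cmod (hcoeff f k))\<^sup>2) summable_on UNIV" by (rule sq_summable_hcoeff)
  then have "((\<lambda>k. (cmod (hcoeff f k))\<^sup>2) has_sum (norm f)\<^sup>2) UNIV"
    unfolding norm_sq_hardy2 by (rule has_sum_infsum)
  then have "((\<lambda>x. (cmod (hcoeff f (case x of (k, n) \<Rightarrow> (k - n, n))))\<^sup>2) has_sum (norm f)\<^sup>2) (SIGMA k:UNIV. {..k})"
    by (subst has_sum_reindex_bij_betw[OF bij_triangle])
  then have "(?a has_sum (norm f)\<^sup>2) UNIV"
    by (rule has_sum_SigmaD) (auto intro!: has_sum_finiteI)
  then have s: "(\<lambda>k. 2 * pi * ?a k) sums (2 * pi * (norm f)\<^sup>2)"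
    by (intro sums_mult has_sum_imp_sums)
  have "slice_energy (hpoly f) = (\<Sum>k. ennreal (2 * pi * ?a k))"
    by (subst slice_energy_eq[OF degree_hpoly]) (simp add: coeff_hpoly cong: sum.cong_simp)
  also have "\<dots> = ennreal (\<Sum>k. 2 * pi * ?a k)"
    by (rule suminf_ennreal2) (use s in \<open>auto intro!: sum_nonneg mult_nonneg_nonneg simp: sums_iff\<close>)
  finally show ?thesis using s by (simp add: sums_iff)
qed

text \<open>By Parseval in \<omega>, finite energy is square summability of all coefficients. The
  degree bound guarantees that each coefficient n of \<open>c k\<close> has a place (k - n,
  n).\<close>

lemma hardy2_of_slices:
  assumes deg: "\<And>k. degree (c k) \<le> k" and fin: "slice_energy c < top"
  shows "\<exists>f. hpoly f = c"
proof -
  define a where "a = (\<lambda>(m, n). coeff (c (m + n)) n)"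
  let ?b = "\<lambda>k. 2 * pi * (\<Sum>n\<le>k. (cmod (coeff (c k) n))\<^sup>2)"
  have sm: "summable ?b"
  proof (rule summable_suminf_not_top)
    show "(\<Sum>k. ennreal (?b k)) \<noteq> top" using fin by (simp add: slice_energy_eq[OF deg])
  qed (auto intro!: mult_nonneg_nonneg sum_nonneg)
  have "(\<lambda>k. (cmod (a k))\<^sup>2) summable_on UNIV"
  proof (rule sq_summable_of_bound[where B = "(\<Sum>k. ?b k) / (2 * pi)"])
    fix F :: "(nat \<times> nat) set" assume "finite F"
    then obtain N where "(\<Sum>x\<in>F. (cmod (a x))\<^sup>2) \<le> (\<Sum>k<N. \<Sum>n\<le>k. (cmod (a (k - n, n)))\<^sup>2)"
      using sum_triangle_subset[of F "\<lambda>x. (cmod (a x))\<^sup>2"] by auto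
    also have "\<dots> = (\<Sum>k<N. ?b k) / (2 * pi)"
      by (simp add: a_def sum_divide_distrib)
    also have "\<dots> \<le> (\<Sum>k. ?b k) / (2 * pi)"
      by (intro divide_right_mono sum_le_suminf[OF sm]) (auto intro!: mult_nonneg_nonneg sum_nonneg)
    finally show "(\<Sum>x\<in>F. (cmod (a x))\<^sup>2) \<le> (\<Sum>k. ?b k) / (2 * pi)" .
  qed
  then have "hcoeff (Abs_hardy2 a) = a" by (simp add: Abs_hardy2_inverse)
  then have h: "hcoeff (Abs_hardy2 a) (m, n) = coeff (c (m + n)) n" for m n by (simp add: a_def)
  have "hpoly (Abs_hardy2 a) k = c k" for k
  proof (rule poly_eqI)
    fix n
    have "coeff (c k) n = 0" if "n > k" using deg[of k] that by (intro coeff_eq_0) auto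
    then show "coeff (hpoly (Abs_hardy2 a) k) n = coeff (c k) n" by (auto simp: coeff_hpoly h)
  qed
  then show ?thesis by blast
qed

lemma hpoly_inject: "hpoly f = hpoly g \<Longrightarrow> f = g"
proof (rule hardy2_eqI)
  fix m n assume "hpoly f = hpoly g"
  then have "coeff (hpoly f (m + n)) n = coeff (hpoly g (m + n)) n" by simp
  then show "hcoeff f (m, n) = hcoeff g (m, n)" by (simp add: coeff_hpoly)
qed

section \<open>Polynomials in two variables and reduced fractions\<close>

lemma poly2_0 [simp]: "poly2 0 z w = 0"
  by (simp add: poly2_def)

lemma poly2_pCons [simp]: "poly2 (pCons a q) z w = poly a z + w * poly2 q z w"
  by (simp add: poly2_def)

lemma poly2_mult: "poly2 (p * q) z w = poly2 p z w * poly2 q z w"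
  by (simp add: poly2_def)

lemma poly2_slice: "poly (poly q [:0, \<omega>:]) t = poly2 q t (t * \<omega>)"
  by (induction q) (simp_all add: algebra_simps)

lemma poly2_map_poly: "poly2 q z w = poly (map_poly (\<lambda>a. poly a z) q) w"
  by (induction q) (simp_all add: map_poly_pCons)

lemma continuous_poly2 [continuous_intros]:
  "continuous_on S f \<Longrightarrow> continuous_on S g \<Longrightarrow> continuous_on S (\<lambda>x. poly2 q (f x) (g x))"
  by (induction q) (auto intro!: continuous_intros)

lemma poly2_eq_0:
  assumes "infinite A" "\<And>z. z \<in> A \<Longrightarrow> infinite {w. poly2 q z w = 0}"
  shows "q = 0"
proof (rule poly_eqI)
  fix i
  have "poly (coeff q i) z = 0" if "z \<in> A" for z
  proof -
    have "map_poly (\<lambda>a. poly a z) q = 0"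
      using assms(2)[OF that] unfolding poly2_map_poly using poly_roots_finite by blast
    then have "coeff (map_poly (\<lambda>a. poly a z) q) i = 0" by simp
    then show ?thesis by (simp add: coeff_map_poly)
  qed
  then have "infinite {z. poly (coeff q i) z = 0}"
    using assms(1) by (metis (mono_tags, lifting) finite_subset mem_Collect_eq subsetI)
  then show "coeff q i = coeff 0 i" using poly_roots_finite[of "coeff q i"] by auto
qed

text \<open>A connected set with more than one point has no isolated points, so x can be approached
  while avoiding F. This is how factors are cancelled at their zeros throughout.\<close>

lemma eq_off_finite:
  fixes f g :: "'a::metric_space \<Rightarrow> 'b::t2_space"
  assumes "connected S" "x \<in> S" "S \<noteq> {x}" "continuous_on S f" "continuous_on S g" "finite F"
    and "\<And>y. y \<in> S - F \<Longrightarrow> f y = g y"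
  shows "f x = g x"
proof -
  have nb: "at x within S \<noteq> bot"
  proof -
    have "S \<noteq> {y}" for y using assms(2,3) by auto
    then have "x islimpt S" using connected_imp_perfect[OF assms(1,2)] by blast
    then show ?thesis by (simp add: trivial_limit_within)
  qed
  have f: "(f \<longlongrightarrow> f x) (at x within S)" and g: "(g \<longlongrightarrow> g x) (at x within S)"
    using assms(2,4,5) by (auto simp: continuous_on_def)
  have "open (- (F - {x}))" by (intro open_Compl finite_imp_closed finite_Diff assms(6))
  then have "\<forall>\<^sub>F y in at x within S. f y = g y"
    unfolding eventually_at_topological using assms(7) by (intro exI[of _ "- (F - {x})"]) auto
  then have "(f \<longlongrightarrow> g x) (at x within S)" using g by (simp cong: tendsto_cong)
  then show ?thesis using f nb tendsto_unique by blast
qed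

lemma connected_disk: "connected unit_disk" "unit_disk \<noteq> {x}"
proof -
  have "(0 :: complex) \<in> unit_disk" "(1 / 2 :: complex) \<in> unit_disk" by auto
  then show "unit_disk \<noteq> {x}" by (metis singletonD zero_neq_numeral divide_eq_0_iff zero_neq_one)
qed simp

lemma connected_circle: "connected (sphere (0 :: complex) 1)" "sphere (0 :: complex) 1 \<noteq> {x}"
proof -
  show "connected (sphere (0 :: complex) 1)" by (rule connected_sphere) simp
  have "(1 :: complex) \<in> sphere 0 1" "(-1 :: complex) \<in> sphere 0 1" by auto
  then show "sphere (0 :: complex) 1 \<noteq> {x}" by (metis singletonD one_neq_neg_one)
qed

lemma infinite_circle: "infinite (sphere (0 :: complex) 1)"
proof
  assume "finite (sphere (0 :: complex) 1)"
  then have "sphere (0 :: complex) 1 = {}"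
    using connected_finite_iff_sing[OF connected_circle(1)] connected_circle(2) by blast
  moreover have "(1 :: complex) \<in> sphere 0 1" by simp
  ultimately show False by blast
qed

text \<open>Common linear factors are divided out one at a time, each lowering the degree of
  Q.\<close>

lemma reduced_fraction:
  fixes P Q :: "complex poly"
  assumes "Q \<noteq> 0"
  shows "\<exists>g P' Q'. g \<noteq> 0 \<and> P = g * P' \<and> Q = g * Q' \<and> (\<forall>c. poly P' c = 0 \<longrightarrow> poly Q' c \<noteq> 0)"
  using assms
proof (induction "degree Q" arbitrary: P Q rule: less_induct)
  case less
  show ?case
  proof (cases "\<exists>c. poly P c = 0 \<and> poly Q c = 0")
    case True
    then obtain c P1 Q1 where PQ: "P = [:-c, 1:] * P1" "Q = [:-c, 1:] * Q1"
      unfolding poly_eq_0_iff_dvd dvd_def by blast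
    have "Q1 \<noteq> 0" using less.prems PQ(2) by auto
    then have "degree Q1 < degree Q" unfolding PQ(2) by (subst degree_mult_eq) auto
    from less.hyps[OF this \<open>Q1 \<noteq> 0\<close>, of P1] obtain g P' Q' where
      "g \<noteq> 0" "P1 = g * P'" "Q1 = g * Q'" "\<forall>c. poly P' c = 0 \<longrightarrow> poly Q' c \<noteq> 0" by blast
    then show ?thesis unfolding PQ
      by (intro exI[of _ "[:-c, 1:] * g"] exI[of _ P'] exI[of _ Q']) (auto simp only: mult.assoc mult_eq_0_iff pCons_eq_0_iff one_neq_zero simp_thms)
  next
    case False
    then show ?thesis by (intro exI[of _ 1] exI[of _ P] exI[of _ Q]) auto
  qed
qed

section \<open>Rational inner functions\<close>

text \<open>\<open>unimodular\<close> is what is kept of the inner property. It avoids quotients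
  because p and q may have common zeros on the torus.\<close>

locale rational_rep =
  fixes \<theta> :: hardy2 and p q :: "complex poly poly"
  assumes q_nz: "q \<noteq> 0"
    and rep: "z \<in> unit_disk \<Longrightarrow> w \<in> unit_disk \<Longrightarrow> heval \<theta> z w * poly2 q z w = poly2 p z w"
    and unimodular: "cmod z = 1 \<Longrightarrow> cmod w = 1 \<Longrightarrow> cmod (poly2 p z w) = cmod (poly2 q z w)"

text \<open>Radial limits of modulus 1 give |p| = |q| almost everywhere on the torus. By continuity
  the exceptional set is open in the open square of angles, and an open null set is empty; closure
  then yields the boundary of the square.\<close>

lemma rational_rep_exists:
  assumes "rational_inner \<theta>"
  shows "\<exists>p q. rational_rep \<theta> p q"
proof -
  obtain p q where q: "q \<noteq> 0"
    and pq: "\<And>z w. z \<in> unit_disk \<Longrightarrow> w \<in> unit_disk \<Longrightarrow> heval \<theta> z w * poly2 q z w = poly2 p z w"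
    using assms by (auto simp: rational_inner_def rational_fun_def)
  define F where "F = (\<lambda>x::real \<times> real. cmod (poly2 p (cis (fst x)) (cis (snd x))) - cmod (poly2 q (cis (fst x)) (cis (snd x))))"
  have cF: "continuous_on UNIV F"
    unfolding F_def by (intro continuous_intros)
  have F0: "F (s, t) = 0"
    if b: "((\<lambda>r. heval \<theta> (complex_of_real r * cis s) (complex_of_real r * cis t)) \<longlongrightarrow> b) (at_left 1)" "cmod b = 1" for s t b
  proof -
    have lim: "((\<lambda>r. poly2 c (complex_of_real r * cis s) (complex_of_real r * cis t)) \<longlongrightarrow> poly2 c (cis s) (cis t)) (at_left 1)" for c
    proof -
      have "continuous_on UNIV (\<lambda>r. poly2 c (complex_of_real r * cis s) (complex_of_real r * cis t))"
        by (intro continuous_intros)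
      then have "((\<lambda>r. poly2 c (complex_of_real r * cis s) (complex_of_real r * cis t)) \<longlongrightarrow>
          poly2 c (complex_of_real 1 * cis s) (complex_of_real 1 * cis t)) (at 1)"
        unfolding continuous_on_def by blast
      from tendsto_within_subset[OF this subset_UNIV, of "{..<1}"] show ?thesis by simp
    qed
    have "\<forall>\<^sub>F r in at_left (1::real). r \<in> {0<..<1}" by (rule eventually_at_left_real) simp
    then have "\<forall>\<^sub>F r in at_left 1. heval \<theta> (complex_of_real r * cis s) (complex_of_real r * cis t) *
        poly2 q (complex_of_real r * cis s) (complex_of_real r * cis t) = poly2 p (complex_of_real r * cis s) (complex_of_real r * cis t)"
      by eventually_elim (rule pq; simp add: norm_mult)
    then have "((\<lambda>r. poly2 p (complex_of_real r * cis s) (complex_of_real r * cis t)) \<longlongrightarrow> b * poly2 q (cis s) (cis t)) (at_left 1)"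
      using tendsto_mult[OF b(1) lim[of q]] by (simp cong: tendsto_cong)
    then have "b * poly2 q (cis s) (cis t) = poly2 p (cis s) (cis t)"
      using lim[of p] tendsto_unique[OF trivial_limit_at_left_real] by blast
    then show ?thesis using b(2) by (simp add: F_def norm_mult flip: \<open>b * _ = _\<close>)
  qed
  define B where "B = box (0::real \<times> real) (2*pi, 2*pi)"
  have "AE x in lborel. x \<notin> B \<inter> {x. F x \<noteq> 0}"
    using assms unfolding rational_inner_def inner_fun_def
  proof (elim conjE AE_mp, intro AE_I2, clarify)
    fix s t assume H: "s \<in> {0..2*pi} \<and> t \<in> {0..2*pi} \<longrightarrow> (\<exists>b. ((\<lambda>r. heval \<theta> (complex_of_real r * cis s) (complex_of_real r * cis t)) \<longlongrightarrow> b) (at_left 1) \<and> cmod b = 1)"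
      and st: "(s, t) \<in> B" "F (s, t) \<noteq> 0"
    have "s \<in> {0..2*pi} \<and> t \<in> {0..2*pi}" using st(1) by (auto simp: B_def box_def Basis_prod_def zero_prod_def)
    then show False using H F0 st(2) by blast
  qed
  moreover have opB: "open (B \<inter> {x. F x \<noteq> 0})"
    unfolding B_def by (intro open_Int open_box open_Collect_neq cF continuous_on_const)
  ultimately have "B \<inter> {x. F x \<noteq> 0} \<in> null_sets lborel"
    by (subst (asm) AE_iff_null_sets[symmetric]) auto
  then have "negligible (B \<inter> {x. F x \<noteq> 0})"
    unfolding negligible_iff_null_sets by (rule null_sets_completionI)
  then have "B \<inter> {x. F x \<noteq> 0} = {}" using open_not_negligible[OF opB] by blast
  then have "B \<subseteq> F -` {0}" by auto
  moreover have "closed (F -` {0})" by (intro continuous_closed_vimage) (use cF in \<open>auto simp: continuous_on_eq_continuous_at\<close>)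
  ultimately have "closure B \<subseteq> F -` {0}" by (rule closure_minimal)
  moreover have "closure B = cbox 0 (2*pi, 2*pi)"
    unfolding B_def by (rule closure_box) (auto simp: box_ne_empty Basis_prod_def zero_prod_def)
  ultimately have F1: "F (s, t) = 0" if "s \<in> {0..2*pi}" "t \<in> {0..2*pi}" for s t
    using that by (auto simp: cbox_def Basis_prod_def zero_prod_def subset_iff)
  have "cmod (poly2 p z w) = cmod (poly2 q z w)" if "cmod z = 1" "cmod w = 1" for z w
  proof -
    have "z = cis (Arg2pi z)" "w = cis (Arg2pi w)"
      using Arg2pi_eq[of z] Arg2pi_eq[of w] that by (simp_all add: cis_conv_exp)
    then show ?thesis using F1[of "Arg2pi z" "Arg2pi w"] Arg2pi[of z] Arg2pi[of w]
      by (simp add: F_def)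
  qed
  then show ?thesis using q pq unfolding rational_rep_def by blast
qed

text \<open>If p vanishes on the whole line w = \<tau> with \<tau> on the circle, then so does q,
  since |p| = |q| on the torus. Hence w - \<tau> divides both and can be cancelled, lowering the
  degree of q in w.\<close>

lemma rational_rep_reduced:
  assumes "rational_rep \<theta> p q"
  shows "\<exists>p q. rational_rep \<theta> p q \<and> (\<forall>\<tau>. cmod \<tau> = 1 \<longrightarrow> (\<exists>z. poly2 p z \<tau> \<noteq> 0))"
  using assms
proof (induction "degree q" arbitrary: p q rule: less_induct)
  case less
  interpret rational_rep \<theta> p q by fact
  show ?case
  proof (cases "\<exists>\<tau>. cmod \<tau> = 1 \<and> (\<forall>z. poly2 p z \<tau> = 0)")
    case True
    then obtain \<tau> where \<tau>: "cmod \<tau> = 1" "\<And>z. poly2 p z \<tau> = 0" by blast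
    have "poly (poly q [:\<tau>:]) z = 0" if "z \<in> sphere 0 1" for z
      using unimodular[of z \<tau>] \<tau> that by (simp add: poly2_def)
    then have "poly q [:\<tau>:] = 0"
      using poly_roots_finite infinite_circle by (metis (mono_tags, lifting) finite_subset mem_Collect_eq subsetI)
    then obtain q1 where q1: "q = [:-[:\<tau>:], 1:] * q1"
      unfolding poly_eq_0_iff_dvd dvd_def by blast
    have "poly p [:\<tau>:] = 0" using \<tau>(2) unfolding poly2_def by (simp flip: poly_all_0_iff_0)
    then obtain p1 where p1: "p = [:-[:\<tau>:], 1:] * p1"
      unfolding poly_eq_0_iff_dvd dvd_def by blast
    have l: "poly2 [:-[:\<tau>:], 1:] z w = w - \<tau>" for z w by (simp add: poly2_def)
    have pe: "poly2 p z w = (w - \<tau>) * poly2 p1 z w" and qe: "poly2 q z w = (w - \<tau>) * poly2 q1 z w" for z w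
      by (simp_all only: p1 q1 poly2_mult l)
    have "q1 \<noteq> 0" using q_nz q1 by auto
    have "rational_rep \<theta> p1 q1"
    proof
      show "q1 \<noteq> 0" by fact
      show "heval \<theta> z w * poly2 q1 z w = poly2 p1 z w" if "z \<in> unit_disk" "w \<in> unit_disk" for z w
        using rep[OF that] that \<tau>(1) by (auto simp: pe qe)
      show "cmod (poly2 p1 z w) = cmod (poly2 q1 z w)" if z: "cmod z = 1" and w: "cmod w = 1" for z w
      proof (rule eq_off_finite[OF connected_circle(1) _ connected_circle(2), where F = "{\<tau>}"
            and f = "\<lambda>w. cmod (poly2 p1 z w)" and g = "\<lambda>w. cmod (poly2 q1 z w)"])
        show "cmod (poly2 p1 z y) = cmod (poly2 q1 z y)" if "y \<in> sphere 0 1 - {\<tau>}" for y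
          using unimodular[OF z, of y] that by (auto simp: pe qe norm_mult)
      qed (use w in \<open>auto intro!: continuous_intros\<close>)
    qed
    moreover have "degree q1 < degree q" unfolding q1 using \<open>q1 \<noteq> 0\<close> by (subst degree_mult_eq) auto
    ultimately show ?thesis using less.hyps by blast
  next
    case False
    then show ?thesis using less.prems by blast
  qed
qed

context rational_rep
begin

text \<open>A bad slope means that q vanishes on the line w = \<omega> z; infinitely many such lines
  would give every fiber over z \<noteq> 0 infinitely many zeros.\<close>

lemma finite_bad_slopes: "finite {\<omega>. poly q [:0, \<omega>:] = 0}"
proof (rule ccontr)
  assume inf: "infinite {\<omega>. poly q [:0, \<omega>:] = 0}"
  have "q = 0"
  proof (rule poly2_eq_0)
    show "infinite (- {0 :: complex})" by (simp add: infinite_UNIV_char_0)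
    fix z :: complex assume z: "z \<in> - {0}"
    have "(\<lambda>\<omega>. z * \<omega>) ` {\<omega>. poly q [:0, \<omega>:] = 0} \<subseteq> {w. poly2 q z w = 0}"
      by (auto simp flip: poly2_slice)
    moreover have "infinite ((\<lambda>\<omega>. z * \<omega>) ` {\<omega>. poly q [:0, \<omega>:] = 0})"
      using inf z by (subst finite_image_iff) (auto simp: inj_on_def)
    ultimately show "infinite {w. poly2 q z w = 0}" using finite_subset by blast
  qed
  then show False using q_nz by simp
qed

text \<open>On the slice \<theta> is P / Q in lowest terms. A zero of Q would also be a zero of P:
  on the circle because |P| = |Q|, inside because \<theta> Q = P. So P / Q is continuous on the
  closed disk and unimodular on the circle.\<close>

lemma slice_unimodular:
  assumes \<omega>: "cmod \<omega> = 1" "poly q [:0, \<omega>:] \<noteq> 0"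
  shows "\<exists>b. continuous_on (cball 0 1) b \<and> (\<forall>t. cmod t = 1 \<longrightarrow> cmod (b t) = 1) \<and>
             (\<forall>t. cmod t < 1 \<longrightarrow> heval \<theta> t (t * \<omega>) = b t)"
proof -
  obtain g P Q where g: "g \<noteq> 0" "poly p [:0, \<omega>:] = g * P" "poly q [:0, \<omega>:] = g * Q"
    and cop: "\<And>c. poly P c = 0 \<Longrightarrow> poly Q c \<noteq> 0"
    using reduced_fraction[OF \<omega>(2), of "poly p [:0, \<omega>:]"] by blast
  have fin: "finite {t. poly g t = 0}" using poly_roots_finite[OF g(1)] .
  have p: "poly2 p t (t * \<omega>) = poly g t * poly P t" and q: "poly2 q t (t * \<omega>) = poly g t * poly Q t" for t
    using g(2,3) by (simp_all flip: poly2_slice)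
  have circ: "cmod (poly P t) = cmod (poly Q t)" if t: "cmod t = 1" for t
  proof (rule eq_off_finite[OF connected_circle(1) _ connected_circle(2) _ _ fin,
        where f = "\<lambda>t. cmod (poly P t)" and g = "\<lambda>t. cmod (poly Q t)"])
    show "cmod (poly P y) = cmod (poly Q y)" if "y \<in> sphere 0 1 - {t. poly g t = 0}" for y
      using unimodular[of y "y * \<omega>"] that \<omega>(1) by (simp add: p q norm_mult)
  qed (use t in \<open>auto intro!: continuous_intros\<close>)
  have disk: "heval \<theta> t (t * \<omega>) * poly Q t = poly P t" if t: "t \<in> unit_disk" for t
  proof (rule eq_off_finite[OF connected_disk(1) t connected_disk(2) _ _ fin,
        where f = "\<lambda>t. heval \<theta> t (t * \<omega>) * poly Q t" and g = "poly P"])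
    show "continuous_on unit_disk (\<lambda>t. heval \<theta> t (t * \<omega>) * poly Q t)"
      by (intro continuous_intros continuous_heval_comp) (use \<omega> in \<open>auto simp: norm_mult\<close>)
    show "heval \<theta> y (y * \<omega>) * poly Q y = poly P y" if "y \<in> unit_disk - {t. poly g t = 0}" for y
      using rep[of y "y * \<omega>"] that \<omega>(1) by (simp add: p q norm_mult)
  qed (auto intro!: continuous_intros)
  have Q: "poly Q t \<noteq> 0" if "cmod t \<le> 1" for t
  proof (cases "cmod t = 1")
    case True
    then show ?thesis using circ[OF True] cop[of t] by auto
  next
    case False
    then show ?thesis using disk[of t] cop[of t] that by auto
  qed
  show ?thesis
  proof (intro exI[of _ "\<lambda>t. poly P t / poly Q t"] conjI allI impI)
    show "continuous_on (cball 0 1) (\<lambda>t. poly P t / poly Q t)"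
      by (intro continuous_intros) (use Q in auto)
    show "cmod (poly P t / poly Q t) = 1" if "cmod t = 1" for t
      using circ[OF that] Q[of t] that by (simp add: norm_divide)
    show "heval \<theta> t (t * \<omega>) = poly P t / poly Q t" if "cmod t < 1" for t
      using disk[of t] Q[of t] that by (simp add: field_simps)
  qed
qed

text \<open>Multiplication by \<theta> preserves the Hardy norm on all but finitely many slices.
  Here x may be merely a candidate for a Hardy function, which is what both the product and the
  quotient by \<theta> require; Z collects further slopes to be avoided.\<close>

lemma slice_energy_transfer:
  assumes Z: "finite Z"
    and "\<And>\<omega> t. cmod \<omega> = 1 \<Longrightarrow> poly q [:0, \<omega>:] \<noteq> 0 \<Longrightarrow> \<omega> \<notin> Z \<Longrightarrow> cmod t < 1 \<Longrightarrow>
      (\<lambda>k. poly (x k) \<omega> * t ^ k) sums X \<omega> t"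
    and "\<And>\<omega> t. cmod \<omega> = 1 \<Longrightarrow> poly q [:0, \<omega>:] \<noteq> 0 \<Longrightarrow> \<omega> \<notin> Z \<Longrightarrow> cmod t < 1 \<Longrightarrow>
      (\<lambda>k. poly (y k) \<omega> * t ^ k) sums (heval \<theta> t (t * \<omega>) * X \<omega> t)"
  shows "slice_energy y = slice_energy x"
proof (rule slice_energy_cong)
  show "finite ({\<omega>. poly q [:0, \<omega>:] = 0} \<union> Z)" using finite_bad_slopes Z by simp
  fix s assume s: "cis s \<notin> {\<omega>. poly q [:0, \<omega>:] = 0} \<union> Z"
  then have s': "cmod (cis s) = 1" "poly q [:0, cis s:] \<noteq> 0" "cis s \<notin> Z" by auto
  obtain b where b: "continuous_on (cball 0 1) b" "\<And>t. cmod t = 1 \<Longrightarrow> cmod (b t) = 1"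
    "\<And>t. cmod t < 1 \<Longrightarrow> heval \<theta> t (t * cis s) = b t"
    using slice_unimodular[OF s'(1,2)] by blast
  show "(\<Sum>k. ennreal ((cmod (poly (y k) (cis s)))\<^sup>2)) = (\<Sum>k. ennreal ((cmod (poly (x k) (cis s)))\<^sup>2))"
    by (rule hardy_norm_unimodular_mult[OF assms(2)[OF s'] assms(3)[OF s'] _ b(1,2)]) (simp_all add: b(3))
qed

text \<open>The components of the product are Cauchy products of components. The resulting series
  has the same energy as g, which puts it into the Hardy space with the norm of g.\<close>

lemma mult_exists:
  "\<exists>h. (\<forall>z\<in>unit_disk. \<forall>w\<in>unit_disk. heval h z w = heval \<theta> z w * heval g z w) \<and> norm h = norm g \<and>
       hpoly h = (\<lambda>k. \<Sum>j\<le>k. hpoly \<theta> j * hpoly g (k - j))"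
proof -
  define c where "c k = (\<Sum>j\<le>k. hpoly \<theta> j * hpoly g (k - j))" for k
  have deg: "degree (c k) \<le> k" for k
    unfolding c_def
  proof (rule degree_sum_le)
    fix j assume "j \<in> {..k}"
    then show "degree (hpoly \<theta> j * hpoly g (k - j)) \<le> k"
      using degree_mult_le[of "hpoly \<theta> j" "hpoly g (k - j)"] degree_hpoly[of \<theta> j] degree_hpoly[of g "k - j"] by simp
  qed simp
  have sums: "(\<lambda>k. poly (c k) \<omega> * t ^ k) sums (heval \<theta> t (t * \<omega>) * heval g t (t * \<omega>))"
    if "t \<in> unit_disk" "t * \<omega> \<in> unit_disk" for t \<omega>
  proof -
    have "(\<lambda>k. \<Sum>j\<le>k. (poly (hpoly \<theta> j) \<omega> * t ^ j) * (poly (hpoly g (k - j)) \<omega> * t ^ (k - j))) sums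
        ((\<Sum>k. poly (hpoly \<theta> k) \<omega> * t ^ k) * (\<Sum>k. poly (hpoly g k) \<omega> * t ^ k))"
      by (rule Cauchy_product_sums) (rule heval_slice(2)[OF that])+
    moreover have "(\<Sum>j\<le>k. (poly (hpoly \<theta> j) \<omega> * t ^ j) * (poly (hpoly g (k - j)) \<omega> * t ^ (k - j))) = poly (c k) \<omega> * t ^ k" for k
      unfolding c_def poly_sum sum_distrib_right
    proof (rule sum.cong)
      fix j assume "j \<in> {..k}"
      then have "t ^ k = t ^ j * t ^ (k - j)" by (simp flip: power_add)
      then show "(poly (hpoly \<theta> j) \<omega> * t ^ j) * (poly (hpoly g (k - j)) \<omega> * t ^ (k - j)) = poly (hpoly \<theta> j * hpoly g (k - j)) \<omega> * t ^ k"
        by simp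
    qed simp
    ultimately show ?thesis
      using heval_slice(1)[OF that, of \<theta>] heval_slice(1)[OF that, of g] by (simp add: sums_iff)
  qed
  have en: "slice_energy c = slice_energy (hpoly g)"
  proof (rule slice_energy_transfer[where Z = "{}" and X = "\<lambda>\<omega> t. heval g t (t * \<omega>)"])
    fix \<omega> t :: complex assume "cmod \<omega> = 1" "cmod t < 1"
    then have "t \<in> unit_disk" "t * \<omega> \<in> unit_disk" by (auto simp: norm_mult)
    then show "(\<lambda>k. poly (hpoly g k) \<omega> * t ^ k) sums heval g t (t * \<omega>)"
      "(\<lambda>k. poly (c k) \<omega> * t ^ k) sums (heval \<theta> t (t * \<omega>) * heval g t (t * \<omega>))"
      using heval_slice(1) sums by blast+
  qed simp
  obtain h where h: "hpoly h = c"
    using hardy2_of_slices[OF deg] en by (auto simp: slice_energy_hpoly)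
  \<comment> \<open>A point with z \<noteq> 0 lies on the slice of slope w / z; the axis z = 0 is
    reached by continuity.\<close>
  have "heval h z w = heval \<theta> z w * heval g z w" if z: "z \<in> unit_disk" and w: "w \<in> unit_disk" for z w
  proof (rule eq_off_finite[OF connected_disk(1) z connected_disk(2), where F = "{0}"
        and f = "\<lambda>z. heval h z w" and g = "\<lambda>z. heval \<theta> z w * heval g z w"])
    show "heval h z w = heval \<theta> z w * heval g z w" if "z \<in> unit_disk - {0}" for z
    proof -
      have z: "z \<in> unit_disk" "z * (w / z) \<in> unit_disk" using that w by auto
      have "z * (w / z) = w" using that by simp
      then show ?thesis
        using heval_slice(1)[OF z, of h] sums[OF z] sums_unique2 unfolding h by fastforce
    qed
  qed (use w in \<open>auto intro!: continuous_intros continuous_heval_comp\<close>)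
  moreover have "norm h = norm g"
  proof -
    have "ennreal (2 * pi * (norm h)\<^sup>2) = ennreal (2 * pi * (norm g)\<^sup>2)"
      using en unfolding h[symmetric] slice_energy_hpoly .
    then have "2 * pi * (norm h)\<^sup>2 = 2 * pi * (norm g)\<^sup>2" by (subst (asm) ennreal_inj) auto
    then show ?thesis by (simp add: power2_eq_iff_nonneg)
  qed
  moreover have "hpoly h = (\<lambda>k. \<Sum>j\<le>k. hpoly \<theta> j * hpoly g (k - j))"
    using h by (simp add: c_def fun_eq_iff)
  ultimately show ?thesis by blast
qed

section \<open>Multiplication by \<theta> as an isometry with closed range\<close>

definition theta_mult :: "hardy2 \<Rightarrow> hardy2" where
  "theta_mult g = (SOME h. \<forall>z\<in>unit_disk. \<forall>w\<in>unit_disk. heval h z w = heval \<theta> z w * heval g z w)"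

lemma heval_theta_mult: "z \<in> unit_disk \<Longrightarrow> w \<in> unit_disk \<Longrightarrow> heval (theta_mult g) z w = heval \<theta> z w * heval g z w"
proof -
  have "\<exists>h. \<forall>z\<in>unit_disk. \<forall>w\<in>unit_disk. heval h z w = heval \<theta> z w * heval g z w"
    using mult_exists by blast
  from someI_ex[OF this] show "z \<in> unit_disk \<Longrightarrow> w \<in> unit_disk \<Longrightarrow> heval (theta_mult g) z w = heval \<theta> z w * heval g z w"
    by (simp add: theta_mult_def)
qed

lemma theta_mult_eqI: "(\<And>z w. z \<in> unit_disk \<Longrightarrow> w \<in> unit_disk \<Longrightarrow> heval h z w = heval \<theta> z w * heval g z w) \<Longrightarrow> h = theta_mult g"
  by (rule heval_inject) (simp add: heval_theta_mult)

lemma norm_theta_mult: "norm (theta_mult g) = norm g"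
  and hpoly_theta_mult: "hpoly (theta_mult g) k = (\<Sum>j\<le>k. hpoly \<theta> j * hpoly g (k - j))"
proof -
  obtain h where h: "\<forall>z\<in>unit_disk. \<forall>w\<in>unit_disk. heval h z w = heval \<theta> z w * heval g z w"
    "norm h = norm g" "hpoly h = (\<lambda>k. \<Sum>j\<le>k. hpoly \<theta> j * hpoly g (k - j))"
    using mult_exists by blast
  have "h = theta_mult g" by (rule theta_mult_eqI) (use h(1) in blast)
  then show "norm (theta_mult g) = norm g" "hpoly (theta_mult g) k = (\<Sum>j\<le>k. hpoly \<theta> j * hpoly g (k - j))"
    using h(2,3) by (simp_all add: fun_eq_iff)
qed

lemma theta_mult_linear: "theta_mult (x + y) = theta_mult x + theta_mult y" "theta_mult (x - y) = theta_mult x - theta_mult y" "theta_mult (a *\<^sub>C x) = a *\<^sub>C theta_mult x"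
  "theta_mult (Az c x) = Az c (theta_mult x)" "theta_mult (mult_z x) = mult_z (theta_mult x)"
  by (rule theta_mult_eqI[symmetric]; simp add: heval_linear heval_theta_mult heval_Az heval_mult_z algebra_simps)+

lemma mult_range_eq: "mult_range \<theta> = range theta_mult"
  using theta_mult_eqI heval_theta_mult unfolding mult_range_def by blast

lemma bounded_op_theta_mult: "bounded_op_on UNIV theta_mult"
  unfolding bounded_op_on_def by (auto simp: theta_mult_linear norm_theta_mult intro!: exI[of _ 1])

lemma csubspace_mult_range: "csubspace (mult_range \<theta>)"
  unfolding mult_range_eq by (rule csubspace_range[OF _ bounded_op_theta_mult]) (rule csubspaceI; simp)

lemma closed_mult_range: "closed (mult_range \<theta>)"
  unfolding mult_range_eq
  by (rule closed_range_of_bounded_below[OF _ _ bounded_op_theta_mult, of 1]) (auto intro: csubspaceI simp: norm_theta_mult)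

end

section \<open>Fibers\<close>

lemma cinner_foldr_Aw: "cinner (foldr Aw as g) x = cinner g (fold Bw as x)"
  by (induction as arbitrary: x) (simp_all add: cinner_Aw)

lemma heval_foldr_Aw:
  assumes "z \<in> unit_disk" "w \<in> unit_disk"
  shows "heval (foldr Aw as g) z w = (\<Prod>a\<leftarrow>as. w - a) * heval g z w"
  by (induction as) (simp_all add: heval_Az[OF assms])

lemma fold_Bw_zero: "fold Bw as 0 = 0"
  by (induction as) (simp_all add: A_linear)

lemma norm_foldr_Aw_ge:
  assumes "\<And>a. a \<in> set as \<Longrightarrow> cmod a \<noteq> 1"
  shows "\<exists>C>0. \<forall>x. C * norm x \<le> norm (foldr Aw as x)"
  using assms
proof (induction as)
  case Nil
  then show ?case by (intro exI[of _ 1]) auto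
next
  case (Cons a as)
  then obtain C where C: "C > 0" "\<And>x. C * norm x \<le> norm (foldr Aw as x)" by auto
  have "\<bar>1 - cmod a\<bar> * C * norm x \<le> norm (foldr Aw (a # as) x)" for x
    using mult_left_mono[OF C(2)[of x], of "\<bar>1 - cmod a\<bar>"] norm_Aw_ge[of a "foldr Aw as x"] by (simp add: mult.assoc)
  then show ?case using C(1) Cons.prems[of a] by (intro exI[of _ "\<bar>1 - cmod a\<bar> * C"]) auto
qed

lemma norm_foldr_Aw_le: "\<exists>C>0. \<forall>x. norm (foldr Aw as x) \<le> C * norm x"
proof (induction as)
  case Nil
  then show ?case by (intro exI[of _ 1]) auto
next
  case (Cons a as)
  then obtain C where C: "C > 0" "\<And>x. norm (foldr Aw as x) \<le> C * norm x" by auto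
  have "norm (foldr Aw (a # as) x) \<le> (1 + cmod a) * C * norm x" for x
    using mult_left_mono[OF C(2)[of x], of "1 + cmod a"] norm_Aw_le[of a "foldr Aw as x"] by (simp add: mult.assoc)
  then show ?case using C(1) by (intro exI[of _ "(1 + cmod a) * C"]) (auto simp: add_pos_nonneg)
qed

lemma fold_Bw_injective:
  "fold Bw bs x = 0 \<Longrightarrow> (\<And>b. b \<in> set bs \<Longrightarrow> cmod b \<ge> 1) \<Longrightarrow> x = 0"
proof (induction bs arbitrary: x)
  case (Cons b bs)
  then have "Bw b x = 0" by simp
  then show ?case using Bw_injective Cons.prems(2) by simp
qed simp

text \<open>For c in the disk these are the functions h(w) / (1 - cnj c z), a copy of the Hardy
  space in w.\<close>

definition back_eigenspace :: "complex \<Rightarrow> hardy2 set" where "back_eigenspace c = {x. Bz c x = 0}"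

lemma back_eigenspace_eq: "back_eigenspace c = orthogonal_complement (range (Az c))"
proof -
  have "Bz c x = 0" if "\<And>u. cinner x (Az c u) = 0" for x
  proof -
    have "cinner (Az c (Bz c x)) x = 0" using that by (subst cinner_commute) simp
    then show ?thesis by (simp add: cinner_Az cinner_self)
  qed
  moreover have "cinner x (Az c u) = 0" if "Bz c x = 0" for x u
    using that by (subst cinner_commute) (simp add: cinner_Az)
  ultimately show ?thesis by (auto simp: back_eigenspace_def orthogonal_complement_def)
qed

lemma csubspace_back_eigenspace: "csubspace (back_eigenspace c)" and closed_back_eigenspace: "closed (back_eigenspace c)"
  unfolding back_eigenspace_eq by (rule csubspace_orthogonal_complement closed_orthogonal_complement)+

text \<open>The difference u - v is divisible by z - c, and eigenvectors are orthogonal to all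
  multiples of z - c. Pairing with an eigenvector therefore sees only the fiber z = c, which reduces
  matters to one variable.\<close>

lemma cinner_back_eigenspace_cong:
  assumes c: "c \<in> unit_disk" and x: "x \<in> back_eigenspace c"
    and uv: "\<And>w. w \<in> unit_disk \<Longrightarrow> heval u c w = heval v c w"
  shows "cinner u x = cinner v x"
proof -
  obtain k where "u - v = Az c k"
    using vanish_imp_Az[OF c, of "u - v"] uv c by (auto simp: heval_linear)
  then have "cinner (u - v) x = 0" using x by (simp add: cinner_Az back_eigenspace_def)
  then show ?thesis by (simp add: cinner_diff_left)
qed

lemma back_eigenspace_Bw: "x \<in> back_eigenspace c \<Longrightarrow> Bw a x \<in> back_eigenspace c" "x \<in> back_eigenspace c \<Longrightarrow> fold Bw as x \<in> back_eigenspace c"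
proof -
  show 1: "Bw a x \<in> back_eigenspace c" if "x \<in> back_eigenspace c" for a x
    using that A_commute(2)[of a c x] by (simp add: back_eigenspace_def A_linear)
  show "fold Bw as x \<in> back_eigenspace c" if "x \<in> back_eigenspace c" for as x
    using that by (induction as arbitrary: x) (simp_all add: 1)
qed

text \<open>Applying \<open>back_w\<close> to the fixed point equation x = w y + cnj a w x gives the
  claim. Multiplication by w commutes with \<open>back_z\<close>, so the iteration stays inside the
  eigenspace.\<close>

lemma Bw_surjective:
  assumes a: "a \<in> unit_disk" and y: "y \<in> back_eigenspace c"
  shows "\<exists>x\<in>back_eigenspace c. Bw a x = y"
proof -
  have mw: "mult_w x \<in> back_eigenspace c" if "x \<in> back_eigenspace c" for x
  proof -
    have "Bz c (mult_w x) = mult_w (Bz c x)" by (simp add: Bz_def shift_commute shift_linear)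
    then show ?thesis using that by (simp add: back_eigenspace_def shift_linear)
  qed
  define F where "F x = mult_w y + cnj a *\<^sub>C mult_w x" for x
  have "\<exists>!x\<in>back_eigenspace c. F x = x"
  proof (rule Banach_fix[where c = "cmod a"])
    show "complete (back_eigenspace c)" using closed_back_eigenspace by (simp add: complete_eq_closed)
    show "back_eigenspace c \<noteq> {}" using y by blast
    show "F ` back_eigenspace c \<subseteq> back_eigenspace c"
      using y mw csubspace_closed_ops[OF csubspace_back_eigenspace] by (auto simp: F_def)
    show "dist (F u) (F v) \<le> cmod a * dist u v" for u v
    proof -
      have "F u - F v = cnj a *\<^sub>C mult_w (u - v)"
        by (simp add: F_def shift_linear complex_vector.scale_right_diff_distrib)
      then show ?thesis by (simp add: dist_norm norm_scaleC)
    qed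
  qed (use a in auto)
  then obtain x where x: "x \<in> back_eigenspace c" "F x = x" by blast
  have "back_w (F x) = y + cnj a *\<^sub>C x" by (simp add: F_def shift_linear)
  then have "back_w x = y + cnj a *\<^sub>C x" unfolding x(2) .
  then show ?thesis using x(1) by (intro bexI[of _ x]) (simp_all add: Bw_def)
qed

lemma szego_eigen:
  assumes "c \<in> unit_disk" "a \<in> unit_disk"
  shows "szego c a \<in> back_eigenspace c" "Bw a (szego c a) = 0" "szego c a \<noteq> 0"
proof -
  show "szego c a \<in> back_eigenspace c" unfolding back_eigenspace_def by (auto intro!: hardy2_eqI simp: Bz_def hcoeff_szego[OF assms])
  show "Bw a (szego c a) = 0" by (rule hardy2_eqI) (simp add: Bw_def hcoeff_szego[OF assms])
  have "hcoeff (szego c a) (0, 0) = 1" by (simp add: hcoeff_szego[OF assms])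
  then show "szego c a \<noteq> 0" by auto
qed

text \<open>The two eigenvalue equations make the coefficients geometric in both indices, so the
  coefficient at (0, 0) determines x.\<close>

lemma Bw_kernel:
  assumes c: "c \<in> unit_disk" "a \<in> unit_disk" and x: "x \<in> back_eigenspace c"
  shows "Bw a x = 0 \<longleftrightarrow> (\<exists>\<alpha>. x = \<alpha> *\<^sub>C szego c a)"
proof
  assume B: "Bw a x = 0"
  have z: "hcoeff x (Suc m, n) = cnj c * hcoeff x (m, n)" for m n
  proof -
    have "hcoeff (Bz c x) (m, n) = 0" using x by (simp add: back_eigenspace_def)
    then show ?thesis by (simp add: Bz_def)
  qed
  have w: "hcoeff x (m, Suc n) = cnj a * hcoeff x (m, n)" for m n
  proof -
    have "hcoeff (Bw a x) (m, n) = 0" using B by simp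
    then show ?thesis by (simp add: Bw_def)
  qed
  have h0: "hcoeff x (0, n) = cnj a ^ n * hcoeff x (0, 0)" for n by (induction n) (simp_all add: w)
  have e: "hcoeff x (m, n) = cnj c ^ m * (cnj a ^ n * hcoeff x (0, 0))" for m n
  proof (induction m)
    case 0
    show ?case using h0[of n] by simp
  next
    case (Suc m)
    then show ?case by (simp add: z)
  qed
  have "x = hcoeff x (0, 0) *\<^sub>C szego c a"
  proof (rule hardy2_eqI)
    fix m n
    show "hcoeff x (m, n) = hcoeff (hcoeff x (0, 0) *\<^sub>C szego c a) (m, n)"
      using e[of m n] by (simp only: hcoeff_scaleC hcoeff_szego[OF c] mult_ac)
  qed
  then show "\<exists>\<alpha>. x = \<alpha> *\<^sub>C szego c a" by blast
qed (auto simp: A_linear szego_eigen[OF c])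

text \<open>Each \<open>Bw a\<close> maps the eigenspace onto itself with one-dimensional kernel, so
  each entry of the list adds one dimension, repeated entries included.\<close>

lemma has_cdim_fold_Bw:
  assumes c: "c \<in> unit_disk" and "set as \<subseteq> unit_disk"
  shows "has_cdim {x \<in> back_eigenspace c. fold Bw as x = 0} (length as)"
  using assms(2)
proof (induction as)
  case Nil
  have "{x \<in> back_eigenspace c. x = 0} = {0}" using csubspace_closed_ops(1)[OF csubspace_back_eigenspace] by auto
  then show ?case by (simp add: has_cdim_0_iff)
next
  case (Cons a as)
  have "has_cdim {x \<in> back_eigenspace c. Bw a x \<in> {x \<in> back_eigenspace c. fold Bw as x = 0}} (Suc (length as))"
  proof (rule has_cdim_preimage[OF csubspace_back_eigenspace])
    show "has_cdim {x \<in> back_eigenspace c. fold Bw as x = 0} (length as)" using Cons by auto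
    show "szego c a \<in> back_eigenspace c" "szego c a \<noteq> 0" using szego_eigen c Cons.prems by auto
    show "Bw a x = 0 \<longleftrightarrow> (\<exists>\<alpha>. x = \<alpha> *\<^sub>C szego c a)" if "x \<in> back_eigenspace c" for x
      using Bw_kernel[OF c _ that, of a] Cons.prems by auto
    show "\<exists>x\<in>back_eigenspace c. Bw a x = y" if "y \<in> {x \<in> back_eigenspace c. fold Bw as x = 0}" for y
      using Bw_surjective[of a y c] that Cons.prems by auto
  qed (simp_all add: A_linear)
  moreover have "{x \<in> back_eigenspace c. Bw a x \<in> {x \<in> back_eigenspace c. fold Bw as x = 0}} = {x \<in> back_eigenspace c. fold Bw (a # as) x = 0}"
    using back_eigenspace_Bw(1) by auto
  ultimately show ?case by simp
qed

text \<open>Modulo z - c, u is a function of w alone, and its zero at a can be divided out after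
  exchanging the variables.\<close>

lemma fiber_division_single:
  assumes c: "c \<in> unit_disk" "a \<in> unit_disk" and u: "heval u c a = 0"
  shows "\<exists>x y. u = Aw a x + Az c y"
proof -
  obtain k h where kh: "u = Az c k + h" "back_z h = 0"
    using difference_quotient[of c u] c by auto
  have "heval h c a = 0" using u by (simp add: kh(1) heval_linear[OF c] heval_Az[OF c])
  then have "heval (swap_zw h) a z = 0" for z
    using heval_indep_z[OF kh(2), of z a c] by (simp add: heval_swap)
  then obtain k' where "swap_zw h = Az a k'" using vanish_imp_Az[OF c(2), of "swap_zw h"] by blast
  then have "swap_zw h = swap_zw (Aw a (swap_zw k'))" by (simp add: swap_Aw)
  then have "h = Aw a (swap_zw k')" by (metis swap_swap)
  then show ?thesis using kh(1) by (metis add.commute)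
qed

lemma fiber_division:
  assumes c: "c \<in> unit_disk" and "set as \<subseteq> unit_disk" and s: "continuous_on unit_disk s"
    and "\<And>w. w \<in> unit_disk \<Longrightarrow> heval u c w = (\<Prod>a\<leftarrow>as. w - a) * s w"
  shows "\<exists>x y. u = foldr Aw as x + Az c y \<and> (\<forall>w\<in>unit_disk. heval x c w = s w)"
  using assms(2,4)
proof (induction as arbitrary: u)
  case Nil
  then show ?case by (intro exI[of _ u] exI[of _ 0]) (simp add: A_linear)
next
  case (Cons a as)
  have a: "a \<in> unit_disk" using Cons.prems by simp
  obtain u' y where u': "u = Aw a u' + Az c y"
    using fiber_division_single[OF c a, of u] Cons.prems(2)[OF a] by auto
  have "heval u' c w = (\<Prod>a\<leftarrow>as. w - a) * s w" if w: "w \<in> unit_disk" for w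
  proof (rule eq_off_finite[OF connected_disk(1) w connected_disk(2), where F = "{a}"
        and f = "heval u' c" and g = "\<lambda>w. (\<Prod>a\<leftarrow>as. w - a) * s w"])
    show "continuous_on unit_disk (heval u' c)"
      by (rule continuous_heval_comp) (use c in auto)
    have "continuous_on unit_disk (\<lambda>w. \<Prod>a\<leftarrow>as. w - a)" by (induction as) (auto intro!: continuous_intros)
    then show "continuous_on unit_disk (\<lambda>w. (\<Prod>a\<leftarrow>as. w - a) * s w)" using s by (intro continuous_intros)
    show "heval u' c y = (\<Prod>a\<leftarrow>as. y - a) * s y" if "y \<in> unit_disk - {a}" for y
      using Cons.prems(2)[of y] that c by (simp add: u' heval_linear heval_Az)
  qed simp
  then obtain x y' where xy: "u' = foldr Aw as x + Az c y'" "\<forall>w\<in>unit_disk. heval x c w = s w"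
    using Cons.IH[of u'] Cons.prems(1) by auto
  have "u = foldr Aw (a # as) x + Az c (Aw a y' + y)"
    by (simp add: u' xy(1) A_linear A_commute add.assoc)
  then show ?case using xy(2) by blast
qed

text \<open>The kernel for a # as contains \<open>szego c a\<close>, so f vanishes at (c, a) and w -
  a can be split off. The quotient is orthogonal to the kernel for the shorter list, because
  \<open>Bw a\<close> maps the kernel for a # as onto that one.\<close>

lemma orthogonal_fiber_division:
  assumes c: "c \<in> unit_disk" and "set as \<subseteq> unit_disk"
    and "\<And>v. v \<in> back_eigenspace c \<Longrightarrow> fold Bw as v = 0 \<Longrightarrow> cinner f v = 0"
  shows "\<exists>x y. f = foldr Aw as x + Az c y"
  using assms(2,3)
proof (induction as arbitrary: f)
  case Nil
  then show ?case by (intro exI[of _ f] exI[of _ 0]) (simp add: A_linear)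
next
  case (Cons a as)
  have a: "a \<in> unit_disk" using Cons.prems by simp
  have "cinner f (szego c a) = 0"
    by (rule Cons.prems(2)) (simp_all add: szego_eigen[OF c a] fold_Bw_zero)
  then obtain f' y where f': "f = Aw a f' + Az c y"
    using fiber_division_single[OF c a, of f] by (auto simp: heval_eq_cinner[OF c a])
  have "cinner f' v = 0" if v: "v \<in> back_eigenspace c" "fold Bw as v = 0" for v
  proof -
    obtain v' where v': "v' \<in> back_eigenspace c" "Bw a v' = v" using Bw_surjective[OF a v(1)] by blast
    have "cinner f v' = 0" using Cons.prems(2)[OF v'(1)] v' v(2) by simp
    then show ?thesis using v' by (simp add: f' cinner_add_left cinner_Az cinner_Aw back_eigenspace_def)
  qed
  then obtain x y' where xy: "f' = foldr Aw as x + Az c y'" using Cons.IH[of f'] Cons.prems(1) by auto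
  have "f = foldr Aw (a # as) x + Az c (Aw a y' + y)"
    by (simp add: f' xy A_linear A_commute add.assoc)
  then show ?case by blast
qed

text \<open>The lists hold, with multiplicity, zeros in the disk, the other zeros, and poles.
  Entries of \<open>bs\<close> and \<open>ds\<close> on the circle are allowed; poles are multiplied
  out so that f need only be known on the disk.\<close>

definition fiber_factorization :: "(complex \<Rightarrow> complex) \<Rightarrow> complex list \<Rightarrow> complex list \<Rightarrow> complex list \<Rightarrow> complex \<Rightarrow> bool" where
  "fiber_factorization f as bs ds \<kappa> \<longleftrightarrow> \<kappa> \<noteq> 0 \<and> set as \<subseteq> unit_disk \<and>
     (\<forall>b\<in>set bs. cmod b \<ge> 1) \<and> (\<forall>d\<in>set ds. cmod d \<ge> 1) \<and>
     (\<forall>w\<in>unit_disk. f w * (\<Prod>d\<leftarrow>ds. w - d) = \<kappa> * (\<Prod>a\<leftarrow>as. w - a) * (\<Prod>b\<leftarrow>bs. w - b))"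

lemma poly_linear_factors:
  fixes P :: "complex poly"
  assumes "P \<noteq> 0"
  shows "\<exists>rs \<kappa>. \<kappa> \<noteq> 0 \<and> (\<forall>w. poly P w = \<kappa> * (\<Prod>a\<leftarrow>rs. w - a)) \<and> (\<forall>a\<in>set rs. poly P a = 0)"
proof -
  obtain rs where rs: "mset rs = proots P" using ex_mset by blast
  have "poly (\<Prod>x\<in>#mset rs. [:-x, 1:]) w = (\<Prod>a\<leftarrow>rs. w - a)" for w
    by (induction rs) (simp_all add: algebra_simps)
  then have "poly P w = lead_coeff P * (\<Prod>a\<leftarrow>rs. w - a)" for w
    using complex_poly_decompose_multiset[of P] unfolding rs[symmetric] by (metis poly_smult)
  moreover have "poly P a = 0" if "a \<in> set rs" for a
  proof -
    have "a \<in># proots P" using that by (simp flip: rs)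
    then show ?thesis using assms by simp
  qed
  ultimately show ?thesis using assms by (intro exI[of _ rs] exI[of _ "lead_coeff P"]) auto
qed

lemma prod_list_filter_partition:
  fixes g :: "'a \<Rightarrow> 'b :: comm_monoid_mult"
  shows "(\<Prod>x\<leftarrow>xs. g x) = (\<Prod>x\<leftarrow>filter P xs. g x) * (\<Prod>x\<leftarrow>filter (\<lambda>x. \<not> P x) xs. g x)"
  by (induction xs) (simp_all add: mult_ac)

text \<open>In lowest terms the denominator has no zero in the disk, since f Q' = P' would make it a
  common zero. That the entries of \<open>bs\<close> are zeros of the given P later excludes zeros
  on the circle.\<close>

lemma fiber_factorization_exists:
  assumes f: "continuous_on unit_disk f" and Q: "Q \<noteq> 0"
    and PQ: "\<And>w. w \<in> unit_disk \<Longrightarrow> f w * poly Q w = poly P w"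
    and nz: "w0 \<in> unit_disk" "f w0 \<noteq> 0"
  shows "\<exists>as bs ds \<kappa>. fiber_factorization f as bs ds \<kappa> \<and> (\<forall>b\<in>set bs. poly P b = 0)"
proof -
  obtain g P' Q' where g: "g \<noteq> 0" "P = g * P'" "Q = g * Q'" and cop: "\<And>c. poly P' c = 0 \<Longrightarrow> poly Q' c \<noteq> 0"
    using reduced_fraction[OF Q, of P] by blast
  have PQ': "f w * poly Q' w = poly P' w" if w: "w \<in> unit_disk" for w
  proof (rule eq_off_finite[OF connected_disk(1) w connected_disk(2), where F = "{w. poly g w = 0}"
        and f = "\<lambda>w. f w * poly Q' w" and g = "poly P'"])
    show "f y * poly Q' y = poly P' y" if "y \<in> unit_disk - {w. poly g w = 0}" for y
      using PQ[of y] that by (simp add: g)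
  qed (use f poly_roots_finite[OF g(1)] in \<open>auto intro!: continuous_intros\<close>)
  have Q'0: "poly Q' w \<noteq> 0" if "w \<in> unit_disk" for w
    using PQ'[OF that] cop[of w] by auto
  have "P' \<noteq> 0" using PQ'[OF nz(1)] Q'0[OF nz(1)] nz(2) by auto
  then obtain rs \<kappa> where rs: "\<kappa> \<noteq> 0" "\<And>w. poly P' w = \<kappa> * (\<Prod>a\<leftarrow>rs. w - a)" "\<And>a. a \<in> set rs \<Longrightarrow> poly P' a = 0"
    using poly_linear_factors by meson
  have "Q' \<noteq> 0" using Q g by auto
  then obtain ds \<kappa>' where ds: "\<kappa>' \<noteq> 0" "\<And>w. poly Q' w = \<kappa>' * (\<Prod>a\<leftarrow>ds. w - a)" "\<And>a. a \<in> set ds \<Longrightarrow> poly Q' a = 0"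
    using poly_linear_factors by meson
  define as bs where "as = filter (\<lambda>a. a \<in> unit_disk) rs" and "bs = filter (\<lambda>a. a \<notin> unit_disk) rs"
  have "fiber_factorization f as bs ds (\<kappa> / \<kappa>')"
    unfolding fiber_factorization_def
  proof (intro conjI ballI)
    show "\<kappa> / \<kappa>' \<noteq> 0" using rs ds by simp
    show "set as \<subseteq> unit_disk" by (auto simp: as_def)
    show "cmod b \<ge> 1" if "b \<in> set bs" for b using that by (auto simp: bs_def)
    show "cmod d \<ge> 1" if "d \<in> set ds" for d using Q'0[of d] ds(3)[OF that] by force
    fix w assume w: "w \<in> unit_disk"
    have "(\<Prod>a\<leftarrow>rs. w - a) = (\<Prod>a\<leftarrow>as. w - a) * (\<Prod>b\<leftarrow>bs. w - b)"
      unfolding as_def bs_def by (rule prod_list_filter_partition)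
    then show "f w * (\<Prod>d\<leftarrow>ds. w - d) = \<kappa> / \<kappa>' * (\<Prod>a\<leftarrow>as. w - a) * (\<Prod>b\<leftarrow>bs. w - b)"
      using PQ'[OF w] ds(1) unfolding rs(2) ds(2) by (simp add: field_simps)
  qed
  moreover have "\<forall>b\<in>set bs. poly P b = 0" using rs(3) by (auto simp: bs_def g)
  ultimately show ?thesis by blast
qed

lemma prod_list_nonzero_disk:
  assumes "\<And>b. b \<in> set bs \<Longrightarrow> cmod b \<ge> 1" "w \<in> unit_disk"
  shows "(\<Prod>b\<leftarrow>bs. w - b) \<noteq> 0"
  using assms by (induction bs) force+

lemma holomorphic_prod_list: "(\<lambda>w. \<Prod>b\<leftarrow>bs. w - b) holomorphic_on S"
  by (induction bs) (auto intro!: holomorphic_intros)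

lemma fiber_factorization_quotient:
  assumes "fiber_factorization f as bs ds \<kappa>"
  shows "\<exists>s. s holomorphic_on unit_disk \<and> (\<forall>w\<in>unit_disk. s w \<noteq> 0 \<and> f w = (\<Prod>a\<leftarrow>as. w - a) * s w)"
proof -
  have F: "\<kappa> \<noteq> 0" "\<And>b. b \<in> set bs \<Longrightarrow> cmod b \<ge> 1" "\<And>d. d \<in> set ds \<Longrightarrow> cmod d \<ge> 1"
    "\<And>w. w \<in> unit_disk \<Longrightarrow> f w * (\<Prod>d\<leftarrow>ds. w - d) = \<kappa> * (\<Prod>a\<leftarrow>as. w - a) * (\<Prod>b\<leftarrow>bs. w - b)"
    using assms by (auto simp: fiber_factorization_def)
  define s where "s w = \<kappa> * (\<Prod>b\<leftarrow>bs. w - b) / (\<Prod>d\<leftarrow>ds. w - d)" for w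
  have "s holomorphic_on unit_disk"
    unfolding s_def by (intro holomorphic_intros holomorphic_prod_list) (use prod_list_nonzero_disk[OF F(3)] in auto)
  moreover have "s w \<noteq> 0" "f w = (\<Prod>a\<leftarrow>as. w - a) * s w" if "w \<in> unit_disk" for w
    using F(1) F(4)[OF that] prod_list_nonzero_disk[OF F(2) that] prod_list_nonzero_disk[OF F(3) that]
    by (auto simp: s_def field_simps)
  ultimately show ?thesis by blast
qed

lemma prod_list_diff_count:
  fixes w a :: complex
  shows "(\<Prod>b\<leftarrow>as. w - b) = (\<Prod>b\<leftarrow>filter (\<lambda>b. b \<noteq> a) as. w - b) * (w - a) ^ count_list as a"
  by (induction as) (auto simp: mult_ac)

text \<open>All factors other than w - a are nonzero at a, so the multiplicity of a in the list is
  the order of the zero.\<close>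

lemma zero_count_of_factorization:
  assumes "fiber_factorization f as bs ds \<kappa>"
  shows "has_zero_count f unit_disk (length as)"
proof -
  obtain s where s: "s holomorphic_on unit_disk" "\<And>w. w \<in> unit_disk \<Longrightarrow> s w \<noteq> 0"
    "\<And>w. w \<in> unit_disk \<Longrightarrow> f w = (\<Prod>a\<leftarrow>as. w - a) * s w"
    using fiber_factorization_quotient[OF assms] by blast
  have as: "set as \<subseteq> unit_disk" using assms by (simp add: fiber_factorization_def)
  have zeros: "{w \<in> unit_disk. f w = 0} = set as"
    using as s(2,3) by (fastforce simp: prod_list_zero_iff)
  have "zorder f a = int (count_list as a)" if "a \<in> set as" for a
  proof (rule zorder_eqI[where S = unit_disk and g = "\<lambda>w. (\<Prod>b\<leftarrow>filter (\<lambda>b. b \<noteq> a) as. w - b) * s w"])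
    show "a \<in> unit_disk" using that as by blast
    then show "(\<Prod>b\<leftarrow>filter (\<lambda>b. b \<noteq> a) as. a - b) * s a \<noteq> 0"
      using s(2) by (auto simp: prod_list_zero_iff)
    show "f w = (\<Prod>b\<leftarrow>filter (\<lambda>b. b \<noteq> a) as. w - b) * s w * (w - a) powi int (count_list as a)"
      if "w \<in> unit_disk" for w
      unfolding s(3)[OF that] prod_list_diff_count[of w as a] by (simp add: power_int_of_nat)
  qed (auto intro!: holomorphic_intros holomorphic_prod_list s(1))
  then have "(\<Sum>w | w \<in> unit_disk \<and> f w = 0. nat (zorder f w)) = (\<Sum>w\<in>set as. count_list as w)"
    using zeros by (intro sum.cong) auto
  also have "\<dots> = length as" by (rule sum_count_set) auto
  finally show ?thesis using zeros by (simp add: has_zero_count_def)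
qed

text \<open>Setting z = c may annihilate q. Then it annihilates p as well, z - c divides both, and
  cancelling it lowers the degree in z of the leading coefficient of q.\<close>

lemma fiber_fraction:
  assumes "q \<noteq> 0" and "\<And>z w. z \<in> unit_disk \<Longrightarrow> w \<in> unit_disk \<Longrightarrow> heval \<theta> z w * poly2 q z w = poly2 p z w"
    and c: "c \<in> unit_disk"
  shows "\<exists>P Q. Q \<noteq> 0 \<and> (\<forall>w\<in>unit_disk. heval \<theta> c w * poly Q w = poly P w)"
  using assms(1,2)
proof (induction "degree (lead_coeff q)" arbitrary: p q rule: less_induct)
  case less
  let ?e = "\<lambda>p. map_poly (\<lambda>a. poly a c) p"
  have ev: "poly (?e p) w = poly2 p c w" for p w by (simp add: poly2_map_poly)
  show ?case
  proof (cases "?e q = 0")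
    case False
    then show ?thesis using less.prems(2)[OF c] by (intro exI[of _ "?e p"] exI[of _ "?e q"]) (simp add: ev)
  next
    case True
    have "poly (?e p) w = 0" if "w \<in> unit_disk" for w
      using less.prems(2)[OF c that] True by (simp flip: ev)
    moreover have "infinite unit_disk"
      using connected_finite_iff_sing[OF connected_disk(1)] connected_disk(2) by (metis centre_in_ball empty_iff zero_less_one)
    ultimately have p0: "?e p = 0"
      using poly_roots_finite[of "?e p"] by (metis (mono_tags, lifting) finite_subset mem_Collect_eq subsetI)
    have red: "r = smult [:-c, 1:] (map_poly (\<lambda>a. a div [:-c, 1:]) r)" if "?e r = 0" for r
    proof (rule poly_eqI)
      fix i
      have "coeff (?e r) i = 0" using that by simp
      then have "[:-c, 1:] dvd coeff r i" by (simp add: coeff_map_poly poly_eq_0_iff_dvd)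
      then show "coeff r i = coeff (smult [:-c, 1:] (map_poly (\<lambda>a. a div [:-c, 1:]) r)) i"
        by (simp add: coeff_map_poly del: mult_pCons_left)
    qed
    define p1 q1 where "p1 = map_poly (\<lambda>a. a div [:-c, 1:]) p" and "q1 = map_poly (\<lambda>a. a div [:-c, 1:]) q"
    have p: "p = smult [:-c, 1:] p1" and q: "q = smult [:-c, 1:] q1"
      unfolding p1_def q1_def by (rule red[OF p0] red[OF True])+
    have q1: "q1 \<noteq> 0" using q less.prems(1) by auto
    have pe: "poly2 p z w = (z - c) * poly2 p1 z w" and qe: "poly2 q z w = (z - c) * poly2 q1 z w" for z w
      unfolding p q by (simp_all add: poly2_def left_diff_distrib)
    have lc: "lead_coeff q = [:-c, 1:] * lead_coeff q1"
      unfolding q by (rule lead_coeff_smult)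
    have "degree (lead_coeff q1) < degree (lead_coeff q)"
      unfolding lc using q1 by (subst degree_mult_eq) auto
    moreover have "heval \<theta> z w * poly2 q1 z w = poly2 p1 z w" if z: "z \<in> unit_disk" and w: "w \<in> unit_disk" for z w
    proof (rule eq_off_finite[OF connected_disk(1) z connected_disk(2), where F = "{c}"
          and f = "\<lambda>z. heval \<theta> z w * poly2 q1 z w" and g = "\<lambda>z. poly2 p1 z w"])
      show "heval \<theta> y w * poly2 q1 y w = poly2 p1 y w" if "y \<in> unit_disk - {c}" for y
        using less.prems(2)[of y w] that w by (auto simp: pe qe)
    qed (use w in \<open>auto intro!: continuous_intros continuous_heval_comp\<close>)
    ultimately show ?thesis using less.hyps q1 by blast
  qed
qed

context rational_rep
begin

section \<open>Eigenvectors in the model space, fiber by fiber\<close>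

lemma mem_model_space: "x \<in> model_space \<theta> \<longleftrightarrow> (\<forall>g. cinner (theta_mult g) x = 0)"
proof -
  have "cinner (theta_mult g) x = 0 \<longleftrightarrow> cinner x (theta_mult g) = 0" for g
    by (metis cinner_commute complex_cnj_zero)
  then show ?thesis by (auto simp: model_space_def orthogonal_complement_def mult_range_eq)
qed

text \<open>Orthogonality to \<theta> g concerns only the fiber, where \<theta> is the product over
  \<open>as\<close> times a zero-free function. The factors w - b may be dropped since
  \<open>Bw b\<close> is injective for |b| \<ge> 1; conversely \<theta> g is divisible by the
  product over \<open>as\<close> modulo z - c.\<close>

lemma kernel_eq:
  assumes c: "c \<in> unit_disk" and F: "fiber_factorization (heval \<theta> c) as bs ds \<kappa>"
  shows "{x \<in> model_space \<theta>. Bz c x = 0} = {x \<in> back_eigenspace c. fold Bw as x = 0}"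
proof -
  have F': "\<kappa> \<noteq> 0" "set as \<subseteq> unit_disk" "\<And>b. b \<in> set bs \<Longrightarrow> cmod b \<ge> 1"
    "\<And>w. w \<in> unit_disk \<Longrightarrow> heval \<theta> c w * (\<Prod>d\<leftarrow>ds. w - d) = \<kappa> * (\<Prod>a\<leftarrow>as. w - a) * (\<Prod>b\<leftarrow>bs. w - b)"
    using F by (auto simp: fiber_factorization_def)
  have "fold Bw as x = 0" if x: "x \<in> model_space \<theta>" "x \<in> back_eigenspace c" for x
  proof -
    have "cinner g (fold Bw (as @ bs) x) = 0" for g
    proof -
      have "\<kappa> * cinner g (fold Bw (as @ bs) x) = cinner (\<kappa> *\<^sub>C foldr Aw (as @ bs) g) x"
        by (simp only: cinner_scaleC_left cinner_foldr_Aw)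
      \<comment> \<open>Multiplying the test function by the factors w - d clears the poles of the
        fiber.\<close>
      also have "\<dots> = cinner (theta_mult (foldr Aw ds g)) x"
      proof (rule cinner_back_eigenspace_cong[OF c x(2)])
        fix w assume w: "w \<in> unit_disk"
        show "heval (\<kappa> *\<^sub>C foldr Aw (as @ bs) g) c w = heval (theta_mult (foldr Aw ds g)) c w"
          unfolding heval_linear(3)[OF c w] heval_foldr_Aw[OF c w] heval_theta_mult[OF c w]
          using F'(4)[OF w] by (simp add: mult.assoc[symmetric])
      qed
      also have "\<dots> = 0" using x(1) by (simp add: mem_model_space)
      finally show ?thesis using F'(1) by simp
    qed
    from this[of "fold Bw (as @ bs) x"] have "fold Bw bs (fold Bw as x) = 0" by (simp add: cinner_self)
    then show ?thesis using fold_Bw_injective F'(3) by blast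
  qed
  moreover have "x \<in> model_space \<theta>" if x: "x \<in> back_eigenspace c" "fold Bw as x = 0" for x
    unfolding mem_model_space
  proof
    fix g
    obtain s where s: "s holomorphic_on unit_disk" "\<And>w. w \<in> unit_disk \<Longrightarrow> heval \<theta> c w = (\<Prod>a\<leftarrow>as. w - a) * s w"
      using fiber_factorization_quotient[OF F] by blast
    have "continuous_on unit_disk (\<lambda>w. s w * heval g c w)"
      by (intro continuous_intros continuous_heval_comp holomorphic_on_imp_continuous_on s(1)) (use c in auto)
    then obtain k y where "theta_mult g = foldr Aw as k + Az c y"
      using fiber_division[OF c F'(2), of "\<lambda>w. s w * heval g c w" "theta_mult g"] s(2) c
      by (auto simp: heval_theta_mult mult.assoc)
    then show "cinner (theta_mult g) x = 0" using x by (simp add: cinner_add_left cinner_foldr_Aw cinner_Az back_eigenspace_def)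
  qed
  ultimately show ?thesis by (auto simp: back_eigenspace_def)
qed

lemma fiber_factorization_of_nonzero:
  assumes c: "c \<in> unit_disk" and nz: "w0 \<in> unit_disk" "heval \<theta> c w0 \<noteq> 0"
  shows "\<exists>as bs ds \<kappa>. fiber_factorization (heval \<theta> c) as bs ds \<kappa>"
proof -
  obtain P Q where "Q \<noteq> 0" "\<And>w. w \<in> unit_disk \<Longrightarrow> heval \<theta> c w * poly Q w = poly P w"
    using fiber_fraction[OF q_nz rep c] by blast
  moreover have "continuous_on unit_disk (heval \<theta> c)"
    by (rule continuous_heval_comp) (use c in auto)
  ultimately show ?thesis using fiber_factorization_exists nz by meson
qed

end

section \<open>Semi-Fredholm perturbation\<close>

text \<open>The adjoint is a parameter so that \<open>back_z\<close> can take its place, which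
  agrees with \<open>adjoint_on\<close> on K only.\<close>

locale hilbert_operator =
  fixes K :: "'a :: {complex_inner, banach} set" and S S' :: "'a \<Rightarrow> 'a"
  assumes csubspace: "csubspace K" and closed: "closed K"
    and bounded_S: "bounded_op_on K S" and bounded_S': "bounded_op_on K S'"
    and adjoint: "x \<in> K \<Longrightarrow> y \<in> K \<Longrightarrow> cinner (S x) y = cinner x (S' y)"
begin

abbreviation T :: "complex \<Rightarrow> 'a \<Rightarrow> 'a" where "T \<equiv> shifted_op S"
text \<open>The conjugation is built in, so that T' c is adjoint to T c and kernels are indexed by
  points of \<Omega> rather than of its conjugate.\<close>

abbreviation T' :: "complex \<Rightarrow> 'a \<Rightarrow> 'a" where "T' c \<equiv> shifted_op S' (cnj c)"
abbreviation N :: "complex \<Rightarrow> 'a set" where "N c \<equiv> kernel_on K (T' c)"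

lemma bounded_shifted:
  assumes "bounded_op_on K R"
  shows "bounded_op_on K (shifted_op R c)"
proof -
  obtain B where B: "B > 0" "\<And>x. x \<in> K \<Longrightarrow> norm (R x) \<le> B * norm x"
    using bounded_op_on_bound[OF assms] by blast
  have "norm (shifted_op R c x) \<le> (B + cmod c) * norm x" if "x \<in> K" for x
    using B(2)[OF that] norm_triangle_ineq4[of "R x" "c *\<^sub>C x"]
    by (simp add: shifted_op_def norm_scaleC distrib_right)
  then show ?thesis
    unfolding bounded_op_on_def
  proof (intro conjI)
    show "\<forall>x\<in>K. shifted_op R c x \<in> K" "\<forall>x\<in>K. \<forall>y\<in>K. shifted_op R c (x + y) = shifted_op R c x + shifted_op R c y"
      "\<forall>a. \<forall>x\<in>K. shifted_op R c (a *\<^sub>C x) = a *\<^sub>C shifted_op R c x"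
      unfolding shifted_op_def
      using bounded_op_onD[OF assms] csubspace_closed_ops[OF csubspace]
      by (auto simp: complex_vector.scale_right_diff_distrib scaleC_add_right scaleC_scaleC mult.commute)
  qed blast
qed

lemmas bounded_T = bounded_shifted[OF bounded_S] and bounded_T' = bounded_shifted[OF bounded_S']

lemma adjoint_T: "x \<in> K \<Longrightarrow> y \<in> K \<Longrightarrow> cinner (T c x) y = cinner x (T' c y)"
  by (simp add: shifted_op_def cinner_simps adjoint)

lemma csubspace_N: "csubspace (N c)"
proof (rule csubspaceI)
  have "T' c (0 - 0) = T' c 0 - T' c 0"
    by (rule bounded_op_on_diff[OF csubspace bounded_T']) (auto intro: csubspace_closed_ops csubspace)
  then show "0 \<in> N c" by (simp add: kernel_on_def csubspace_closed_ops csubspace)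
qed (auto simp: kernel_on_def csubspace_closed_ops csubspace bounded_op_onD[OF bounded_T'])

lemma orthogonal_kernel_mem_range:
  assumes c: "c > 0" "\<And>x. x \<in> K \<Longrightarrow> c * norm x \<le> norm (T \<nu> x)"
    and x: "x \<in> K" "\<And>y. y \<in> N \<nu> \<Longrightarrow> cinner x y = 0"
  shows "x \<in> T \<nu> ` K"
  by (rule mem_range_of_orthogonal_kernel[OF csubspace closed bounded_T _ _ _ x(1), of "T' \<nu>"])
    (use bounded_op_onD(1)[OF bounded_T'] adjoint_T x(2) closed_range_of_bounded_below[OF csubspace closed bounded_T c]
     in \<open>auto simp: kernel_on_def\<close>)

text \<open>A lower bound makes the range closed, so it is all of K once the adjoint has trivial
  kernel; the inverse has norm at most 1 / c.\<close>

lemma invertible_of_trivial_kernel: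
  assumes c: "c > 0" "\<And>x. x \<in> K \<Longrightarrow> c * norm x \<le> norm (T \<nu> x)" and N: "N \<nu> = {0}"
  shows "invertible_on K (T \<nu>)"
proof -
  have surj: "\<exists>x\<in>K. T \<nu> x = y" if "y \<in> K" for y
    using orthogonal_kernel_mem_range[OF c that] N by auto
  have inj: "x = y" if "x \<in> K" "y \<in> K" "T \<nu> x = T \<nu> y" for x y
  proof -
    have "c * norm (x - y) \<le> 0"
      using c(2)[OF csubspace_closed_ops(3)[OF csubspace that(1,2)]] that(3)
      by (simp add: bounded_op_on_diff[OF csubspace bounded_T that(1,2)])
    then have "norm (x - y) \<le> 0" using c(1) by (simp add: mult_le_0_iff)
    then show ?thesis by simp
  qed
  define R where "R y = (THE x. x \<in> K \<and> T \<nu> x = y)" for y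
  have R: "R y \<in> K" "T \<nu> (R y) = y" if "y \<in> K" for y
    using theI'[of "\<lambda>x. x \<in> K \<and> T \<nu> x = y"] surj[OF that] inj unfolding R_def by metis+
  have "bounded_op_on K R"
    unfolding bounded_op_on_def
  proof (intro conjI ballI allI exI[of _ "1 / c"])
    fix x y a assume x: "x \<in> K"
    show "R x \<in> K" by (rule R(1)[OF x])
    show "R (x + y) = R x + R y" if y: "y \<in> K"
    proof (rule inj)
      have xy: "x + y \<in> K" by (rule csubspace_closed_ops(2)[OF csubspace x y])
      show "R (x + y) \<in> K" by (rule R(1)[OF xy])
      show "R x + R y \<in> K" by (rule csubspace_closed_ops(2)[OF csubspace R(1)[OF x] R(1)[OF y]])
      show "T \<nu> (R (x + y)) = T \<nu> (R x + R y)"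
        unfolding bounded_op_onD(2)[OF bounded_T R(1)[OF x] R(1)[OF y]] R(2)[OF x] R(2)[OF y] by (rule R(2)[OF xy])
    qed
    show "R (a *\<^sub>C x) = a *\<^sub>C R x"
    proof (rule inj)
      have ax: "a *\<^sub>C x \<in> K" by (rule csubspace_closed_ops(4)[OF csubspace x])
      show "R (a *\<^sub>C x) \<in> K" by (rule R(1)[OF ax])
      show "a *\<^sub>C R x \<in> K" by (rule csubspace_closed_ops(4)[OF csubspace R(1)[OF x]])
      show "T \<nu> (R (a *\<^sub>C x)) = T \<nu> (a *\<^sub>C R x)"
        unfolding bounded_op_onD(3)[OF bounded_T R(1)[OF x]] R(2)[OF x] by (rule R(2)[OF ax])
    qed
    show "norm (R x) \<le> 1 / c * norm x" using c(2)[OF R(1)[OF x]] R(2)[OF x] c(1) by (simp add: field_simps)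
  qed
  moreover have "R (T \<nu> x) = x" if "x \<in> K" for x
  proof (rule inj[OF _ that])
    have Tx: "T \<nu> x \<in> K" by (rule bounded_op_onD(1)[OF bounded_T that])
    show "R (T \<nu> x) \<in> K" by (rule R(1)[OF Tx])
    show "T \<nu> (R (T \<nu> x)) = T \<nu> x" by (rule R(2)[OF Tx])
  qed
  ultimately show ?thesis using R(2) by (auto simp: invertible_on_def)
qed

lemma kernel_of_invertible:
  assumes "invertible_on K (T \<nu>)"
  shows "N \<nu> = {0}"
proof -
  obtain R where R: "bounded_op_on K R" "\<And>x. x \<in> K \<Longrightarrow> T \<nu> (R x) = x"
    using assms by (auto simp: invertible_on_def)
  have "x = 0" if "x \<in> N \<nu>" for x
  proof -
    have x: "x \<in> K" "T' \<nu> x = 0" using that by (auto simp: kernel_on_def)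
    have "cinner x x = cinner (T \<nu> (R x)) x" using R(2)[OF x(1)] by simp
    also have "\<dots> = 0" using adjoint_T[OF bounded_op_onD(1)[OF R(1) x(1)] x(1)] x(2) by simp
    finally show ?thesis by (simp add: cinner_self)
  qed
  then show ?thesis using csubspace_closed_ops(1)[OF csubspace_N] by blast
qed

lemma bounded_below_near:
  assumes "\<And>x. x \<in> K \<Longrightarrow> c * norm x \<le> norm (T \<nu> x)" "x \<in> K"
  shows "(c - cmod (\<mu> - \<nu>)) * norm x \<le> norm (T \<mu> x)"
proof -
  have "T \<nu> x = T \<mu> x + (\<mu> - \<nu>) *\<^sub>C x"
    by (simp add: shifted_op_def complex_vector.scale_left_diff_distrib)
  then have "norm (T \<nu> x) \<le> norm (T \<mu> x) + cmod (\<mu> - \<nu>) * norm x"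
    using norm_triangle_ineq[of "T \<mu> x" "(\<mu> - \<nu>) *\<^sub>C x"] by (simp add: norm_scaleC)
  then show ?thesis using assms by (fastforce simp: left_diff_distrib)
qed

text \<open>An element of \<open>N \<mu>\<close> orthogonal to \<open>N \<nu>\<close> has the form \<open>T \<nu> y\<close> and is orthogonal to
  \<open>T \<mu> y\<close>, which is close to it.\<close>

lemma kernel_transversal:
  assumes c: "c > 0" "\<And>x. x \<in> K \<Longrightarrow> c * norm x \<le> norm (T \<nu> x)" and \<mu>: "cmod (\<mu> - \<nu>) < c"
    and x: "x \<in> N \<mu>" "\<And>y. y \<in> N \<nu> \<Longrightarrow> cinner x y = 0"
  shows "x = 0"
proof -
  have xK: "x \<in> K" "T' \<mu> x = 0" using x(1) by (auto simp: kernel_on_def)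
  obtain y where y: "y \<in> K" "x = T \<nu> y"
    using orthogonal_kernel_mem_range[OF c xK(1) x(2)] by blast
  have "T \<mu> y = x - (\<mu> - \<nu>) *\<^sub>C y"
    by (simp add: y(2) shifted_op_def complex_vector.scale_left_diff_distrib)
  moreover have "cinner (T \<mu> y) x = 0" using adjoint_T[OF y(1) xK(1)] xK(2) by simp
  ultimately have "cinner x x = (\<mu> - \<nu>) * cinner y x" by (simp add: cinner_simps)
  then have "(norm x)\<^sup>2 = cmod ((\<mu> - \<nu>) * cinner y x)" by (metis cinner_self norm_of_real abs_of_nonneg zero_le_power2)
  also have "\<dots> \<le> cmod (\<mu> - \<nu>) * (norm y * norm x)"
    unfolding norm_mult by (intro mult_left_mono norm_cinner_le) auto
  finally have *: "norm x * norm x \<le> (cmod (\<mu> - \<nu>) * norm y) * norm x" by (simp add: power2_eq_square mult.assoc)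
  show ?thesis
  proof (rule ccontr)
    assume "x \<noteq> 0"
    then have "norm x \<le> cmod (\<mu> - \<nu>) * norm y" using * by simp
    then have "c * norm y \<le> cmod (\<mu> - \<nu>) * norm y" using c(2)[OF y(1)] y(2) by simp
    then have "norm y \<le> 0" using \<mu> by (meson mult_less_cancel_right_pos not_le)
    then have "y = 0" by simp
    then show False using \<open>norm x \<le> cmod (\<mu> - \<nu>) * norm y\<close> \<open>x \<noteq> 0\<close> by simp
  qed
qed

text \<open>The finite-dimensional space N \<nu> complements the closed range.\<close>

lemma fredholm_of_bounded_below:
  assumes c: "c > 0" "\<And>x. x \<in> K \<Longrightarrow> c * norm x \<le> norm (T \<nu> x)" and N: "has_cdim (N \<nu>) n"
  shows "fredholm_on K (T \<nu>)"
  unfolding fredholm_on_def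
proof (intro conjI)
  show cl: "Topological_Spaces.closed (T \<nu> ` K)"
    by (rule closed_range_of_bounded_below[OF csubspace closed bounded_T c])
  show "\<exists>B. finite B \<and> kernel_on K (T \<nu>) \<subseteq> cspan B"
  proof (intro exI[of _ "{}"] conjI subsetI)
    fix x assume "x \<in> kernel_on K (T \<nu>)"
    then have "c * norm x \<le> 0" using c(2)[of x] by (simp add: kernel_on_def)
    then show "x \<in> cspan {}" using c(1) by (simp add: mult_le_0_iff)
  qed simp
  obtain B where B: "finite B" "cspan B = N \<nu>" using N by (auto simp: has_cdim_def)
  have BK: "B \<subseteq> K" using complex_vector.span_superset[of B] B(2) by (auto simp: kernel_on_def)
  have "K = {x + y |x y. x \<in> T \<nu> ` K \<and> y \<in> cspan B}"
  proof
    show "{x + y |x y. x \<in> T \<nu> ` K \<and> y \<in> cspan B} \<subseteq> K"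
      unfolding B(2) using bounded_op_onD(1)[OF bounded_T] csubspace_closed_ops(2)[OF csubspace] by (auto simp: kernel_on_def)
    show "K \<subseteq> {x + y |x y. x \<in> T \<nu> ` K \<and> y \<in> cspan B}"
    proof
      fix x assume x: "x \<in> K"
      have Ncl: "Topological_Spaces.closed (N \<nu>)"
      proof (unfold closed_sequential_limits, safe)
        fix X l assume X: "\<forall>n. X n \<in> N \<nu>" "X \<longlonglongrightarrow> l"
        have XK: "X n \<in> K" "T' \<nu> (X n) = 0" for n using X(1) by (auto simp: kernel_on_def)
        have l: "l \<in> K" using closed_sequentially[OF closed XK(1) X(2)] .
        have "(\<lambda>n. T' \<nu> (X n)) \<longlonglongrightarrow> T' \<nu> l" by (rule bounded_op_on_tendsto[OF csubspace bounded_T' XK(1) l X(2)])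
        then show "l \<in> N \<nu>" using l XK(2) by (simp add: kernel_on_def LIMSEQ_const_iff)
      qed
      obtain y where y: "y \<in> N \<nu>" "x - y \<in> orthogonal_complement (N \<nu>)"
        using projection_exists[OF csubspace_N Ncl] by blast
      have "y \<in> K" using y(1) by (simp add: kernel_on_def)
      then have "x - y \<in> T \<nu> ` K"
        using y(2) by (intro orthogonal_kernel_mem_range[OF c] csubspace_closed_ops(3)[OF csubspace] x)
          (auto simp: orthogonal_complement_def)
      then show "x \<in> {x + y |x y. x \<in> T \<nu> ` K \<and> y \<in> cspan B}"
        unfolding B(2) mem_Collect_eq using y(1)
        by (intro exI[of _ "x - y"] exI[of _ y] conjI) (rule diff_add_cancel[symmetric])
    qed
  qed
  then show "\<exists>B. finite B \<and> B \<subseteq> K \<and> K = {x + y |x y. x \<in> T \<nu> ` K \<and> y \<in> cspan B}"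
    using B(1) BK by blast
qed

lemma bounded_below_of_fredholm:
  assumes "fredholm_on K (T \<nu>)" "\<And>x. x \<in> K \<Longrightarrow> T \<nu> x = 0 \<Longrightarrow> x = 0"
  shows "\<exists>c>0. \<forall>x\<in>K. c * norm x \<le> norm (T \<nu> x)"
  using assms by (intro bounded_below_of_closed_range[OF csubspace closed bounded_T]) (auto simp: fredholm_on_def)

abbreviation \<Omega> :: "complex set" where "\<Omega> \<equiv> spectrum_on K S - essential_spectrum_on K S"

lemma \<Omega>_iff: "\<nu> \<in> \<Omega> \<longleftrightarrow> \<not> invertible_on K (T \<nu>) \<and> fredholm_on K (T \<nu>)"
  by (auto simp: spectrum_on_def essential_spectrum_on_def)

text \<open>Injectivity turns the Fredholm property into a lower bound, which persists nearby and
  makes the adjoint onto. Neighbouring kernels of the adjoint then have equal dimension, and it is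
  positive because T \<nu> is not invertible.\<close>

lemma \<Omega>_locally_constant:
  assumes D: "open D" "\<And>\<mu>. \<mu> \<in> D \<Longrightarrow> has_cdim (N \<mu>) (n \<mu>)" and inj: "\<And>x. x \<in> K \<Longrightarrow> T \<nu> x = 0 \<Longrightarrow> x = 0"
    and \<nu>: "\<nu> \<in> \<Omega>" "\<nu> \<in> D"
  shows "n \<nu> > 0" "T' \<nu> ` K = K" "\<exists>e>0. \<forall>\<mu>\<in>ball \<nu> e. \<mu> \<in> \<Omega> \<and> n \<mu> = n \<nu>"
proof -
  obtain c where c: "c > 0" "\<And>x. x \<in> K \<Longrightarrow> c * norm x \<le> norm (T \<nu> x)"
    using bounded_below_of_fredholm inj \<nu>(1) unfolding \<Omega>_iff by metis
  show n0: "n \<nu> > 0"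
  proof (rule ccontr)
    assume "\<not> n \<nu> > 0"
    then have "N \<nu> = {0}" using D(2)[OF \<nu>(2)] by (simp add: has_cdim_0_iff)
    then show False using invertible_of_trivial_kernel[OF c] \<nu>(1) unfolding \<Omega>_iff by blast
  qed
  show "T' \<nu> ` K = K"
    using bounded_op_onD(1)[OF bounded_T'] adjoint_surjective[OF csubspace closed bounded_T bounded_T' adjoint_T c] by blast
  obtain e0 where e0: "e0 > 0" "ball \<nu> e0 \<subseteq> D" using D(1) \<nu>(2) openE by blast
  \<comment> \<open>Within distance c / 2 the lower bound c' left at \<mu> still exceeds the
    distance to \<nu>, so transversality of the kernels holds in both directions.\<close>
  have "\<mu> \<in> \<Omega> \<and> n \<mu> = n \<nu>" if \<mu>: "\<mu> \<in> ball \<nu> (min e0 (c / 2))" for \<mu>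
  proof -
    have d: "cmod (\<mu> - \<nu>) < c / 2" and \<mu>D: "\<mu> \<in> D" using \<mu> e0 by (auto simp: dist_norm norm_minus_commute)
    define c' where "c' = c - cmod (\<mu> - \<nu>)"
    have c': "c' > 0" "\<And>x. x \<in> K \<Longrightarrow> c' * norm x \<le> norm (T \<mu> x)"
      using d c(1) bounded_below_near[OF c(2)] by (auto simp: c'_def)
    have "n \<mu> \<le> n \<nu>"
      by (rule has_cdim_mono[OF D(2)[OF \<mu>D] D(2)[OF \<nu>(2)]])
        (use kernel_transversal[OF c, of \<mu>] d c(1) in auto)
    moreover have "n \<nu> \<le> n \<mu>"
      by (rule has_cdim_mono[OF D(2)[OF \<nu>(2)] D(2)[OF \<mu>D]])
        (use kernel_transversal[OF c', of \<nu>] d in \<open>auto simp: c'_def norm_minus_commute\<close>)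
    ultimately have eq: "n \<mu> = n \<nu>" by simp
    have "N \<mu> \<noteq> {0}" using D(2)[OF \<mu>D] n0 eq has_cdim_cdim has_cdim_0_iff by (metis less_irrefl)
    then have "\<not> invertible_on K (T \<mu>)" using kernel_of_invertible by blast
    then show ?thesis using fredholm_of_bounded_below[OF c' D(2)[OF \<mu>D]] eq unfolding \<Omega>_iff by blast
  qed
  moreover have "min e0 (c / 2) > 0" using e0(1) c(1) by simp
  ultimately show "\<exists>e>0. \<forall>\<mu>\<in>ball \<nu> e. \<mu> \<in> \<Omega> \<and> n \<mu> = n \<nu>" by blast
qed

end

section \<open>The compressed shift\<close>

context rational_rep
begin

abbreviation "K \<equiv> model_space \<theta>"

lemma csubspace_K: "csubspace K" and closed_K: "closed K"
  by (simp_all add: model_space_def csubspace_orthogonal_complement closed_orthogonal_complement)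

lemma K_theta_mult: "x \<in> K \<Longrightarrow> cinner x (theta_mult g) = 0"
  by (auto simp: model_space_def orthogonal_complement_def mult_range_eq)

lemma back_z_K: "x \<in> K \<Longrightarrow> back_z x \<in> K"
  by (simp add: mem_model_space flip: cinner_mult_z theta_mult_linear)

lemma compressed_shift_K: "compressed_shift \<theta> x \<in> K"
  unfolding compressed_shift_def by (rule orthogonal_projection_props[OF csubspace_K closed_K])

lemma compressed_shift_decomp: "\<exists>g. mult_z x = compressed_shift \<theta> x + theta_mult g"
proof -
  have "mult_z x - compressed_shift \<theta> x \<in> orthogonal_complement (orthogonal_complement (mult_range \<theta>))"
    unfolding compressed_shift_def model_space_def[symmetric]
    by (rule orthogonal_projection_props[OF csubspace_K closed_K])
  then have "mult_z x - compressed_shift \<theta> x \<in> mult_range \<theta>"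
    by (rule double_orthogonal_complement[OF csubspace_mult_range closed_mult_range])
  then obtain g where "mult_z x - compressed_shift \<theta> x = theta_mult g" by (auto simp: mult_range_eq)
  then show ?thesis by (metis add.commute diff_add_cancel)
qed

lemma compressed_shift_eqI: "y \<in> K \<Longrightarrow> mult_z x = y + theta_mult g \<Longrightarrow> compressed_shift \<theta> x = y"
  unfolding compressed_shift_def
  by (rule orthogonal_projection_unique[OF csubspace_K closed_K])
    (auto simp: orthogonal_complement_def mem_model_space)

lemma compressed_shift_linear:
  "compressed_shift \<theta> (x + y) = compressed_shift \<theta> x + compressed_shift \<theta> y"
  "compressed_shift \<theta> (a *\<^sub>C x) = a *\<^sub>C compressed_shift \<theta> x"
proof -
  obtain g h where g: "mult_z x = compressed_shift \<theta> x + theta_mult g" and h: "mult_z y = compressed_shift \<theta> y + theta_mult h"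
    using compressed_shift_decomp by metis
  show "compressed_shift \<theta> (x + y) = compressed_shift \<theta> x + compressed_shift \<theta> y"
    by (rule compressed_shift_eqI[where g = "g + h"])
      (auto simp: shift_linear g h theta_mult_linear intro!: csubspace_closed_ops csubspace_K compressed_shift_K)
  show "compressed_shift \<theta> (a *\<^sub>C x) = a *\<^sub>C compressed_shift \<theta> x"
    by (rule compressed_shift_eqI[where g = "a *\<^sub>C g"])
      (auto simp: shift_linear g theta_mult_linear scaleC_add_right intro!: csubspace_closed_ops csubspace_K compressed_shift_K)
qed

lemma cinner_compressed_shift: "y \<in> K \<Longrightarrow> cinner (compressed_shift \<theta> x) y = cinner x (back_z y)"
proof -
  assume y: "y \<in> K"
  obtain g where "mult_z x = compressed_shift \<theta> x + theta_mult g" using compressed_shift_decomp by blast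
  then have "cinner (mult_z x) y = cinner (compressed_shift \<theta> x) y + cinner (theta_mult g) y"
    by (simp add: cinner_add_left)
  then show ?thesis using y by (simp add: mem_model_space cinner_mult_z)
qed

lemma norm_compressed_shift_le: "norm (compressed_shift \<theta> x) \<le> norm x"
proof -
  let ?y = "compressed_shift \<theta> x"
  obtain g where "mult_z x = ?y + theta_mult g" using compressed_shift_decomp by blast
  moreover have "cinner ?y (- theta_mult g) = 0" using K_theta_mult[OF compressed_shift_K] by (simp add: cinner_minus_right)
  ultimately have "norm ?y \<le> norm (mult_z x)" using norm_le_norm_diff_of_orthogonal[of ?y "- theta_mult g"] by simp
  then show ?thesis by simp
qed

sublocale hilbert_operator K "compressed_shift \<theta>" back_z
proof
  show "bounded_op_on K (compressed_shift \<theta>)"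
    unfolding bounded_op_on_def
    by (auto simp: compressed_shift_K compressed_shift_linear intro!: exI[of _ 1] norm_compressed_shift_le)
  show "bounded_op_on K back_z"
    unfolding bounded_op_on_def
    by (auto simp: back_z_K shift_linear intro!: exI[of _ 1] norm_back_le)
qed (simp_all add: csubspace_K closed_K cinner_compressed_shift)

lemma adjoint_compressed_shift:
  assumes y: "y \<in> K"
  shows "adjoint_on K (compressed_shift \<theta>) y = back_z y"
  unfolding adjoint_on_def
proof (rule the_equality)
  show "back_z y \<in> K \<and> (\<forall>x\<in>K. cinner (compressed_shift \<theta> x) y = cinner x (back_z y))"
    using y back_z_K cinner_compressed_shift by blast
  fix u assume u: "u \<in> K \<and> (\<forall>x\<in>K. cinner (compressed_shift \<theta> x) y = cinner x u)"
  have d: "u - back_z y \<in> K" using u back_z_K[OF y] csubspace_closed_ops(3)[OF csubspace_K] by blast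
  then have "cinner (u - back_z y) u = cinner (u - back_z y) (back_z y)"
    using u cinner_compressed_shift[OF y] by metis
  then have "cinner (u - back_z y) (u - back_z y) = 0" by (simp add: cinner_diff_right)
  then show "u = back_z y" by (simp add: cinner_self)
qed

lemma T'_eq: "T' c = Bz c"
  by (simp add: fun_eq_iff shifted_op_def Bz_def)

lemma N_eq: "N c = {x \<in> K. Bz c x = 0}"
  by (simp add: kernel_on_def T'_eq)

lemma T_decomp: "\<exists>g. Az c x = T c x + theta_mult g"
  using compressed_shift_decomp[of x] by (auto simp: Az_def shifted_op_def algebra_simps)

text \<open>An eigenvector x of the compression would satisfy |Bz c x|^2 = |back_z x|^2 - |c|^2
  |x|^2 \<le> 0, making it an eigenvector of the backward shift, which has none for |c| \<ge>
  1.\<close>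

lemma injective_outside_disk:
  assumes "cmod c \<ge> 1" "x \<in> K" "T c x = 0"
  shows "x = 0"
proof -
  have S: "compressed_shift \<theta> x = c *\<^sub>C x" using assms(3) by (simp add: shifted_op_def)
  have "cinner (back_z x) x = cinner x (compressed_shift \<theta> x)"
    using cinner_compressed_shift[OF assms(2), of x] by (metis cinner_commute)
  then have i: "cinner (back_z x) (cnj c *\<^sub>C x) = complex_of_real ((cmod c)\<^sup>2 * (norm x)\<^sup>2)"
    by (simp add: S cinner_scaleC_right cinner_self cnj_mult_self flip: mult.assoc)
  have "(norm (Bz c x))\<^sup>2 = (norm (back_z x))\<^sup>2 - (cmod c)\<^sup>2 * (norm x)\<^sup>2"
    unfolding Bz_def norm_diff_sq i by (simp add: norm_scaleC power_mult_distrib)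
  also have "\<dots> \<le> (norm x)\<^sup>2 - 1 * (norm x)\<^sup>2"
    using norm_back_le(1)[of x] assms(1) by (intro diff_mono power_mono mult_right_mono) auto
  finally have "Bz c x = 0" by simp
  then show ?thesis by (rule Bz_injective[OF _ assms(1)])
qed

text \<open>T c x = 0 means (z - c) x = \<theta> g. As \<theta> is not identically zero on the
  fiber, g vanishes there and z - c cancels, so x lies in the range of \<theta> and is orthogonal to
  it.\<close>

lemma injective_inside_disk:
  assumes c: "c \<in> unit_disk" and nz: "w0 \<in> unit_disk" "heval \<theta> c w0 \<noteq> 0"
    and x: "x \<in> K" "T c x = 0"
  shows "x = 0"
proof -
  obtain g where g: "Az c x = theta_mult g" using T_decomp[of c x] x(2) by auto
  obtain as bs ds \<kappa> where F: "fiber_factorization (heval \<theta> c) as bs ds \<kappa>"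
    using fiber_factorization_of_nonzero[OF c nz] by blast
  obtain s where s: "\<And>w. w \<in> unit_disk \<Longrightarrow> s w \<noteq> 0 \<and> heval \<theta> c w = (\<Prod>a\<leftarrow>as. w - a) * s w"
    using fiber_factorization_quotient[OF F] by blast
  have "heval g c w = 0" if w: "w \<in> unit_disk" for w
  proof (rule eq_off_finite[OF connected_disk(1) w connected_disk(2), where F = "set as" and f = "heval g c" and g = "\<lambda>_. 0"])
    show "heval g c y = 0" if y: "y \<in> unit_disk - set as" for y
    proof -
      have "heval (Az c x) c y = heval \<theta> c y * heval g c y" unfolding g using heval_theta_mult c y by auto
      then have "heval \<theta> c y * heval g c y = 0" using heval_Az(1)[of c y c x] c y by simp
      moreover have "heval \<theta> c y \<noteq> 0" using s[of y] y by (auto simp: prod_list_zero_iff)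
      ultimately show ?thesis by simp
    qed
  qed (use c in \<open>auto intro!: continuous_heval_comp continuous_intros\<close>)
  then obtain g1 where g1: "g = Az c g1" using vanish_imp_Az[OF c] by blast
  have "Az c (x - theta_mult g1) = 0" using g by (simp add: g1 A_linear theta_mult_linear)
  then have "x = theta_mult g1" using norm_Az_ge[of c "x - theta_mult g1"] c by (auto simp: mult_le_0_iff)
  then have "cinner x x = 0" using K_theta_mult[OF x(1)] by metis
  then show ?thesis by (simp add: cinner_self)
qed

text \<open>Write \<open>g = g0 + (z - c) g1\<close> in \<open>(z - c) x = T c x + \<theta> g\<close> and restrict to \<open>z = c\<close>: as
  \<open>\<theta> (c, _)\<close> is bounded away from zero near the circle, \<open>g0\<close> is controlled by \<open>T c x\<close>.\<close>

lemma bounded_below_inside_disk: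
  assumes c: "c \<in> unit_disk" and F: "fiber_factorization (heval \<theta> c) as bs ds \<kappa>"
    and bs: "\<And>b. b \<in> set bs \<Longrightarrow> cmod b \<noteq> 1"
  shows "\<exists>C>0. \<forall>x\<in>K. C * norm x \<le> norm (T c x)"
proof -
  have F': "\<kappa> \<noteq> 0" "set as \<subseteq> unit_disk"
    "\<And>w. w \<in> unit_disk \<Longrightarrow> heval \<theta> c w * (\<Prod>d\<leftarrow>ds. w - d) = \<kappa> * (\<Prod>a\<leftarrow>as. w - a) * (\<Prod>b\<leftarrow>bs. w - b)"
    using F by (auto simp: fiber_factorization_def)
  have "cmod a \<noteq> 1" if "a \<in> set (as @ bs)" for a using that F'(2) bs by auto
  then obtain C1 where C1: "C1 > 0" "\<And>x. C1 * norm x \<le> norm (foldr Aw (as @ bs) x)"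
    using norm_foldr_Aw_ge by blast
  obtain C2 where C2: "C2 > 0" "\<And>x. norm (foldr Aw ds x) \<le> C2 * norm x" using norm_foldr_Aw_le by blast
  define C3 where "C3 = 1 + 2 / (1 - cmod c)"
  have c1: "cmod c < 1" using c by simp
  have C3: "C3 > 0" using c1 by (auto simp: C3_def intro!: add_pos_nonneg)
  define M where "M = C3 * C2 / (cmod \<kappa> * C1)"
  have M: "M > 0" using C1 C2 C3 F'(1) by (simp add: M_def)
  have main: "(1 - cmod c) * norm x \<le> (1 + M) * norm (T c x)" if x: "x \<in> K" for x
  proof -
    obtain g where g: "Az c x = T c x + theta_mult g" using T_decomp by blast
    obtain g1 g0 where g01: "g = Az c g1 + g0" "back_z g0 = 0" using difference_quotient[OF c1] by blast
    define u where "u = foldr Aw ds (T c x)"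
    obtain k h where kh: "u = Az c k + h" "back_z h = 0" "norm h \<le> C3 * norm u"
      unfolding C3_def using difference_quotient[OF c1] by blast
    \<comment> \<open>On the fiber, h is the product over \<open>ds\<close> times T c x, which
      equals minus the product over \<open>ds\<close> times \<theta> g0. So y vanishes there, and
      being independent of z it vanishes everywhere.\<close>
    define y where "y = h + \<kappa> *\<^sub>C foldr Aw (as @ bs) g0"
    have bz: "back_z (Aw a v) = 0" if "back_z v = 0" for a v
      using that by (simp add: Aw_def shift_linear shift_commute)
    have "back_z (foldr Aw l v) = 0" if "back_z v = 0" for l v
      using that by (induction l) (simp_all add: bz)
    then have by0: "back_z y = 0" using kh(2) g01(2) by (simp add: y_def shift_linear)
    have "y = 0"
    proof (rule heval_const_z_zero[OF by0 c])
      fix w assume w: "w \<in> unit_disk"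
      have "heval (Az c x) c w = 0" by (simp add: heval_Az[OF c w])
      then have T: "heval (T c x) c w = - (heval \<theta> c w * heval g0 c w)"
        unfolding g heval_linear[OF c w] heval_theta_mult[OF c w] g01(1) heval_Az[OF c w] by (simp add: eq_neg_iff_add_eq_0)
      have "heval h c w = heval u c w" by (simp add: kh(1) heval_linear[OF c w] heval_Az[OF c w])
      also have "\<dots> = - (heval \<theta> c w * (\<Prod>d\<leftarrow>ds. w - d)) * heval g0 c w"
        unfolding u_def heval_foldr_Aw[OF c w] T by simp
      finally show "heval y c w = 0"
        unfolding y_def heval_linear[OF c w] heval_foldr_Aw[OF c w] F'(3)[OF w] by simp
    qed
    then have "h = - (\<kappa> *\<^sub>C foldr Aw (as @ bs) g0)" by (simp add: y_def eq_neg_iff_add_eq_0)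
    then have nh: "norm h = cmod \<kappa> * norm (foldr Aw (as @ bs) g0)" by (simp add: norm_scaleC)
    have "cmod \<kappa> * C1 * norm g0 \<le> norm h"
      unfolding nh mult.assoc by (intro mult_left_mono C1) auto
    also have "\<dots> \<le> C3 * (C2 * norm (T c x))"
      using order.trans[OF kh(3)] mult_left_mono[OF C2(2)[of "T c x"], of C3] C3 by (simp add: u_def)
    finally have g0: "norm g0 \<le> M * norm (T c x)"
      using F'(1) C1(1) by (simp add: M_def field_simps)
    \<comment> \<open>Replacing x by x - \<theta> g1 leaves only the controlled g0 on the right;
      since x is orthogonal to \<theta> g1, this does not decrease its norm.\<close>
    have "Az c (x - theta_mult g1) = T c x + theta_mult g0"
      using g by (simp add: g01(1) A_linear theta_mult_linear algebra_simps)
    then have "(1 - cmod c) * norm (x - theta_mult g1) \<le> norm (T c x + theta_mult g0)"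
      using norm_Az_ge[of c "x - theta_mult g1"] c1 by simp
    also have "\<dots> \<le> (1 + M) * norm (T c x)"
      using norm_triangle_ineq[of "T c x" "theta_mult g0"] g0 by (simp add: norm_theta_mult distrib_right)
    finally have 1: "(1 - cmod c) * norm (x - theta_mult g1) \<le> (1 + M) * norm (T c x)" .
    have "norm x \<le> norm (x - theta_mult g1)" by (rule norm_le_norm_diff_of_orthogonal[OF K_theta_mult[OF x]])
    then have "(1 - cmod c) * norm x \<le> (1 - cmod c) * norm (x - theta_mult g1)" using c1 by (intro mult_left_mono) auto
    with 1 show ?thesis by simp
  qed
  show ?thesis
  proof (intro exI[of _ "(1 - cmod c) / (1 + M)"] conjI ballI)
    show "(1 - cmod c) / (1 + M) * norm x \<le> norm (T c x)" if "x \<in> K" for x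
      using main[OF that] M by (simp add: field_simps)
  qed (use c1 M in auto)
qed

text \<open>Outside the disk both T c and its adjoint are injective, so there the Fredholm property
  already implies invertibility.\<close>

lemma \<Omega>_subset_disk: "\<Omega> \<subseteq> unit_disk"
proof
  fix c assume "c \<in> \<Omega>"
  then have c: "\<not> invertible_on K (T c)" "fredholm_on K (T c)" unfolding \<Omega>_iff by blast+
  show "c \<in> unit_disk"
  proof (rule ccontr)
    assume "c \<notin> unit_disk"
    then have c1: "cmod c \<ge> 1" by simp
    have "\<exists>C>0. \<forall>x\<in>K. C * norm x \<le> norm (T c x)"
      by (rule bounded_below_of_fredholm[OF c(2) injective_outside_disk[OF c1]])
    then obtain C where C: "C > 0" "\<forall>x\<in>K. C * norm x \<le> norm (T c x)" by (elim exE conjE)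
    have "x = 0" if "x \<in> N c" for x
      using that Bz_injective[OF _ c1, of x] by (simp add: N_eq)
    then have "N c = {0}" using csubspace_closed_ops(1)[OF csubspace_N[of c]] by auto
    then show False using invertible_of_trivial_kernel[OF C(1) bspec[OF C(2)]] c(1) by blast
  qed
qed

end

section \<open>Fibers with zeros on the circle\<close>

lemma power_sum_zero:
  fixes c :: "nat \<Rightarrow> complex"
  assumes "\<And>v. (\<Sum>b<N. c b * v ^ b) = 0" "b < N"
  shows "c b = 0"
proof -
  have "poly (\<Sum>b<N. monom (c b) b) v = 0" for v using assms(1)[of v] by (simp add: poly_sum poly_monom)
  then have "(\<Sum>b<N. monom (c b) b) = 0" by (simp flip: poly_all_0_iff_0)
  then have "coeff (\<Sum>b<N. monom (c b) b) b = 0" by simp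
  then show ?thesis using assms(2) by (simp add: coeff_sum)
qed

lemma poly_zero_of_real_interval:
  fixes p :: "complex poly" and a b :: real
  assumes "a < b" "\<And>x. a < x \<Longrightarrow> x < b \<Longrightarrow> poly p (of_real x) = 0"
  shows "p = 0"
proof (rule ccontr)
  assume "p \<noteq> 0"
  then have "finite {x. poly p x = 0}" by (rule poly_roots_finite)
  then have "finite (complex_of_real ` {a<..<b})" by (rule finite_subset[rotated]) (use assms(2) in auto)
  then have "finite {a<..<b}" by (rule finite_imageD) (auto simp: inj_on_def)
  then show False using infinite_Ioo[OF assms(1)] by blast
qed

text \<open>A polynomial in \<open>z\<close> and \<open>cnj z\<close> vanishing on a disk vanishes at all \<open>x + \<i> y\<close>, \<open>x - \<i> y\<close>
  with independent complex \<open>x\<close> and \<open>y\<close>.\<close>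

lemma poly_conj_zero:
  fixes r :: "nat \<Rightarrow> nat \<Rightarrow> complex"
  assumes e: "e > 0" and zero: "\<And>z. z \<in> ball c e \<Longrightarrow> (\<Sum>a<N. \<Sum>b<N. r a b * (z ^ a * cnj z ^ b)) = 0"
    and ab: "a < N" "b < N"
  shows "r a b = 0"
proof -
  let ?F = "\<lambda>u v. \<Sum>a<N. \<Sum>b<N. r a b * (u ^ a * v ^ b)"
  have real: "?F (of_real x + \<i> * of_real y) (of_real x - \<i> * of_real y) = 0"
    if "\<bar>x - Re c\<bar> < e / 2" "\<bar>y - Im c\<bar> < e / 2" for x y
  proof -
    have "cmod (c - Complex x y) \<le> \<bar>Re (c - Complex x y)\<bar> + \<bar>Im (c - Complex x y)\<bar>" by (rule cmod_le)
    also have "\<dots> < e"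
    proof -
      have "\<bar>Re (c - Complex x y)\<bar> < e / 2" "\<bar>Im (c - Complex x y)\<bar> < e / 2"
        using that by (simp_all add: abs_minus_commute)
      then show ?thesis by linarith
    qed
    finally have "Complex x y \<in> ball c e" by (simp add: dist_norm)
    moreover have "Complex x y = of_real x + \<i> * of_real y" "cnj (Complex x y) = of_real x - \<i> * of_real y"
      by (simp_all add: complex_eq_iff)
    ultimately show ?thesis using zero[of "Complex x y"] by simp
  qed
  have x: "?F (x + \<i> * of_real y) (x - \<i> * of_real y) = 0" if y: "\<bar>y - Im c\<bar> < e / 2" for x y
  proof -
    define G where "G = (\<Sum>a<N. \<Sum>b<N. smult (r a b) ([:\<i> * of_real y, 1:] ^ a * [:- \<i> * of_real y, 1:] ^ b))"
    have G: "poly G x = ?F (x + \<i> * of_real y) (x - \<i> * of_real y)" for x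
      by (simp add: G_def poly_sum algebra_simps)
    have "G = 0"
    proof (rule poly_zero_of_real_interval[of "Re c - e / 2" "Re c + e / 2"])
      fix x assume "Re c - e / 2 < x" "x < Re c + e / 2"
      then have "\<bar>x - Re c\<bar> < e / 2" by linarith
      then show "poly G (of_real x) = 0" unfolding G by (rule real[OF _ y])
    qed (use e in simp)
    then show ?thesis using G[of x] by simp
  qed
  have xy: "?F (x + \<i> * y) (x - \<i> * y) = 0" for x y
  proof -
    define G where "G = (\<Sum>a<N. \<Sum>b<N. smult (r a b) ([:x, \<i>:] ^ a * [:x, - \<i>:] ^ b))"
    have G: "poly G y = ?F (x + \<i> * y) (x - \<i> * y)" for y
      by (simp add: G_def poly_sum algebra_simps)
    have "G = 0"
    proof (rule poly_zero_of_real_interval[of "Im c - e / 2" "Im c + e / 2"])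
      fix y assume "Im c - e / 2 < y" "y < Im c + e / 2"
      then have "\<bar>y - Im c\<bar> < e / 2" by linarith
      then show "poly G (of_real y) = 0" unfolding G by (rule x)
    qed (use e in simp)
    then show ?thesis using G[of y] by simp
  qed
  \<comment> \<open>Inverts u = x + \<i> y, v = x - \<i> y.\<close>
  have uv: "?F u v = 0" for u v
    using xy[of "(u + v) / 2" "(u - v) / (2 * \<i>)"] by (simp add: field_simps)
  have "(\<Sum>b<N. r a b * v ^ b) = 0" for v
  proof (rule power_sum_zero[OF _ ab(1)])
    fix u
    have "(\<Sum>a<N. (\<Sum>b<N. r a b * v ^ b) * u ^ a) = ?F u v"
      by (simp add: sum_distrib_left mult_ac)
    then show "(\<Sum>a<N. (\<Sum>b<N. r a b * v ^ b) * u ^ a) = 0" using uv by simp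
  qed
  then show ?thesis using power_sum_zero[OF _ ab(2)] by blast
qed

text \<open>Exchanges the roles of the variables; n is the degree in z, so that A n is a nonzero
  leading coefficient to reduce powers of z with.\<close>

lemma poly2_by_powers_of_z:
  assumes "p \<noteq> 0"
  shows "\<exists>n A. A n \<noteq> 0 \<and> (\<forall>z w. poly2 p z w = (\<Sum>i\<le>n. poly (A i) w * z ^ i))"
proof -
  define A where "A i = map_poly (\<lambda>a. coeff a i) p" for i
  have coA: "coeff (A i) j = coeff (coeff p j) i" for i j by (simp add: A_def coeff_map_poly)
  have "{i. A i \<noteq> 0} \<subseteq> (\<Union>j\<le>degree p. {..degree (coeff p j)})"
  proof
    fix i assume "i \<in> {i. A i \<noteq> 0}"
    then obtain j where "coeff (A i) j \<noteq> 0" by (auto simp: poly_eq_iff)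
    then have "coeff (coeff p j) i \<noteq> 0" by (simp add: coA)
    then have "i \<le> degree (coeff p j)" "j \<le> degree p" by (auto intro: le_degree)
    then show "i \<in> (\<Union>j\<le>degree p. {..degree (coeff p j)})" by auto
  qed
  then have fin: "finite {i. A i \<noteq> 0}" by (rule finite_subset) auto
  have ne: "{i. A i \<noteq> 0} \<noteq> {}"
  proof
    assume "{i. A i \<noteq> 0} = {}"
    then have "coeff (coeff p j) i = 0" for i j using coA[of i j] by simp
    then show False using assms by (auto simp: poly_eq_iff)
  qed
  define n where "n = Max {i. A i \<noteq> 0}"
  have "A n \<noteq> 0" using Max_in[OF fin ne] by (simp add: n_def)
  moreover have An: "A i = 0" if "i > n" for i
    using that Max_ge[OF fin, of i] by (auto simp: n_def)
  have "poly2 p z w = (\<Sum>i\<le>n. poly (A i) w * z ^ i)" for z w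
  proof -
    have dj: "degree (coeff p j) \<le> n" for j
      by (rule degree_le) (use An coA in \<open>metis coeff_0\<close>)
    have dA: "degree (A i) \<le> degree p" for i by (rule degree_le) (simp add: coA coeff_eq_0)
    have "poly2 p z w = (\<Sum>j\<le>degree p. poly (coeff p j) z * w ^ j)"
      unfolding poly2_def poly_altdef[of p] by (simp add: poly_sum)
    also have "\<dots> = (\<Sum>j\<le>degree p. \<Sum>i\<le>n. coeff (coeff p j) i * z ^ i * w ^ j)"
    proof (rule sum.cong)
      fix j
      have "poly (coeff p j) z = (\<Sum>i\<le>n. coeff (coeff p j) i * z ^ i)"
        unfolding poly_altdef by (rule sum.mono_neutral_left) (use dj[of j] in \<open>auto simp: coeff_eq_0\<close>)
      then show "poly (coeff p j) z * w ^ j = (\<Sum>i\<le>n. coeff (coeff p j) i * z ^ i * w ^ j)"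
        by (simp add: sum_distrib_right)
    qed simp
    also have "\<dots> = (\<Sum>i\<le>n. \<Sum>j\<le>degree p. coeff (coeff p j) i * z ^ i * w ^ j)" by (rule sum.swap)
    also have "\<dots> = (\<Sum>i\<le>n. poly (A i) w * z ^ i)"
    proof (rule sum.cong)
      fix i
      have "poly (A i) w = (\<Sum>j\<le>degree p. coeff (A i) j * w ^ j)"
        unfolding poly_altdef by (rule sum.mono_neutral_left) (use dA[of i] in \<open>auto simp: coeff_eq_0\<close>)
      then show "(\<Sum>j\<le>degree p. coeff (coeff p j) i * z ^ i * w ^ j) = poly (A i) w * z ^ i"
        by (simp add: coA sum_distrib_left mult_ac)
    qed simp
    finally show ?thesis .
  qed
  ultimately show ?thesis by blast
qed

text \<open>Pseudo-division: each power of z costs one factor A n instead of a division. Degrees in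
  w grow by at most d per step, and this linear growth is what the counting argument on fibers
  needs.\<close>

lemma power_reduction:
  fixes A :: "nat \<Rightarrow> complex poly"
  assumes n: "n > 0" and d: "\<And>i. i \<le> n \<Longrightarrow> degree (A i) \<le> d"
  shows "\<exists>B. (\<forall>i<n. degree (B i) \<le> a * d) \<and>
    (\<forall>z w. (\<Sum>i\<le>n. poly (A i) w * z ^ i) = 0 \<longrightarrow> poly (A n) w ^ a * z ^ a = (\<Sum>i<n. poly (B i) w * z ^ i))"
proof (induction a)
  case 0
  obtain m where m: "n = Suc m" using n by (cases n) auto
  show ?case by (rule exI[of _ "\<lambda>i. if i = 0 then 1 else 0"]) (simp add: m sum.lessThan_Suc_shift del: sum.lessThan_Suc)
next
  case (Suc a)
  then obtain B where B: "\<And>i. i < n \<Longrightarrow> degree (B i) \<le> a * d"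
    "\<And>z w. (\<Sum>i\<le>n. poly (A i) w * z ^ i) = 0 \<Longrightarrow> poly (A n) w ^ a * z ^ a = (\<Sum>i<n. poly (B i) w * z ^ i)" by blast
  obtain m where m: "n = Suc m" using n by (cases n) auto
  define B' where "B' i = (if i = 0 then 0 else A n * B (i - 1)) - B m * A i" for i
  have dm: "degree (x * y) \<le> Suc a * d" if "degree x \<le> a * d" "degree y \<le> d" for x y :: "complex poly"
    using degree_mult_le[of x y] that by simp
  have "degree (B' i) \<le> Suc a * d" if "i < n" for i
    unfolding B'_def using dm[of "B (i - 1)" "A n"] dm[of "B m" "A i"] B(1)[of "i - 1"] B(1)[of m] d[of n] d[of i] that m
    by (intro degree_diff_le) (auto simp: mult.commute)
  moreover have "poly (A n) w ^ Suc a * z ^ Suc a = (\<Sum>i<n. poly (B' i) w * z ^ i)"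
    if z: "(\<Sum>i\<le>n. poly (A i) w * z ^ i) = 0" for z w
  proof -
    have top: "poly (A n) w * z ^ n = - (\<Sum>i<n. poly (A i) w * z ^ i)"
      using z by (simp add: lessThan_Suc_atMost[symmetric] eq_neg_iff_add_eq_0 add.commute)
    have "poly (A n) w ^ Suc a * z ^ Suc a = poly (A n) w * z * (poly (A n) w ^ a * z ^ a)" by simp
    also have "\<dots> = (\<Sum>i<n. poly (A n * B i) w * z ^ Suc i)"
      unfolding B(2)[OF z] sum_distrib_left by (intro sum.cong) (auto simp: mult_ac)
    also have "\<dots> = (\<Sum>i<m. poly (A n * B i) w * z ^ Suc i) + poly (B m) w * (poly (A n) w * z ^ n)"
      by (simp add: m mult_ac)
    also have "(\<Sum>i<m. poly (A n * B i) w * z ^ Suc i) = (\<Sum>i<n. poly (if i = 0 then 0 else A n * B (i - 1)) w * z ^ i)"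
      unfolding m by (subst sum.lessThan_Suc_shift) simp
    also have "\<dots> + poly (B m) w * (poly (A n) w * z ^ n) = (\<Sum>i<n. poly (B' i) w * z ^ i)"
      unfolding top by (simp add: B'_def sum_subtractf sum_distrib_left algebra_simps)
    finally show ?thesis .
  qed
  ultimately show ?case by blast
qed

text \<open>On the circle \<open>cnj \<tau>\<close> is the inverse of \<tau>, so \<tau>^M turns the
  conjugate of a polynomial of degree at most M into a polynomial.\<close>

lemma reflected_poly:
  fixes C :: "complex poly"
  assumes "degree C \<le> M"
  shows "\<exists>D. degree D \<le> M \<and> (\<forall>\<tau>. cmod \<tau> = 1 \<longrightarrow> poly D \<tau> = \<tau> ^ M * cnj (poly C \<tau>))"
proof (intro exI[of _ "\<Sum>j\<le>M. monom (cnj (coeff C j)) (M - j)"] conjI allI impI)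
  show "degree (\<Sum>j\<le>M. monom (cnj (coeff C j)) (M - j)) \<le> M"
    by (rule degree_sum_le) (auto intro: order.trans[OF degree_monom_le])
  fix \<tau> :: complex assume \<tau>: "cmod \<tau> = 1"
  then have inv: "\<tau> * cnj \<tau> = 1" by (simp add: cnj_mult_self)
  have C: "poly C \<tau> = (\<Sum>j\<le>M. coeff C j * \<tau> ^ j)"
    unfolding poly_altdef by (rule sum.mono_neutral_left) (use assms in \<open>auto simp: coeff_eq_0\<close>)
  have "\<tau> ^ M * cnj (poly C \<tau>) = (\<Sum>j\<le>M. \<tau> ^ M * (cnj (coeff C j) * cnj \<tau> ^ j))"
    unfolding C by (simp add: sum_distrib_left)
  also have "\<dots> = (\<Sum>j\<le>M. cnj (coeff C j) * \<tau> ^ (M - j))"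
  proof (rule sum.cong)
    fix j assume "j \<in> {..M}"
    then have "\<tau> ^ M = \<tau> ^ (M - j) * \<tau> ^ j" by (simp flip: power_add)
    then have "\<tau> ^ M * cnj \<tau> ^ j = \<tau> ^ (M - j) * (\<tau> * cnj \<tau>) ^ j" by (simp add: power_mult_distrib)
    then show "\<tau> ^ M * (cnj (coeff C j) * cnj \<tau> ^ j) = cnj (coeff C j) * \<tau> ^ (M - j)"
      by (simp add: inv mult_ac)
  qed simp
  finally show "poly (\<Sum>j\<le>M. monom (cnj (coeff C j)) (M - j)) \<tau> = \<tau> ^ M * cnj (poly C \<tau>)"
    by (simp add: poly_sum poly_monom)
qed

text \<open>If every \<open>z\<close> in an open set had some \<open>\<tau>\<close> on the circle with \<open>p (z, \<tau>) = 0\<close>, then reducing powers of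
  \<open>z\<close> and of \<open>cnj z\<close> modulo \<open>p (z, \<tau>) = 0\<close> would leave only \<open>O(N)\<close> independent functions among the \<open>N\<^sup>2\<close>
  functions \<open>z ^ a * cnj z ^ b\<close> with \<open>a, b < N\<close>, hence a linear relation between these on an open set.\<close>

lemma zero_free_fibers_dense:
  assumes p: "\<And>\<tau>. cmod \<tau> = 1 \<Longrightarrow> \<exists>z. poly2 p z \<tau> \<noteq> 0" and e: "e > 0"
  shows "\<exists>z\<in>ball c e. \<forall>\<tau>. cmod \<tau> = 1 \<longrightarrow> poly2 p z \<tau> \<noteq> 0"
proof (rule ccontr)
  assume "\<not> ?thesis"
  then have bad: "\<And>z. z \<in> ball c e \<Longrightarrow> \<exists>\<tau>. cmod \<tau> = 1 \<and> poly2 p z \<tau> = 0" by blast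
  have "p \<noteq> 0" using p[of 1] by auto
  then obtain n A where An: "A n \<noteq> 0" and pA: "\<And>z w. poly2 p z w = (\<Sum>i\<le>n. poly (A i) w * z ^ i)"
    using poly2_by_powers_of_z by blast
  have n: "n > 0"
  proof (rule ccontr)
    assume "\<not> n > 0"
    then have ind: "poly2 p z w = poly (A 0) w" for z w by (simp add: pA)
    have "c \<in> ball c e" using e by simp
    then obtain \<tau> where "cmod \<tau> = 1" "poly2 p c \<tau> = 0" using bad by blast
    then show False using p[of \<tau>] by (simp add: ind)
  qed
  define d where "d = Max ((\<lambda>i. degree (A i)) ` {..n})"
  have d: "degree (A i) \<le> d" if "i \<le> n" for i
    unfolding d_def by (rule Max_ge) (use that in auto)
  \<comment> \<open>Chosen so that n^2 (2 N d + 1), the number of equations, is at most N n^2 (2 d +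
    1) and hence below N^2, the number of unknowns.\<close>
  define N where "N = Suc (n * n * (2 * d + 1))"
  define M where "M = N * d"
  have "\<forall>a. \<exists>B. (\<forall>i<n. degree (B i) \<le> a * d) \<and>
      (\<forall>z w. (\<Sum>i\<le>n. poly (A i) w * z ^ i) = 0 \<longrightarrow> poly (A n) w ^ a * z ^ a = (\<Sum>i<n. poly (B i) w * z ^ i))"
    by (rule allI) (rule power_reduction[OF n d])
  from choice[OF this] obtain B where B': "\<forall>a. (\<forall>i<n. degree (B a i) \<le> a * d) \<and>
      (\<forall>z w. (\<Sum>i\<le>n. poly (A i) w * z ^ i) = 0 \<longrightarrow> poly (A n) w ^ a * z ^ a = (\<Sum>i<n. poly (B a i) w * z ^ i))" ..
  have B: "degree (B a i) \<le> a * d" if "i < n" for a i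
    using B' that by blast
  have B2: "poly (A n) w ^ a * z ^ a = (\<Sum>i<n. poly (B a i) w * z ^ i)" if "(\<Sum>i\<le>n. poly (A i) w * z ^ i) = 0" for a z w
    using B' that by blast
  \<comment> \<open>The extra powers of A n make the factor in front of z^a the same for all a <
    N.\<close>
  define C where "C a i = A n ^ (N - a) * B a i" for a i
  have C_deg: "degree (C a i) \<le> M" if "a < N" "i < n" for a i
  proof -
    have "degree (C a i) \<le> degree (A n ^ (N - a)) + degree (B a i)" unfolding C_def by (rule degree_mult_le)
    also have "\<dots> \<le> degree (A n) * (N - a) + a * d" by (intro add_mono degree_power_le B that)
    also have "\<dots> \<le> d * (N - a) + a * d" by (intro add_mono mult_right_mono d) auto
    also have "\<dots> = d * ((N - a) + a)" by (simp only: distrib_left mult.commute[of a])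
    also have "\<dots> = M" using that(1) by (simp add: M_def mult.commute)
    finally show ?thesis .
  qed
  have C_eq: "poly (A n) w ^ N * z ^ a = (\<Sum>i<n. poly (C a i) w * z ^ i)"
    if "poly2 p z w = 0" "a < N" for z w a
  proof -
    have "poly (A n) w ^ N * z ^ a = poly (A n) w ^ (N - a) * (poly (A n) w ^ a * z ^ a)"
      using that(2) by (simp flip: power_add mult.assoc)
    also have "\<dots> = (\<Sum>i<n. poly (C a i) w * z ^ i)"
      using that(1) by (subst B2) (simp_all add: pA C_def sum_distrib_left mult_ac)
    finally show ?thesis .
  qed
  define E where "E b i = (SOME E. degree E \<le> M \<and> (\<forall>\<tau>. cmod \<tau> = 1 \<longrightarrow> poly E \<tau> = \<tau> ^ M * cnj (poly (C b i) \<tau>)))" for b i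
  have E': "degree (E b i) \<le> M \<and> (\<forall>\<tau>. cmod \<tau> = 1 \<longrightarrow> poly (E b i) \<tau> = \<tau> ^ M * cnj (poly (C b i) \<tau>))" if "b < N" "i < n" for b i
    unfolding E_def by (rule someI_ex) (rule reflected_poly[OF C_deg[OF that]])
  have E: "degree (E b i) \<le> M" if "b < N" "i < n" for b i
    using E'[OF that] by blast
  have E2: "poly (E b i) \<tau> = \<tau> ^ M * cnj (poly (C b i) \<tau>)" if "b < N" "i < n" "cmod \<tau> = 1" for b i \<tau>
    using E'[OF that(1,2)] that(3) by blast
  define I where "I = {..<N} \<times> {..<N}"
  define J where "J = ({..<n} \<times> {..<n}) \<times> {..2 * M}"
  define v where "v = (\<lambda>(a, b) ((i, i'), j). coeff (C a i * E b i') j)"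
  have "card J < card I"
  proof -
    have "card J = n * n * (2 * M + 1)" by (simp add: J_def)
    also have "\<dots> \<le> n * n * (N * (2 * d + 1))" by (intro mult_left_mono) (auto simp: M_def N_def algebra_simps)
    also have "\<dots> = N * (n * n * (2 * d + 1))" by (simp only: mult_ac)
    also have "\<dots> < N * N" by (rule mult_strict_left_mono) (auto simp: N_def)
    finally show ?thesis by (simp add: I_def)
  qed
  then obtain r where r: "\<exists>x\<in>I. r x \<noteq> 0" "\<And>j. j \<in> J \<Longrightarrow> (\<Sum>x\<in>I. r x * v x j) = 0"
    using homogeneous_system_solution[of J I v] by (auto simp: I_def J_def)
  define R where "R z = (\<Sum>a<N. \<Sum>b<N. r (a, b) * (z ^ a * cnj z ^ b))" for z
  have R0: "R z = 0" if z: "poly2 p z \<tau> = 0" and \<tau>: "cmod \<tau> = 1" and nz: "poly (A n) \<tau> \<noteq> 0" for z \<tau>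
  proof -
    let ?L = "poly (A n) \<tau> ^ N"
    have tm: "\<tau> ^ M * (?L * cnj ?L) * (z ^ a * cnj z ^ b) = (\<Sum>(i, i')\<in>{..<n} \<times> {..<n}. poly (C a i * E b i') \<tau> * (z ^ i * cnj z ^ i'))"
      if "a < N" "b < N" for a b
    proof -
      have "\<tau> ^ M * (?L * cnj ?L) * (z ^ a * cnj z ^ b) = (?L * z ^ a) * (\<tau> ^ M * cnj (?L * z ^ b))"
        by (simp add: mult_ac)
      also have "\<dots> = (\<Sum>i<n. poly (C a i) \<tau> * z ^ i) * (\<Sum>i'<n. poly (E b i') \<tau> * cnj z ^ i')"
        unfolding C_eq[OF z that(1)] C_eq[OF z that(2)]
        using E2[OF that(2) _ \<tau>] by (simp add: sum_distrib_left mult_ac)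
      also have "\<dots> = (\<Sum>i<n. \<Sum>i'<n. poly (C a i * E b i') \<tau> * (z ^ i * cnj z ^ i'))"
        unfolding sum_product by (intro sum.cong) (auto simp: mult_ac)
      finally show ?thesis by (simp add: sum.cartesian_product)
    qed
    have expand: "poly (C a i * E b i') \<tau> = (\<Sum>j\<le>2 * M. v (a, b) ((i, i'), j) * \<tau> ^ j)" if "a < N" "b < N" "i < n" "i' < n" for a b i i'
    proof -
      have "degree (C a i * E b i') \<le> 2 * M"
        using degree_mult_le[of "C a i" "E b i'"] C_deg[OF that(1,3)] E[OF that(2,4)] by simp
      then show ?thesis unfolding poly_altdef v_def
        by (simp, intro sum.mono_neutral_left) (auto simp: coeff_eq_0)
    qed
    have "\<tau> ^ M * (?L * cnj ?L) * R z = (\<Sum>a<N. \<Sum>b<N. r (a, b) * (\<tau> ^ M * (?L * cnj ?L) * (z ^ a * cnj z ^ b)))"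
      unfolding R_def sum_distrib_left by (intro sum.cong) (auto simp: mult_ac)
    also have "\<dots> = (\<Sum>a<N. \<Sum>b<N. \<Sum>(i, i')\<in>{..<n} \<times> {..<n}. \<Sum>j\<le>2 * M. r (a, b) * v (a, b) ((i, i'), j) * (\<tau> ^ j * (z ^ i * cnj z ^ i')))"
    proof (intro sum.cong refl)
      fix a b assume "a \<in> {..<N}" "b \<in> {..<N}"
      then have ab: "a < N" "b < N" by auto
      have "r (a, b) * (\<tau> ^ M * (?L * cnj ?L) * (z ^ a * cnj z ^ b)) = (\<Sum>(i, i')\<in>{..<n} \<times> {..<n}. r (a, b) * (poly (C a i * E b i') \<tau> * (z ^ i * cnj z ^ i')))"
        unfolding tm[OF ab] sum_distrib_left by (intro sum.cong) auto
      also have "\<dots> = (\<Sum>(i, i')\<in>{..<n} \<times> {..<n}. \<Sum>j\<le>2 * M. r (a, b) * v (a, b) ((i, i'), j) * (\<tau> ^ j * (z ^ i * cnj z ^ i')))"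
      proof (intro sum.cong refl, clarify)
        fix i i' assume "i < n" "i' < n"
        then show "r (a, b) * (poly (C a i * E b i') \<tau> * (z ^ i * cnj z ^ i')) = (\<Sum>j\<le>2 * M. r (a, b) * v (a, b) ((i, i'), j) * (\<tau> ^ j * (z ^ i * cnj z ^ i')))"
          unfolding expand[OF ab \<open>i < n\<close> \<open>i' < n\<close>] sum_distrib_left sum_distrib_right by (simp only: mult_ac)
      qed
      finally show "r (a, b) * (\<tau> ^ M * (?L * cnj ?L) * (z ^ a * cnj z ^ b)) = (\<Sum>(i, i')\<in>{..<n} \<times> {..<n}. \<Sum>j\<le>2 * M. r (a, b) * v (a, b) ((i, i'), j) * (\<tau> ^ j * (z ^ i * cnj z ^ i')))" .
    qed
    also have "\<dots> = (\<Sum>x\<in>I. \<Sum>y\<in>J. r x * v x y * (case y of ((i, i'), j) \<Rightarrow> \<tau> ^ j * (z ^ i * cnj z ^ i')))"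
      unfolding I_def J_def by (simp add: sum.cartesian_product')
    also have "\<dots> = (\<Sum>y\<in>J. (\<Sum>x\<in>I. r x * v x y) * (case y of ((i, i'), j) \<Rightarrow> \<tau> ^ j * (z ^ i * cnj z ^ i')))"
      by (subst sum.swap) (simp add: sum_distrib_right)
    also have "\<dots> = 0" using r(2) by simp
    finally show ?thesis using nz \<tau> by auto
  qed
  \<comment> \<open>Points z met only through a \<tau> at which the leading coefficient vanishes,
    where the reduction says nothing. They are finitely many because no p(_, \<tau>) is identically
    zero.\<close>
  define Z where "Z = (\<Union>\<tau>\<in>{\<tau>. poly (A n) \<tau> = 0 \<and> cmod \<tau> = 1}. {z. poly2 p z \<tau> = 0})"
  have "finite Z"
    unfolding Z_def
  proof (rule finite_UN_I)
    show "finite {\<tau>. poly (A n) \<tau> = 0 \<and> cmod \<tau> = 1}"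
      by (rule finite_subset[OF _ poly_roots_finite[OF An]]) auto
    show "finite {z. poly2 p z \<tau> = 0}" if "\<tau> \<in> {\<tau>. poly (A n) \<tau> = 0 \<and> cmod \<tau> = 1}" for \<tau>
    proof -
      have "poly p [:\<tau>:] \<noteq> 0" using p[of \<tau>] that by (auto simp: poly2_def)
      then show ?thesis unfolding poly2_def by (rule poly_roots_finite)
    qed
  qed
  have "R z = 0" if z: "z \<in> ball c e" for z
  proof (rule eq_off_finite[where S = "ball c e" and f = R and g = "\<lambda>_. 0", OF _ z _ _ _ \<open>finite Z\<close>])
    have "c + of_real (e / 2) \<in> ball c e" "c \<in> ball c e" using e by (auto simp: dist_norm)
    moreover have "c + of_real (e / 2) \<noteq> c" using e by simp
    ultimately show "ball c e \<noteq> {z}" by (metis singletonD)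
    show "continuous_on (ball c e) R" unfolding R_def by (intro continuous_intros)
    show "R y = 0" if "y \<in> ball c e - Z" for y
      using bad[of y] that R0[of y] by (auto simp: Z_def)
  qed auto
  then have "r (a, b) = 0" if "a < N" "b < N" for a b
    using poly_conj_zero[OF e, where c = c and N = N and r = "\<lambda>a b. r (a, b)"] that by (simp add: R_def)
  then show False using r(1) by (auto simp: I_def)
qed

section \<open>Division of power series and of polynomials\<close>

text \<open>Zeros of H are isolated, and the bound makes them removable singularities of F /
  H.\<close>

lemma holomorphic_division:
  assumes S: "open S" "connected S" and F: "F holomorphic_on S" and H: "H holomorphic_on S"
    and nz: "\<beta> \<in> S" "H \<beta> \<noteq> 0"
    and bnd: "\<And>t0. t0 \<in> S \<Longrightarrow> \<exists>e>0. \<exists>C. \<forall>t\<in>ball t0 e. cmod (F t) \<le> C * cmod (H t)"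
  shows "\<exists>G. G holomorphic_on S \<and> (\<forall>t\<in>S. F t = H t * G t)"
proof -
  \<comment> \<open>Taking the limit gives the value at zeros of H as well, so G agrees with every
    local extension and no gluing is left to do.\<close>
  define G where "G t = Lim (at t) (\<lambda>s. F s / H s)" for t
  have loc: "\<exists>r g. r > 0 \<and> ball t0 r \<subseteq> S \<and> g holomorphic_on ball t0 r \<and> (\<forall>t\<in>ball t0 r. G t = g t \<and> F t = H t * g t)"
    if t0: "t0 \<in> S" for t0
  proof -
    have "\<exists>r>0. ball t0 r \<subseteq> S \<and> (\<forall>t\<in>ball t0 r - {t0}. H t \<noteq> 0)"
    proof (cases "H t0 = 0")
      case True
      then show ?thesis using isolated_zeros[OF H S t0 True nz] by metis
    next
      case False
      have "continuous_on S H" using H by (rule holomorphic_on_imp_continuous_on)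
      then have "open (S \<inter> H -` (- {0}))" by (rule continuous_open_preimage[OF _ S(1)]) auto
      moreover have "t0 \<in> S \<inter> H -` (- {0})" using t0 False by simp
      ultimately obtain r where "r > 0" "ball t0 r \<subseteq> S \<inter> H -` (- {0})" using openE by blast
      then show ?thesis by (intro exI[of _ r]) auto
    qed
    then obtain r where r: "r > 0" "ball t0 r \<subseteq> S" "\<And>t. t \<in> ball t0 r - {t0} \<Longrightarrow> H t \<noteq> 0" by blast
    obtain e C where e: "e > 0" "\<And>t. t \<in> ball t0 e \<Longrightarrow> cmod (F t) \<le> C * cmod (H t)"
      using bnd[OF t0] by blast
    have holq: "(\<lambda>t. F t / H t) holomorphic_on ball t0 r - {t0}"
      using F H r by (intro holomorphic_intros) (auto intro: holomorphic_on_subset)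
    have "\<forall>\<^sub>F t in at t0. t \<in> ball t0 (min e r) - {t0}"
      using e(1) r(1) by (intro eventually_at_in_open) auto
    then have "\<forall>\<^sub>F t in at t0. cmod (F t / H t) \<le> C"
    proof eventually_elim
      case (elim t)
      then have "cmod (F t) \<le> C * cmod (H t)" "H t \<noteq> 0" using e(2) r(3) by auto
      then show ?case by (simp add: norm_divide divide_le_eq)
    qed
    then obtain g where g: "g holomorphic_on ball t0 r" "\<And>t. t \<in> ball t0 r - {t0} \<Longrightarrow> g t = F t / H t"
      using holomorphic_on_extend_bounded[OF holq] r(1) by auto
    have cg: "continuous_on (ball t0 r) g" using g(1) by (rule holomorphic_on_imp_continuous_on)
    have Gg: "G t = g t" if t: "t \<in> ball t0 r" for t
    proof -
      have "(g \<longlongrightarrow> g t) (at t)" using cg t by (simp add: continuous_on_eq_continuous_at isCont_def)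
      moreover have "\<forall>\<^sub>F s in at t. s \<in> ball t0 r - {t0}"
      proof -
        have "open (ball t0 r - ({t0} - {t}))" by (intro open_Diff finite_imp_closed) auto
        then have "\<forall>\<^sub>F s in at t. s \<in> (ball t0 r - ({t0} - {t})) - {t}" using t by (intro eventually_at_in_open) auto
        then show ?thesis by eventually_elim auto
      qed
      then have "\<forall>\<^sub>F s in at t. g s = F s / H s" by eventually_elim (rule g(2))
      ultimately have "((\<lambda>s. F s / H s) \<longlongrightarrow> g t) (at t)" by (simp cong: tendsto_cong)
      then show ?thesis unfolding G_def by (intro tendsto_Lim) auto
    qed
    have FH: "F t = H t * g t" if t: "t \<in> ball t0 r" for t
    proof (rule eq_off_finite[where S = "ball t0 r" and f = F and g = "\<lambda>t. H t * g t" and F = "{t0}", OF _ t])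
      have "t0 + of_real (r / 2) \<in> ball t0 r" "t0 \<in> ball t0 r" using r(1) by (auto simp: dist_norm)
      moreover have "t0 + of_real (r / 2) \<noteq> t0" using r(1) by simp
      ultimately show "ball t0 r \<noteq> {t}" by (metis singletonD)
      show "continuous_on (ball t0 r) F" "continuous_on (ball t0 r) (\<lambda>t. H t * g t)"
        using F H r(2) g(1)
        by (auto intro!: holomorphic_on_imp_continuous_on holomorphic_intros intro: holomorphic_on_subset)
      show "F y = H y * g y" if "y \<in> ball t0 r - {t0}" for y using g(2)[OF that] r(3)[OF that] by simp
    qed auto
    show ?thesis using r(1,2) g(1) Gg FH by blast
  qed
  have "G field_differentiable (at t)" if t: "t \<in> S" for t
  proof -
    obtain r g where rg: "r > 0" "g holomorphic_on ball t r" "\<And>s. s \<in> ball t r \<Longrightarrow> G s = g s"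
      using loc[OF t] by blast
    have "G holomorphic_on ball t r" by (rule holomorphic_transform[OF rg(2)]) (simp add: rg(3))
    then show ?thesis using rg(1) by (intro holomorphic_on_imp_differentiable_at) auto
  qed
  then have "G holomorphic_on S"
    unfolding holomorphic_on_def by (blast intro: field_differentiable_at_within)
  moreover have "F t = H t * G t" if t: "t \<in> S" for t
  proof -
    obtain r g where rg: "r > 0" "\<And>s. s \<in> ball t r \<Longrightarrow> G s = g s \<and> F s = H s * g s"
      using loc[OF t] by blast
    show ?thesis using rg(2)[of t] rg(1) by simp
  qed
  ultimately show ?thesis by blast
qed

lemma powser_eq_0:
  fixes c :: "nat \<Rightarrow> complex"
  assumes r: "r > 0" and sums: "\<And>t. cmod t < r \<Longrightarrow> (\<lambda>k. c k * t ^ k) sums 0"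
  shows "c m = 0"
proof (rule ccontr)
  assume m: "c m \<noteq> 0"
  have "c 0 = 0" using sums[of 0] r by (simp add: powser_sums_zero_iff)
  with m have "m > 0" by (cases m) auto
  show False
  proof (rule powser_0_nonzero[of r 0 c "\<lambda>_. 0" m])
    fix s :: real
    assume "0 < s" "\<And>z::complex. z \<in> cball 0 s - {0} \<Longrightarrow> (0::complex) \<noteq> 0"
    from this(2)[of "complex_of_real s"] this(1) show False by simp
  qed (use sums m \<open>m > 0\<close> r in auto)
qed

lemma powser_unique:
  fixes a b :: "nat \<Rightarrow> complex"
  assumes "r > 0" "\<And>t. cmod t < r \<Longrightarrow> (\<lambda>k. a k * t ^ k) sums h t" "\<And>t. cmod t < r \<Longrightarrow> (\<lambda>k. b k * t ^ k) sums h t"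
  shows "a k = b k"
proof -
  have "a k - b k = 0"
  proof (rule powser_eq_0[OF assms(1)])
    fix t assume t: "cmod t < r"
    show "(\<lambda>k. (a k - b k) * t ^ k) sums 0"
      using sums_diff[OF assms(2)[OF t] assms(3)[OF t]] by (simp add: left_diff_distrib)
  qed
  then show ?thesis by simp
qed

lemma powser_abs_summable:
  fixes a :: "nat \<Rightarrow> complex"
  assumes "\<And>t. cmod t < r \<Longrightarrow> summable (\<lambda>k. a k * t ^ k)" "cmod t < r"
  shows "summable (\<lambda>k. cmod (a k * t ^ k))"
proof -
  obtain s where s: "cmod t < s" "s < r" using assms(2) dense by blast
  have "cmod (of_real s) < r" using s norm_ge_zero[of t] by (simp del: norm_ge_zero)
  from powser_insidea[OF assms(1)[OF this]] show ?thesis using s norm_ge_zero[of t] by (simp del: norm_ge_zero)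
qed

text \<open>The Taylor coefficients of the holomorphic quotient solve the Cauchy product equations,
  by uniqueness of coefficients. Holomorphy and a point where H is nonzero are passed on for the
  estimate that follows.\<close>

lemma powser_division:
  fixes x y :: "nat \<Rightarrow> complex"
  assumes r: "r > 0" and X: "\<And>t. cmod t < r \<Longrightarrow> (\<lambda>k. x k * t ^ k) sums H t"
    and Y: "\<And>t. cmod t < r \<Longrightarrow> (\<lambda>k. y k * t ^ k) sums F t" and nz: "x m \<noteq> 0"
    and bnd: "\<And>t0. cmod t0 < r \<Longrightarrow> \<exists>e>0. \<exists>C. \<forall>t\<in>ball t0 e. cmod (F t) \<le> C * cmod (H t)"
  shows "\<exists>\<gamma> G. G holomorphic_on ball 0 r \<and> (\<forall>t. cmod t < r \<longrightarrow> (\<lambda>k. \<gamma> k * t ^ k) sums G t \<and> F t = H t * G t) \<and>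
           (\<forall>k. y k = (\<Sum>j\<le>k. x j * \<gamma> (k - j))) \<and> (\<forall>k. \<gamma> k = (deriv ^^ k) G 0 / fact k) \<and> (\<exists>\<beta>\<in>ball 0 r. H \<beta> \<noteq> 0) \<and> H holomorphic_on ball 0 r"
proof -
  have H: "H holomorphic_on ball 0 r" by (rule power_series_holomorphic[of 0 r x]) (use X in simp)
  have F: "F holomorphic_on ball 0 r" by (rule power_series_holomorphic[of 0 r y]) (use Y in simp)
  have "\<exists>\<beta>. cmod \<beta> < r \<and> H \<beta> \<noteq> 0"
  proof (rule ccontr)
    assume "\<not> ?thesis"
    then have "x m = 0" using X by (intro powser_eq_0[OF r]) metis
    then show False using nz by simp
  qed
  then obtain \<beta> where \<beta>: "\<beta> \<in> ball 0 r" "H \<beta> \<noteq> 0" by auto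
  obtain G where G: "G holomorphic_on ball 0 r" "\<And>t. t \<in> ball 0 r \<Longrightarrow> F t = H t * G t"
    using holomorphic_division[OF open_ball connected_ball F H \<beta>] bnd by auto
  define \<gamma> where "\<gamma> k = (deriv ^^ k) G 0 / fact k" for k
  have \<gamma>: "(\<lambda>k. \<gamma> k * t ^ k) sums G t" if "cmod t < r" for t
    using holomorphic_power_series[OF G(1), of t] that by (simp add: \<gamma>_def)
  have "y k = (\<Sum>j\<le>k. x j * \<gamma> (k - j))" for k
  proof (rule powser_unique[OF r Y])
    fix t assume t: "cmod t < r"
    have "(\<lambda>k. \<Sum>j\<le>k. (x j * t ^ j) * (\<gamma> (k - j) * t ^ (k - j))) sums ((\<Sum>k. x k * t ^ k) * (\<Sum>k. \<gamma> k * t ^ k))"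
      by (intro Cauchy_product_sums powser_abs_summable[OF sums_summable[OF X] t] powser_abs_summable[OF sums_summable[OF \<gamma>] t])
    moreover have "(\<Sum>j\<le>k. (x j * t ^ j) * (\<gamma> (k - j) * t ^ (k - j))) = (\<Sum>j\<le>k. x j * \<gamma> (k - j)) * t ^ k" for k
      unfolding sum_distrib_right
    proof (rule sum.cong)
      fix j assume "j \<in> {..k}"
      then have "t ^ k = t ^ j * t ^ (k - j)" by (simp flip: power_add)
      then show "(x j * t ^ j) * (\<gamma> (k - j) * t ^ (k - j)) = x j * \<gamma> (k - j) * t ^ k" by simp
    qed simp
    moreover have "(\<Sum>k. x k * t ^ k) * (\<Sum>k. \<gamma> k * t ^ k) = F t"
      using sums_unique[OF X[OF t]] sums_unique[OF \<gamma>[OF t]] G(2)[of t] t by simp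
    ultimately show "(\<lambda>k. (\<Sum>j\<le>k. x j * \<gamma> (k - j)) * t ^ k) sums F t" by simp
  qed
  then show ?thesis using G \<gamma> \<beta> H by (intro exI[of _ \<gamma>] exI[of _ G]) (auto simp: \<gamma>_def)
qed

text \<open>The bound on F / H extends by continuity to the isolated zeros of H, and Cauchy's
  inequality then bounds the coefficients.\<close>

lemma powser_division_bounded:
  fixes x y :: "nat \<Rightarrow> complex"
  assumes r: "r > 0" and X: "\<And>t. cmod t < r \<Longrightarrow> (\<lambda>k. x k * t ^ k) sums H t"
    and Y: "\<And>t. cmod t < r \<Longrightarrow> (\<lambda>k. y k * t ^ k) sums F t" and nz: "x m \<noteq> 0"
    and bnd: "\<And>t. cmod t < r \<Longrightarrow> cmod (F t) \<le> C * cmod (H t)"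
  shows "\<exists>\<gamma>. (\<forall>k. y k = (\<Sum>j\<le>k. x j * \<gamma> (k - j))) \<and> (\<forall>k. cmod (\<gamma> k) \<le> C * (2 / r) ^ k)"
proof -
  have "\<exists>e>0. \<exists>C. \<forall>t\<in>ball t0 e. cmod (F t) \<le> C * cmod (H t)" if "cmod t0 < r" for t0
  proof -
    have "cmod (F t) \<le> C * cmod (H t)" if "t \<in> ball t0 (r - cmod t0)" for t
      by (rule bnd) (use that norm_triangle_sub[of t t0] in \<open>simp add: dist_norm norm_minus_commute\<close>)
    then show ?thesis using that by (intro exI[of _ "r - cmod t0"] conjI exI[of _ C] ballI) simp_all
  qed
  from powser_division[OF r X Y nz this]
  obtain \<gamma> G \<beta> where G: "G holomorphic_on ball 0 r" "\<And>t. cmod t < r \<Longrightarrow> F t = H t * G t"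
    and \<gamma>: "\<forall>k. y k = (\<Sum>j\<le>k. x j * \<gamma> (k - j))" "\<And>k. \<gamma> k = (deriv ^^ k) G 0 / fact k"
    and \<beta>: "\<beta> \<in> ball 0 r" "H \<beta> \<noteq> 0" "H holomorphic_on ball 0 r" by blast
  have cG: "continuous_on (ball 0 r) G" using G(1) by (rule holomorphic_on_imp_continuous_on)
  have Gle: "cmod (G t) \<le> C" if t: "cmod t < r" for t
  proof (cases "H t = 0")
    case False
    then show ?thesis using bnd[OF t] by (simp add: G(2)[OF t] norm_mult mult.commute)
  next
    case True
    obtain \<rho> where \<rho>: "\<rho> > 0" "ball t \<rho> \<subseteq> ball 0 r" "\<And>s. s \<in> ball t \<rho> - {t} \<Longrightarrow> H s \<noteq> 0"
      using isolated_zeros[OF \<beta>(3) open_ball connected_ball _ True \<beta>(1,2)] t by auto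
    have "\<forall>\<^sub>F s in at t. s \<in> ball t \<rho> - {t}" using \<rho>(1) by (intro eventually_at_in_open) auto
    then have "\<forall>\<^sub>F s in at t. cmod (G s) \<le> C"
    proof eventually_elim
      case (elim s)
      then have s: "cmod s < r" "H s \<noteq> 0" using \<rho>(2,3) by auto
      then show ?case using bnd[OF s(1)] by (simp add: G(2)[OF s(1)] norm_mult mult.commute)
    qed
    moreover have lim: "((\<lambda>s. cmod (G s)) \<longlongrightarrow> cmod (G t)) (at t)"
      using cG t by (intro tendsto_norm) (simp add: continuous_on_eq_continuous_at isCont_def)
    ultimately show ?thesis by (intro tendsto_upperbound[OF lim]) auto
  qed
  have "cmod (\<gamma> k) \<le> C * (2 / r) ^ k" for k
  proof -
    \<comment> \<open>Radius r / 2 keeps the closed disk inside the domain of G; hence the factor 2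
      / r.\<close>
    have "cmod ((deriv ^^ k) G 0) \<le> fact k * C / (r / 2) ^ k"
    proof (rule Cauchy_inequality)
      show "G holomorphic_on ball 0 (r / 2)" using G(1) r by (rule_tac holomorphic_on_subset) auto
      show "continuous_on (cball 0 (r / 2)) G" using cG r by (rule_tac continuous_on_subset) auto
      show "cmod (G t) \<le> C" if "cmod (0 - t) = r / 2" for t using Gle[of t] that r by simp
    qed (use r in simp)
    then show ?thesis unfolding \<gamma>(2) by (simp add: norm_divide field_simps power_divide)
  qed
  then show ?thesis using \<gamma>(1) by blast
qed

lemma poly_eq_off_finite:
  fixes p q :: "complex poly"
  assumes "finite Z" "\<And>w. w \<notin> Z \<Longrightarrow> poly p w = poly q w"
  shows "p = q"
proof (rule ccontr)
  assume "p \<noteq> q"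
  then have "finite {w. poly (p - q) w = 0}" by (intro poly_roots_finite) simp
  moreover have "UNIV = Z \<union> {w. poly (p - q) w = 0}" using assms(2) by auto
  ultimately have "finite (UNIV :: complex set)" using assms(1) by (metis finite_Un)
  then show False using infinite_UNIV_char_0 by blast
qed

text \<open>Each root a of D is a root of Y, and w - a can be cancelled. Away from a the bound
  survives at once; at a it survives since it can only fail on an open set, which contains points
  other than a.\<close>

lemma poly_dvd_of_bound:
  fixes D Y :: "complex poly"
  assumes "D \<noteq> 0" "continuous_on UNIV B" "\<And>w. cmod (poly Y w) \<le> B w * cmod (poly D w)"
  shows "D dvd Y"
  using assms(1,3)
proof (induction "degree D" arbitrary: D Y)
  case 0
  then obtain c where "D = [:c:]" "c \<noteq> 0" by (metis degree_eq_zeroE pCons_0_0)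
  then show ?case by (simp add: const_poly_dvd_iff dvd_field_iff)
next
  case (Suc n)
  obtain a where a: "poly D a = 0"
    using fundamental_theorem_of_algebra[of D] Suc.hyps(2) by (auto simp: constant_degree)
  then have "poly Y a = 0" using Suc.prems(2)[of a] by simp
  with a obtain D1 Y1 where DY: "D = [:-a, 1:] * D1" "Y = [:-a, 1:] * Y1"
    unfolding poly_eq_0_iff_dvd dvd_def by blast
  have D1: "D1 \<noteq> 0" using DY(1) Suc.prems(1) by auto
  have "n = degree D1" using Suc.hyps(2) D1 unfolding DY(1) by (subst (asm) degree_mult_eq) auto
  moreover have "cmod (poly Y1 w) \<le> B w * cmod (poly D1 w)" for w
  proof (rule ccontr)
    assume "\<not> cmod (poly Y1 w) \<le> B w * cmod (poly D1 w)"
    then have w: "w \<in> {w. B w * cmod (poly D1 w) < cmod (poly Y1 w)}" by simp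
    have "open {w. B w * cmod (poly D1 w) < cmod (poly Y1 w)}"
      by (intro open_Collect_less continuous_intros assms(2))
    then obtain e where e: "e > 0" "ball w e \<subseteq> {w. B w * cmod (poly D1 w) < cmod (poly Y1 w)}" using w openE by blast
    have "\<exists>u\<in>ball w e. u \<noteq> a"
    proof -
      have "w + of_real (e / 2) \<in> ball w e" "w \<in> ball w e" using e(1) by (auto simp: dist_norm)
      moreover have "w + of_real (e / 2) \<noteq> w" using e(1) by simp
      ultimately show ?thesis by metis
    qed
    then obtain u where u: "u \<in> ball w e" "u \<noteq> a" by blast
    have "cmod (u - a) * cmod (poly Y1 u) \<le> cmod (u - a) * (B u * cmod (poly D1 u))"
      using Suc.prems(2)[of u] by (simp add: DY norm_mult mult_ac flip: left_diff_distrib)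
    then have "cmod (poly Y1 u) \<le> B u * cmod (poly D1 u)" using u(2) by simp
    then show False using e(2) u(1) by auto
  qed
  ultimately have "D1 dvd Y1" using Suc.hyps(1) D1 by blast
  then show ?case unfolding DY by (rule mult_dvd_mono[OF dvd_refl])
qed

text \<open>Along the positive integers, which eventually avoid Z, X(w) / w^(degree X) tends to the
  leading coefficient; were the degree above k, it would also tend to 0.\<close>

lemma degree_le_of_growth:
  fixes X :: "complex poly"
  assumes "\<And>w. w \<notin> Z \<Longrightarrow> cmod (poly X w) \<le> C * (max 1 (cmod w)) ^ k" "finite Z"
  shows "degree X \<le> k"
proof (rule ccontr)
  assume "\<not> degree X \<le> k"
  then have k: "k < degree X" by simp
  define u where "u n = complex_of_real (real (Suc n))" for n
  have uinj: "inj u" by (auto simp: u_def inj_def)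
  have lim: "((\<lambda>w. poly X w / w ^ degree X) \<longlongrightarrow> lead_coeff X) at_infinity"
    by (rule poly_divide_tendsto_aux)
  have uinf: "filterlim u at_infinity sequentially"
    unfolding u_def of_real_of_nat_eq by (rule filterlim_compose[OF tendsto_of_nat filterlim_Suc])
  have "(\<lambda>n. poly X (u n) / u n ^ degree X) \<longlonglongrightarrow> lead_coeff X" by (rule filterlim_compose[OF lim uinf])
  moreover have "(\<lambda>n. poly X (u n) / u n ^ degree X) \<longlonglongrightarrow> 0"
  proof (rule Lim_null_comparison)
    have "finite {n. u n \<in> Z}" using finite_vimageI[OF assms(2) uinj] by (simp add: vimage_def)
    then have "\<forall>\<^sub>F n in sequentially. u n \<notin> Z" by (simp add: eventually_cofinite flip: cofinite_eq_sequentially)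
    then show "\<forall>\<^sub>F n in sequentially. cmod (poly X (u n) / u n ^ degree X) \<le> \<bar>C\<bar> / real (Suc n)"
    proof eventually_elim
      case (elim n)
      have un: "cmod (u n) = real (Suc n)" by (simp only: u_def norm_of_real abs_of_nat)
      have "cmod (poly X (u n)) \<le> \<bar>C\<bar> * real (Suc n) ^ k"
        using assms(1)[OF elim] unfolding un by (rule order.trans) (auto intro!: mult_right_mono simp: max_def)
      also have "\<dots> \<le> \<bar>C\<bar> * real (Suc n) ^ (degree X - 1)"
        using k by (intro mult_left_mono power_increasing) auto
      finally have "cmod (poly X (u n)) / real (Suc n) ^ degree X \<le> \<bar>C\<bar> * real (Suc n) ^ (degree X - 1) / real (Suc n) ^ degree X"
        by (rule divide_right_mono) simp
      also have "real (Suc n) ^ degree X = real (Suc n) * real (Suc n) ^ (degree X - 1)"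
        using k by (cases "degree X") auto
      also have "\<bar>C\<bar> * real (Suc n) ^ (degree X - 1) / (real (Suc n) * real (Suc n) ^ (degree X - 1)) = \<bar>C\<bar> / real (Suc n)"
        by simp
      finally show ?case unfolding norm_divide norm_power un using k by (cases "degree X") (auto simp: mult_ac)
    qed
    have "(\<lambda>n. \<bar>C\<bar> * inverse (real (Suc n))) \<longlonglongrightarrow> \<bar>C\<bar> * 0"
      by (intro tendsto_mult_left LIMSEQ_inverse_real_of_nat)
    then show "(\<lambda>n. \<bar>C\<bar> / real (Suc n)) \<longlonglongrightarrow> 0" by (simp add: field_simps)
  qed
  ultimately have "lead_coeff X = 0" using LIMSEQ_unique by blast
  then show False using k by simp
qed

section \<open>Density of the eigenvectors\<close>

lemma infinite_disk: "infinite unit_disk"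
proof
  assume "finite unit_disk"
  then have "unit_disk = {}"
    using connected_finite_iff_sing[OF connected_disk(1)] connected_disk(2) by blast
  then show False by simp
qed

text \<open>\<open>circle\<close> keeps the fibers of p from sharing a zero on the circle;
  \<open>fiber_nonzero\<close> is the form in which the absence of inner factors in z is
  used.\<close>

locale reduced_rational_rep = rational_rep +
  assumes circle: "cmod \<tau> = 1 \<Longrightarrow> \<exists>z. poly2 p z \<tau> \<noteq> 0"
    and fiber_nonzero: "c \<in> unit_disk \<Longrightarrow> \<exists>w\<in>unit_disk. heval \<theta> c w \<noteq> 0"
begin

lemma fiber_structure:
  assumes c: "c \<in> unit_disk"
  shows "\<exists>as bs ds \<kappa>. fiber_factorization (heval \<theta> c) as bs ds \<kappa>"
  using fiber_factorization_of_nonzero[OF c] fiber_nonzero[OF c] by blast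

text \<open>The fraction is p(c, _) / q(c, _) itself, so the zeros outside the disk are zeros of
  p(c, _) and avoid the circle by assumption.\<close>

lemma good_fiber_structure:
  assumes c: "c \<in> unit_disk" and good: "\<And>\<tau>. cmod \<tau> = 1 \<Longrightarrow> poly2 p c \<tau> \<noteq> 0"
  shows "\<exists>as bs ds \<kappa>. fiber_factorization (heval \<theta> c) as bs ds \<kappa> \<and> (\<forall>b\<in>set bs. cmod b \<noteq> 1)"
proof -
  let ?e = "\<lambda>r. map_poly (\<lambda>a. poly a c) r"
  have ev: "poly (?e r) w = poly2 r c w" for r w by (simp add: poly2_map_poly)
  have PQ: "heval \<theta> c w * poly (?e q) w = poly (?e p) w" if "w \<in> unit_disk" for w
    using rep[OF c that] by (simp add: ev)
  have "?e q \<noteq> 0"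
  proof
    assume "?e q = 0"
    then have "unit_disk \<subseteq> {w. poly (?e p) w = 0}" using PQ by auto
    then have "infinite {w. poly (?e p) w = 0}" using infinite_disk finite_subset by blast
    then have "?e p = 0" using poly_roots_finite by blast
    then have "poly2 p c 1 = 0" by (metis ev poly_0)
    then show False using good[of 1] by simp
  qed
  moreover have "continuous_on unit_disk (heval \<theta> c)"
    by (rule continuous_heval_comp) (use c in auto)
  moreover obtain w0 where "w0 \<in> unit_disk" "heval \<theta> c w0 \<noteq> 0" using fiber_nonzero[OF c] by blast
  ultimately obtain as bs ds \<kappa> where F: "fiber_factorization (heval \<theta> c) as bs ds \<kappa>" "\<forall>b\<in>set bs. poly (?e p) b = 0"
    using fiber_factorization_exists[OF _ _ PQ] by blast
  have "cmod b \<noteq> 1" if "b \<in> set bs" for b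
    using F(2) that good[of b] by (auto simp: ev)
  then show ?thesis using F(1) by blast
qed

text \<open>Chosen to be the number of zeros of the fiber and the dimension of the kernel at once,
  so that each can be read off from the other.\<close>

definition zero_number :: "complex \<Rightarrow> nat" where
  "zero_number c = (SOME n. has_zero_count (heval \<theta> c) unit_disk n \<and> has_cdim (N c) n)"

lemma zero_number:
  assumes c: "c \<in> unit_disk"
  shows "has_zero_count (heval \<theta> c) unit_disk (zero_number c)" "has_cdim (N c) (zero_number c)"
proof -
  obtain as bs ds \<kappa> where F: "fiber_factorization (heval \<theta> c) as bs ds \<kappa>" using fiber_structure[OF c] by blast
  have "set as \<subseteq> unit_disk" using F by (simp add: fiber_factorization_def)
  then have "has_cdim (N c) (length as)"
    unfolding N_eq kernel_eq[OF c F] by (rule has_cdim_fold_Bw[OF c])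
  then have "\<exists>n. has_zero_count (heval \<theta> c) unit_disk n \<and> has_cdim (N c) n"
    using zero_count_of_factorization[OF F] by blast
  from someI_ex[OF this] show "has_zero_count (heval \<theta> c) unit_disk (zero_number c)" "has_cdim (N c) (zero_number c)"
    by (simp_all add: zero_number_def)
qed

lemma injective_T:
  assumes "c \<in> unit_disk" "x \<in> K" "T c x = 0"
  shows "x = 0"
proof -
  obtain w0 where "w0 \<in> unit_disk" "heval \<theta> c w0 \<noteq> 0" using fiber_nonzero[OF assms(1)] by blast
  from injective_inside_disk[OF assms(1) this assms(2,3)] show ?thesis .
qed

context
  fixes f :: hardy2
  assumes orth: "\<And>c v. c \<in> \<Omega> \<Longrightarrow> v \<in> N c \<Longrightarrow> cinner f v = 0"
begin

text \<open>Here T c is bounded below, hence Fredholm. Either c lies in \<Omega> and f is orthogonal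
  to N c by assumption, or T c is invertible and N c is trivial. In both cases f is divisible by the
  zeros of the fiber.\<close>

lemma good_fiber_quotient:
  assumes c: "c \<in> unit_disk" and good: "\<And>\<tau>. cmod \<tau> = 1 \<Longrightarrow> poly2 p c \<tau> \<noteq> 0"
  shows "\<exists>g. g holomorphic_on unit_disk \<and> (\<forall>w\<in>unit_disk. heval f c w = heval \<theta> c w * g w)"
proof -
  obtain as bs ds \<kappa> where F: "fiber_factorization (heval \<theta> c) as bs ds \<kappa>" "\<And>b. b \<in> set bs \<Longrightarrow> cmod b \<noteq> 1"
    using good_fiber_structure[OF c good] by blast
  have "\<exists>C>0. \<forall>x\<in>K. C * norm x \<le> norm (T c x)" by (rule bounded_below_inside_disk[OF c F])
  then obtain C where C: "C > 0" "\<forall>x\<in>K. C * norm x \<le> norm (T c x)" by blast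
  have fred: "fredholm_on K (T c)"
    by (rule fredholm_of_bounded_below[OF C(1) bspec[OF C(2)] zero_number(2)[OF c]])
  have "cinner f v = 0" if v: "v \<in> back_eigenspace c" "fold Bw as v = 0" for v
  proof -
    have "v \<in> N c" unfolding N_eq kernel_eq[OF c F(1)] using v by simp
    show ?thesis
    proof (cases "invertible_on K (T c)")
      case True
      then have "v = 0" using kernel_of_invertible[OF True] \<open>v \<in> N c\<close> by blast
      then show ?thesis by simp
    next
      case False
      then have "c \<in> \<Omega>" using fred unfolding \<Omega>_iff by blast
      then show ?thesis using orth \<open>v \<in> N c\<close> by blast
    qed
  qed
  moreover have "set as \<subseteq> unit_disk" using F(1) by (simp add: fiber_factorization_def)
  ultimately obtain x y where xy: "f = foldr Aw as x + Az c y"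
    using orthogonal_fiber_division[OF c] by blast
  obtain s where s: "s holomorphic_on unit_disk" "\<And>w. w \<in> unit_disk \<Longrightarrow> s w \<noteq> 0 \<and> heval \<theta> c w = (\<Prod>a\<leftarrow>as. w - a) * s w"
    using fiber_factorization_quotient[OF F(1)] by blast
  have "(\<lambda>w. heval x c w / s w) holomorphic_on unit_disk"
    using holomorphic_heval_w[OF c, of x] s by (intro holomorphic_intros) auto
  moreover have "heval f c w = heval \<theta> c w * (heval x c w / s w)" if w: "w \<in> unit_disk" for w
    using s(2)[OF w] unfolding xy heval_linear[OF c w] heval_foldr_Aw[OF c w] heval_Az[OF c w] by simp
  ultimately show ?thesis by (intro exI[of _ "\<lambda>w. heval x c w / s w"]) blast
qed

text \<open>Over good \<open>z\<close> the quotient \<open>f (z, _) / \<theta> (z, _)\<close> is holomorphic, so the maximum principle bounds it by its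
  values on a circle where \<open>\<theta> (c, _)\<close> does not vanish; good \<open>z\<close> are dense.\<close>

lemma locally_bounded_quotient:
  assumes c: "c \<in> unit_disk" and a: "a \<in> unit_disk"
  shows "\<exists>e>0. \<exists>C. \<forall>z\<in>ball c e. \<forall>w\<in>ball a e. z \<in> unit_disk \<and> w \<in> unit_disk \<and> cmod (heval f z w) \<le> C * cmod (heval \<theta> z w)"
proof -
  obtain as bs ds \<kappa> where F: "fiber_factorization (heval \<theta> c) as bs ds \<kappa>" using fiber_structure[OF c] by blast
  obtain s where s: "\<And>w. w \<in> unit_disk \<Longrightarrow> s w \<noteq> 0 \<and> heval \<theta> c w = (\<Prod>a\<leftarrow>as. w - a) * s w"
    using fiber_factorization_quotient[OF F] by blast
  have zeros: "heval \<theta> c w \<noteq> 0" if "w \<in> unit_disk" "w \<notin> set as" for w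
    using s[OF that(1)] that(2) by (auto simp: prod_list_zero_iff)
  \<comment> \<open>Only finitely many radii are excluded, so some circle about a inside the disk
    misses all zeros of the fiber.\<close>
  have "infinite ({0<..<1 - cmod a} - (\<lambda>b. dist a b) ` set as)"
    by (intro Diff_infinite_finite infinite_Ioo) (use a in auto)
  then obtain \<rho> where \<rho>: "0 < \<rho>" "\<rho> < 1 - cmod a" "\<rho> \<notin> (\<lambda>b. dist a b) ` set as"
    by (metis (no_types, lifting) DiffE all_not_in_conv finite.emptyI greaterThanLessThan_iff)
  have cb: "w \<in> unit_disk" if "w \<in> cball a \<rho>" for w
    using that \<rho>(2) norm_triangle_sub[of w a] by (simp add: dist_norm norm_minus_commute)
  define e1 where "e1 = (1 - cmod c) / 2"
  have e1: "e1 > 0" using c by (simp add: e1_def)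
  have ce: "z \<in> unit_disk" if "z \<in> cball c e1" for z
  proof -
    have "cmod z \<le> cmod c + e1" using that norm_triangle_sub[of z c] by (simp add: dist_norm norm_minus_commute)
    moreover have "cmod c < 1" using c by simp
    ultimately have "cmod z < 1" unfolding e1_def by argo
    then show ?thesis by simp
  qed
  define X where "X = cball c e1 \<times> sphere a \<rho>"
  have cX: "compact X" unfolding X_def by (intro compact_Times) auto
  have XD: "X \<subseteq> unit_disk \<times> unit_disk" unfolding X_def using ce cb by auto
  have cont: "continuous_on X (\<lambda>(z, w). heval h z w)" for h
    by (rule continuous_on_subset[OF continuous_heval XD])
  have "sphere a \<rho> \<noteq> {}" using \<rho>(1) by simp
  have "continuous_on (sphere a \<rho>) (\<lambda>w. cmod (heval \<theta> c w))"
    by (intro continuous_on_norm continuous_heval_comp continuous_intros) (use c cb in auto)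
  then obtain w1 where w1: "w1 \<in> sphere a \<rho>" "\<And>w. w \<in> sphere a \<rho> \<Longrightarrow> cmod (heval \<theta> c w1) \<le> cmod (heval \<theta> c w)"
    using continuous_attains_inf[OF compact_sphere \<open>sphere a \<rho> \<noteq> {}\<close>] by blast
  \<comment> \<open>Half the minimum over the circle at z = c leaves room for moving z.\<close>
  define m where "m = cmod (heval \<theta> c w1) / 2"
  have "w1 \<notin> set as" using w1(1) \<rho>(3) by auto
  then have m: "m > 0" using zeros[of w1] cb[of w1] w1(1) by (simp add: m_def)
  have "uniformly_continuous_on X (\<lambda>(z, w). heval \<theta> z w)" by (rule compact_uniformly_continuous[OF cont cX])
  then obtain d where d: "d > 0" "\<And>x y. x \<in> X \<Longrightarrow> y \<in> X \<Longrightarrow> dist y x < d \<Longrightarrow> dist ((\<lambda>(z, w). heval \<theta> z w) y) ((\<lambda>(z, w). heval \<theta> z w) x) < m"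
    unfolding uniformly_continuous_on_def using m by metis
  have "bounded ((\<lambda>(z, w). heval f z w) ` X)" by (intro compact_imp_bounded compact_continuous_image cont cX)
  then obtain B where B: "\<And>z w. (z, w) \<in> X \<Longrightarrow> cmod (heval f z w) \<le> B"
    unfolding bounded_iff by force
  define e where "e = min (min e1 d) \<rho>"
  have e: "e > 0" "e \<le> e1" "e \<le> d" "e \<le> \<rho>" using e1 d(1) \<rho>(1) by (auto simp: e_def)
  have low: "m \<le> cmod (heval \<theta> z w)" if z: "z \<in> ball c e" and w: "w \<in> sphere a \<rho>" for z w
  proof -
    have "(z, w) \<in> X" "(c, w) \<in> X" using z w e e1 by (auto simp: X_def)
    moreover have "dist (c, w) (z, w) < d" using z e(3) by (simp add: dist_Pair_Pair)
    ultimately have "dist (heval \<theta> c w) (heval \<theta> z w) < m" using d(2) by force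
    moreover have "2 * m \<le> cmod (heval \<theta> c w)" using w1(2)[OF w] by (simp add: m_def)
    moreover have "cmod (heval \<theta> c w) - cmod (heval \<theta> z w) \<le> dist (heval \<theta> c w) (heval \<theta> z w)"
      unfolding dist_norm by (rule norm_triangle_ineq2)
    ultimately show ?thesis by linarith
  qed
  define C where "C = B / m"
  have good: "cmod (heval f z w) \<le> C * cmod (heval \<theta> z w)"
    if z: "z \<in> ball c e" and gz: "\<And>\<tau>. cmod \<tau> = 1 \<Longrightarrow> poly2 p z \<tau> \<noteq> 0" and w: "w \<in> cball a \<rho>" for z w
  proof -
    have zD: "z \<in> unit_disk" using z e(2) by (intro ce) auto
    obtain g where g: "g holomorphic_on unit_disk" "\<And>w. w \<in> unit_disk \<Longrightarrow> heval f z w = heval \<theta> z w * g w"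
      using good_fiber_quotient[OF zD gz] by blast
    have "cmod (g w) \<le> C"
    proof (rule maximum_modulus_frontier[where S = "cball a \<rho>" and f = g and \<xi> = w])
      have sub: "cball a \<rho> \<subseteq> unit_disk" using cb by blast
      show "g holomorphic_on interior (cball a \<rho>)"
        by (rule holomorphic_on_subset[OF g(1)]) (use sub interior_subset[of "cball a \<rho>"] in blast)
      show "continuous_on (closure (cball a \<rho>)) g"
        by (rule continuous_on_subset[OF holomorphic_on_imp_continuous_on[OF g(1)]]) (use sub in simp)
      fix u assume "u \<in> frontier (cball a \<rho>)"
      then have u: "u \<in> sphere a \<rho>" using \<rho>(1) by simp
      have uD: "u \<in> unit_disk" using u cb by auto
      have "m * cmod (g u) \<le> cmod (heval \<theta> z u) * cmod (g u)" using low[OF z u] by (rule mult_right_mono) simp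
      also have "\<dots> = cmod (heval f z u)" by (simp add: g(2)[OF uD] norm_mult)
      also have "\<dots> \<le> B" using z u e by (intro B) (auto simp: X_def)
      finally show "cmod (g u) \<le> C" using m by (simp add: C_def field_simps)
    qed (use w in auto)
    then show ?thesis using g(2)[OF cb[OF w]] by (simp add: norm_mult mult.commute[of "cmod (heval _ _ _)"] mult_right_mono)
  qed
  \<comment> \<open>A violation would persist for all nearby z, among them good ones.\<close>
  have main: "cmod (heval f z w) \<le> C * cmod (heval \<theta> z w)" if z: "z \<in> ball c e" and w: "w \<in> ball a e" for z w
  proof (rule ccontr)
    assume neg: "\<not> ?thesis"
    have w': "w \<in> cball a \<rho>" using w e(4) by auto
    have wD: "w \<in> unit_disk" using cb[OF w'] .
    have bD: "ball c e \<subseteq> unit_disk" using ce e(2) by auto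
    define h where "h z = cmod (heval f z w) - C * cmod (heval \<theta> z w)" for z
    have "continuous_on (ball c e) h"
      unfolding h_def by (intro continuous_intros continuous_heval_comp) (use bD wD in auto)
    then have "open (ball c e \<inter> h -` {0<..})" by (rule continuous_open_preimage) auto
    moreover have "z \<in> ball c e \<inter> h -` {0<..}" using z neg by (simp add: h_def)
    ultimately obtain r where r: "r > 0" "ball z r \<subseteq> ball c e \<inter> h -` {0<..}" using openE by blast
    obtain z' where z': "z' \<in> ball z r" "\<forall>\<tau>. cmod \<tau> = 1 \<longrightarrow> poly2 p z' \<tau> \<noteq> 0"
      using zero_free_fibers_dense[OF circle r(1), of z] by blast
    then have "z' \<in> ball c e" "h z' > 0" using r(2) by auto
    then show False using good[of z' w] z'(2) w' by (simp add: h_def)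
  qed
  have "z \<in> unit_disk \<and> w \<in> unit_disk" if "z \<in> ball c e" "w \<in> ball a e" for z w
    using that e ce cb by auto
  then show ?thesis using main e(1) by blast
qed

lemma slice_bound:
  assumes "t0 \<in> unit_disk" "t0 * \<omega> \<in> unit_disk"
  shows "\<exists>e>0. \<exists>C. \<forall>t\<in>ball t0 e. cmod (heval f t (t * \<omega>)) \<le> C * cmod (heval \<theta> t (t * \<omega>))"
proof -
  obtain e C where e: "e > 0" "\<And>z w. z \<in> ball t0 e \<Longrightarrow> w \<in> ball (t0 * \<omega>) e \<Longrightarrow> cmod (heval f z w) \<le> C * cmod (heval \<theta> z w)"
    using locally_bounded_quotient[OF assms] by blast
  \<comment> \<open>Keeps both t and t \<omega> within e of their centres.\<close>
  define d where "d = e / (1 + cmod \<omega>)"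
  have pos: "1 + cmod \<omega> > 0" by (rule add_pos_nonneg) auto
  have d: "d > 0" "d \<le> e" "d * cmod \<omega> < e"
    using e(1) pos by (auto simp: d_def field_simps intro: add_pos_nonneg mult_nonneg_nonneg)
  have "cmod (heval f t (t * \<omega>)) \<le> C * cmod (heval \<theta> t (t * \<omega>))" if t: "t \<in> ball t0 d" for t
  proof (rule e(2))
    show "t \<in> ball t0 e" using t d(2) by auto
    have "dist (t0 * \<omega>) (t * \<omega>) = dist t0 t * cmod \<omega>" by (simp add: dist_norm norm_mult flip: left_diff_distrib)
    also have "\<dots> \<le> d * cmod \<omega>" using t by (intro mult_right_mono) auto
    finally show "t * \<omega> \<in> ball (t0 * \<omega>) e" using d(3) by simp
  qed
  then show ?thesis using d(1) by blast
qed

text \<open>The homogeneous components of \<open>f / \<theta>\<close>, a priori rational functions of \<open>\<omega>\<close> with denominators powers of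
  the lowest component of \<open>\<theta>\<close>, are polynomials because \<open>f / \<theta>\<close> is bounded near the origin.\<close>

lemma quotient_components:
  assumes l: "hpoly \<theta> l \<noteq> 0" "\<And>j. j < l \<Longrightarrow> hpoly \<theta> j = 0"
  shows "\<exists>c. (\<forall>k. degree (c k) \<le> k) \<and> (\<forall>k. hpoly f k = (\<Sum>j\<le>k. hpoly \<theta> j * c (k - j)))"
proof -
  let ?f = "\<lambda>k \<omega>. poly (hpoly f k) \<omega>" and ?h = "\<lambda>k \<omega>. poly (hpoly \<theta> k) \<omega>"
  obtain e C where e: "e > 0" "\<And>z w. z \<in> ball 0 e \<Longrightarrow> w \<in> ball 0 e \<Longrightarrow> z \<in> unit_disk \<and> w \<in> unit_disk \<and> cmod (heval f z w) \<le> C * cmod (heval \<theta> z w)"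
  proof -
    have "(0 :: complex) \<in> unit_disk" by simp
    from locally_bounded_quotient[OF this this] show thesis using that by blast
  qed
  define Z where "Z = {\<omega>. ?h l \<omega> = 0}"
  have Z: "finite Z" unfolding Z_def by (rule poly_roots_finite[OF l(1)])
  have "\<exists>\<gamma>. (\<forall>k. ?f k \<omega> = (\<Sum>j\<le>k. ?h j \<omega> * \<gamma> (k - j))) \<and> (\<forall>k. cmod (\<gamma> k) \<le> C * (2 * max 1 (cmod \<omega>) / e) ^ k)"
    if \<omega>: "\<omega> \<notin> Z" for \<omega>
  proof -
    \<comment> \<open>The radius on which t and t \<omega> both have modulus below e. Its decay in
      \<omega> produces the growth bound of order k that later limits the degree.\<close>
    define r where "r = e / max 1 (cmod \<omega>)"
    have m: "max 1 (cmod \<omega>) > 0" by simp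
    have r: "r > 0" using e(1) m by (simp add: r_def)
    have tb: "t \<in> ball 0 e" "t * \<omega> \<in> ball 0 e" if t: "cmod t < r" for t
    proof -
      have tm: "cmod t * max 1 (cmod \<omega>) < e" using t m by (simp only: r_def pos_less_divide_eq)
      have "cmod t * 1 \<le> cmod t * max 1 (cmod \<omega>)" "cmod t * cmod \<omega> \<le> cmod t * max 1 (cmod \<omega>)"
        by (intro mult_left_mono; simp)+
      then have "cmod t < e" "cmod (t * \<omega>) < e" using tm by (simp_all add: norm_mult)
      then show "t \<in> ball 0 e" "t * \<omega> \<in> ball 0 e" by simp_all
    qed
    have D: "t \<in> unit_disk" "t * \<omega> \<in> unit_disk" if "cmod t < r" for t
      using e(2)[OF tb[OF that]] by auto
    have "\<exists>\<gamma>. (\<forall>k. ?f k \<omega> = (\<Sum>j\<le>k. ?h j \<omega> * \<gamma> (k - j))) \<and> (\<forall>k. cmod (\<gamma> k) \<le> C * (2 / r) ^ k)"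
    proof (rule powser_division_bounded[OF r, where m = l])
      show "(\<lambda>k. ?h k \<omega> * t ^ k) sums heval \<theta> t (t * \<omega>)" "(\<lambda>k. ?f k \<omega> * t ^ k) sums heval f t (t * \<omega>)" if "cmod t < r" for t
        by (rule heval_slice(1)[OF D[OF that]])+
      show "?h l \<omega> \<noteq> 0" using \<omega> by (simp add: Z_def)
      show "cmod (heval f t (t * \<omega>)) \<le> C * cmod (heval \<theta> t (t * \<omega>))" if "cmod t < r" for t
        using e(2)[OF tb[OF that]] by blast
    qed
    then show ?thesis by (simp add: r_def)
  qed
  then have "\<forall>\<omega>. \<exists>\<gamma>. \<omega> \<notin> Z \<longrightarrow> (\<forall>k. ?f k \<omega> = (\<Sum>j\<le>k. ?h j \<omega> * \<gamma> (k - j))) \<and> (\<forall>k. cmod (\<gamma> k) \<le> C * (2 * max 1 (cmod \<omega>) / e) ^ k)"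
    by blast
  from choice[OF this] obtain \<gamma> where \<gamma>': "\<forall>\<omega>. \<omega> \<notin> Z \<longrightarrow> (\<forall>k. ?f k \<omega> = (\<Sum>j\<le>k. ?h j \<omega> * \<gamma> \<omega> (k - j))) \<and> (\<forall>k. cmod (\<gamma> \<omega> k) \<le> C * (2 * max 1 (cmod \<omega>) / e) ^ k)" ..
  have \<gamma>: "?f k \<omega> = (\<Sum>j\<le>k. ?h j \<omega> * \<gamma> \<omega> (k - j))" "cmod (\<gamma> \<omega> k) \<le> C * (2 * max 1 (cmod \<omega>) / e) ^ k" if "\<omega> \<notin> Z" for \<omega> k
    using \<gamma>' that by blast+
  \<comment> \<open>Component k + l of the product begins with the lowest component l of \<theta>,
    so it determines \<gamma> at k from its earlier values.\<close>
  have top: "?h l \<omega> * \<gamma> \<omega> k = ?f (k + l) \<omega> - (\<Sum>j<k. ?h (l + (k - j)) \<omega> * \<gamma> \<omega> j)" if "\<omega> \<notin> Z" for \<omega> k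
  proof -
    have "?f (k + l) \<omega> = (\<Sum>i\<le>k + l. ?h (k + l - i) \<omega> * \<gamma> \<omega> i)"
      unfolding \<gamma>(1)[OF that] by (rule sum.reindex_bij_witness[of _ "\<lambda>i. k + l - i" "\<lambda>i. k + l - i"]) auto
    also have "\<dots> = (\<Sum>i\<le>k. ?h (k + l - i) \<omega> * \<gamma> \<omega> i)"
      by (rule sum.mono_neutral_right) (auto simp: l(2))
    also have "\<dots> = ?h l \<omega> * \<gamma> \<omega> k + (\<Sum>j<k. ?h (l + (k - j)) \<omega> * \<gamma> \<omega> j)"
    proof -
      have "(\<Sum>i<k. ?h (k + l - i) \<omega> * \<gamma> \<omega> i) = (\<Sum>j<k. ?h (l + (k - j)) \<omega> * \<gamma> \<omega> j)"
        by (intro sum.cong) (auto simp: add.commute)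
      then show ?thesis by (simp flip: lessThan_Suc_atMost)
    qed
    finally show ?thesis by simp
  qed
  have step: "\<exists>X. degree X \<le> k \<and> (\<forall>\<omega>. \<omega> \<notin> Z \<longrightarrow> \<gamma> \<omega> k = poly X \<omega>)" for k
  proof (induction k rule: less_induct)
    case (less k)
    then have "\<forall>j. \<exists>X. j < k \<longrightarrow> (\<forall>\<omega>. \<omega> \<notin> Z \<longrightarrow> \<gamma> \<omega> j = poly X \<omega>)" by blast
    from choice[OF this] obtain X where X: "\<And>j \<omega>. j < k \<Longrightarrow> \<omega> \<notin> Z \<Longrightarrow> \<gamma> \<omega> j = poly (X j) \<omega>" by blast
    define Y where "Y = hpoly f (k + l) - (\<Sum>j<k. hpoly \<theta> (l + (k - j)) * X j)"
    have Y: "poly Y \<omega> = ?h l \<omega> * \<gamma> \<omega> k" if "\<omega> \<notin> Z" for \<omega>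
      unfolding top[OF that] Y_def by (simp add: poly_sum X that)
    define b where "b \<omega> = C * (2 * max 1 (cmod \<omega>) / e) ^ k" for \<omega>
    have bcont: "continuous_on UNIV b"
      unfolding b_def using e(1) by (intro continuous_intros) auto
    have le: "cmod (poly Y \<omega>) \<le> b \<omega> * cmod (?h l \<omega>)" if "\<omega> \<notin> Z" for \<omega>
      unfolding Y[OF that] norm_mult b_def using mult_right_mono[OF \<gamma>(2)[OF that, of k], of "cmod (?h l \<omega>)"] by (simp add: mult.commute)
    \<comment> \<open>The maximum recasts the inequality as an equation between continuous
      functions, which extends across the finite set Z.\<close>
    have mx: "max 0 (cmod (poly Y \<omega>) - b \<omega> * cmod (?h l \<omega>)) = 0" for \<omega>
    proof (rule eq_off_finite[where S = UNIV and F = Z and g = "\<lambda>_. 0" and f = "\<lambda>\<omega>. max 0 (cmod (poly Y \<omega>) - b \<omega> * cmod (?h l \<omega>))"])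
      show "(UNIV :: complex set) \<noteq> {\<omega>}" by (metis UNIV_I singletonD zero_neq_one)
      show "continuous_on UNIV (\<lambda>\<omega>. max 0 (cmod (poly Y \<omega>) - b \<omega> * cmod (?h l \<omega>)))"
        by (intro continuous_intros bcont)
      show "max 0 (cmod (poly Y y) - b y * cmod (?h l y)) = 0" if "y \<in> UNIV - Z" for y using le[of y] that by simp
    qed (use Z in auto)
    have "cmod (poly Y \<omega>) \<le> b \<omega> * cmod (?h l \<omega>)" for \<omega>
      using mx[of \<omega>] max.cobounded2[of "cmod (poly Y \<omega>) - b \<omega> * cmod (?h l \<omega>)" 0] by linarith
    then have "hpoly \<theta> l dvd Y" by (rule poly_dvd_of_bound[OF l(1) bcont])
    then obtain W where W: "Y = hpoly \<theta> l * W" by blast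
    have WW: "\<gamma> \<omega> k = poly W \<omega>" if "\<omega> \<notin> Z" for \<omega>
      using Y[OF that] that by (simp add: W Z_def)
    have "degree W \<le> k"
    proof (rule degree_le_of_growth[OF _ Z])
      show "cmod (poly W \<omega>) \<le> (C * (2 / e) ^ k) * (max 1 (cmod \<omega>)) ^ k" if "\<omega> \<notin> Z" for \<omega>
        using \<gamma>(2)[OF that, of k] unfolding WW[OF that] by (simp add: power_mult_distrib power_divide mult_ac)
    qed
    then show ?case using WW by blast
  qed
  from choice[OF allI[OF step]] obtain c where c: "\<forall>k. degree (c k) \<le> k \<and> (\<forall>\<omega>. \<omega> \<notin> Z \<longrightarrow> \<gamma> \<omega> k = poly (c k) \<omega>)" ..
  have "hpoly f k = (\<Sum>j\<le>k. hpoly \<theta> j * c (k - j))" for k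
  proof (rule poly_eq_off_finite[OF Z])
    fix \<omega> assume "\<omega> \<notin> Z"
    then show "?f k \<omega> = poly (\<Sum>j\<le>k. hpoly \<theta> j * c (k - j)) \<omega>"
      using \<gamma>(1)[of \<omega> k] c by (simp add: poly_sum)
  qed
  then show ?thesis using c by blast
qed

text \<open>The polynomials c of the quotient describe f / \<theta> on almost every slice, so their
  energy equals that of f. It is finite, and c therefore comes from a Hardy function.\<close>

lemma mem_mult_range: "f \<in> mult_range \<theta>"
proof -
  have "\<exists>l. hpoly \<theta> l \<noteq> 0"
  proof (rule ccontr)
    assume "\<nexists>l. hpoly \<theta> l \<noteq> 0"
    then have "hpoly \<theta> = hpoly 0" by (intro ext) (simp add: hpoly_def)
    then have "\<theta> = 0" by (rule hpoly_inject)
    then show False using fiber_nonzero[of 0] by (auto simp: heval_linear)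
  qed
  define l where "l = (LEAST l. hpoly \<theta> l \<noteq> 0)"
  have l: "hpoly \<theta> l \<noteq> 0" "\<And>j. j < l \<Longrightarrow> hpoly \<theta> j = 0"
    unfolding l_def using LeastI_ex[OF \<open>\<exists>l. hpoly \<theta> l \<noteq> 0\<close>] not_less_Least by blast+
  obtain c where c: "\<And>k. degree (c k) \<le> k" "\<And>k. hpoly f k = (\<Sum>j\<le>k. hpoly \<theta> j * c (k - j))"
    using quotient_components[OF l] by blast
  define Z where "Z = {\<omega>. poly (hpoly \<theta> l) \<omega> = 0}"
  have Z: "finite Z" unfolding Z_def by (rule poly_roots_finite[OF l(1)])
  have G: "\<exists>G. \<forall>t. cmod t < 1 \<longrightarrow> (\<lambda>k. poly (c k) \<omega> * t ^ k) sums G t \<and> heval f t (t * \<omega>) = heval \<theta> t (t * \<omega>) * G t"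
    if \<omega>: "cmod \<omega> = 1" "\<omega> \<notin> Z" for \<omega>
  proof -
    have D: "t \<in> unit_disk" "t * \<omega> \<in> unit_disk" if "cmod t < 1" for t
      using that \<omega> by (auto simp: norm_mult)
    have hl: "poly (hpoly \<theta> l) \<omega> \<noteq> 0" using \<omega>(2) by (simp add: Z_def)
    obtain \<gamma> G where \<gamma>: "\<And>t. cmod t < 1 \<Longrightarrow> (\<lambda>k. \<gamma> k * t ^ k) sums G t \<and> heval f t (t * \<omega>) = heval \<theta> t (t * \<omega>) * G t"
      "\<And>k. poly (hpoly f k) \<omega> = (\<Sum>j\<le>k. poly (hpoly \<theta> j) \<omega> * \<gamma> (k - j))"
      using powser_division[OF zero_less_one heval_slice(1)[OF D] heval_slice(1)[OF D] hl slice_bound[OF D]] by blast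
    \<comment> \<open>Both sequences solve the same triangular recursion, whose leading coefficient
      is nonzero off Z.\<close>
    have "\<gamma> k = poly (c k) \<omega>" for k
    proof (induction k rule: less_induct)
      case (less k)
      have split: "(\<Sum>j\<le>k + l. poly (hpoly \<theta> j) \<omega> * y (k + l - j)) = poly (hpoly \<theta> l) \<omega> * y k + (\<Sum>i<k. poly (hpoly \<theta> (k + l - i)) \<omega> * y i)" for y :: "nat \<Rightarrow> complex"
      proof -
        have "(\<Sum>j\<le>k + l. poly (hpoly \<theta> j) \<omega> * y (k + l - j)) = (\<Sum>i\<le>k + l. poly (hpoly \<theta> (k + l - i)) \<omega> * y i)"
          by (rule sum.reindex_bij_witness[of _ "\<lambda>i. k + l - i" "\<lambda>i. k + l - i"]) auto
        also have "\<dots> = (\<Sum>i\<le>k. poly (hpoly \<theta> (k + l - i)) \<omega> * y i)"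
          by (rule sum.mono_neutral_right) (auto simp: l(2))
        finally show ?thesis by (simp flip: lessThan_Suc_atMost)
      qed
      have "(\<Sum>j\<le>k + l. poly (hpoly \<theta> j) \<omega> * \<gamma> (k + l - j)) = (\<Sum>j\<le>k + l. poly (hpoly \<theta> j) \<omega> * poly (c (k + l - j)) \<omega>)"
        using \<gamma>(2)[of "k + l"] c(2)[of "k + l"] by (simp add: poly_sum)
      moreover have "(\<Sum>i<k. poly (hpoly \<theta> (k + l - i)) \<omega> * \<gamma> i) = (\<Sum>i<k. poly (hpoly \<theta> (k + l - i)) \<omega> * poly (c i) \<omega>)"
        using less by (intro sum.cong) auto
      ultimately have "poly (hpoly \<theta> l) \<omega> * \<gamma> k = poly (hpoly \<theta> l) \<omega> * poly (c k) \<omega>"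
        unfolding split[of \<gamma>] split[of "\<lambda>i. poly (c i) \<omega>"] by simp
      then show ?case using hl by simp
    qed
    then show ?thesis using \<gamma>(1) by auto
  qed
  define Q where "Q \<omega> = (SOME G. \<forall>t. cmod t < 1 \<longrightarrow> (\<lambda>k. poly (c k) \<omega> * t ^ k) sums G t \<and> heval f t (t * \<omega>) = heval \<theta> t (t * \<omega>) * G t)" for \<omega>
  have Q: "(\<lambda>k. poly (c k) \<omega> * t ^ k) sums Q \<omega> t" "heval f t (t * \<omega>) = heval \<theta> t (t * \<omega>) * Q \<omega> t"
    if "cmod \<omega> = 1" "\<omega> \<notin> Z" "cmod t < 1" for \<omega> t
    using someI_ex[OF G[OF that(1,2)]] that(3) unfolding Q_def by blast+
  have "slice_energy (hpoly f) = slice_energy c"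
  proof (rule slice_energy_transfer[OF Z, where X = Q])
    fix \<omega> t :: complex assume \<omega>: "cmod \<omega> = 1" "\<omega> \<notin> Z" "cmod t < 1"
    show "(\<lambda>k. poly (c k) \<omega> * t ^ k) sums Q \<omega> t" by (rule Q(1)[OF \<omega>])
    show "(\<lambda>k. poly (hpoly f k) \<omega> * t ^ k) sums (heval \<theta> t (t * \<omega>) * Q \<omega> t)"
      unfolding Q(2)[OF \<omega>, symmetric] by (rule heval_slice(1)) (use \<omega> in \<open>auto simp: norm_mult\<close>)
  qed
  then have "slice_energy c < top" by (simp add: slice_energy_hpoly flip: \<open>slice_energy (hpoly f) = slice_energy c\<close>)
  then obtain g where g: "hpoly g = c" using hardy2_of_slices[OF c(1)] by blast
  have "f = theta_mult g"
    by (rule hpoly_inject) (simp add: fun_eq_iff hpoly_theta_mult c(2) g)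
  then show ?thesis by (simp add: mult_range_eq)
qed

end

lemma eigenvectors_total:
  assumes "f \<in> K" "\<And>c v. c \<in> \<Omega> \<Longrightarrow> v \<in> N c \<Longrightarrow> cinner f v = 0"
  shows "f = 0"
proof -
  have "f \<in> mult_range \<theta>" by (rule mem_mult_range) (rule assms(2))
  then have "cinner f f = 0" using assms(1) K_theta_mult by (auto simp: mult_range_eq)
  then show ?thesis by (simp add: cinner_self)
qed

end

section \<open>Factors depending only on the first variable\<close>

lemma heval_szego_z:
  assumes c: "c \<in> unit_disk" and zw: "z \<in> unit_disk" "w \<in> unit_disk"
  shows "heval (szego c 0) z w * (1 - cnj c * z) = 1"
proof -
  have "szego c 0 - cnj c *\<^sub>C mult_z (szego c 0) = monomial_zw (0, 0)"
  proof (rule hardy2_eqI)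
    fix m n
    show "hcoeff (szego c 0 - cnj c *\<^sub>C mult_z (szego c 0)) (m, n) = hcoeff (monomial_zw (0, 0)) (m, n)"
      using c by (cases m) (auto simp: hcoeff_szego monomial_zw.rep_eq power_0_left)
  qed
  moreover have "heval (monomial_zw (0, 0)) z w = 1"
    unfolding heval_eq_cinner[OF zw] by (subst cinner_commute) (simp add: cinner_monomial hcoeff_szego[OF zw])
  ultimately have "heval (szego c 0 - cnj c *\<^sub>C mult_z (szego c 0)) z w = 1" by simp
  then show ?thesis by (simp add: heval_linear[OF zw] heval_mult_z algebra_simps)
qed

definition blaschke_z :: "complex \<Rightarrow> hardy2" where "blaschke_z c = Az c (szego c 0)"

lemma one_minus_cnj_mult_nz:
  assumes "cmod c < 1" "cmod z \<le> 1"
  shows "1 - cnj c * z \<noteq> 0"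
proof
  assume "1 - cnj c * z = 0"
  then have "cmod (cnj c * z) = 1" by (metis eq_iff_diff_eq_0 norm_one)
  moreover have "cmod (cnj c * z) \<le> cmod c * 1" unfolding norm_mult by (intro mult_mono) (use assms in auto)
  ultimately show False using assms(1) by simp
qed

lemma heval_blaschke_z:
  assumes c: "c \<in> unit_disk" and zw: "z \<in> unit_disk" "w \<in> unit_disk"
  shows "heval (blaschke_z c) z w = (z - c) / (1 - cnj c * z)"
proof -
  have "1 - cnj c * z \<noteq> 0" using one_minus_cnj_mult_nz[of c z] c zw by simp
  then have "heval (szego c 0) z w = 1 / (1 - cnj c * z)" using heval_szego_z[OF c zw] by (simp add: field_simps)
  then show ?thesis by (simp add: blaschke_z_def heval_Az[OF zw])
qed

lemma radial_limit_blaschke_z: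
  assumes c: "c \<in> unit_disk"
  shows "\<exists>b. ((\<lambda>r. heval (blaschke_z c) (complex_of_real r * cis s) (complex_of_real r * cis t)) \<longlongrightarrow> b) (at_left 1) \<and> cmod b = 1"
proof -
  let ?u = "cis s"
  have nz: "1 - cnj c * ?u \<noteq> 0" using one_minus_cnj_mult_nz[of c ?u] c by simp
  have lim1: "((\<lambda>r. (complex_of_real r * ?u - c) / (1 - cnj c * (complex_of_real r * ?u))) \<longlongrightarrow>
      (complex_of_real 1 * ?u - c) / (1 - cnj c * (complex_of_real 1 * ?u))) (at_left 1)"
    by (intro tendsto_intros) (use nz in simp)
  have "\<forall>\<^sub>F r in at_left (1::real). r \<in> {0<..<1}" by (rule eventually_at_left_real) simp
  then have "\<forall>\<^sub>F r in at_left 1. (complex_of_real r * ?u - c) / (1 - cnj c * (complex_of_real r * ?u))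
      = heval (blaschke_z c) (complex_of_real r * ?u) (complex_of_real r * cis t)"
    by eventually_elim (rule heval_blaschke_z[OF c, symmetric]; simp add: norm_mult)
  from Lim_transform_eventually[OF lim1 this] have lim: "((\<lambda>r. heval (blaschke_z c) (complex_of_real r * ?u) (complex_of_real r * cis t)) \<longlongrightarrow> (?u - c) / (1 - cnj c * ?u)) (at_left 1)"
    by simp
  have uu: "?u * cnj ?u = 1" unfolding cnj_mult_self by simp
  \<comment> \<open>On the circle the conjugate of u is its inverse, so numerator and denominator
    have equal modulus.\<close>
  have "1 - cnj c * ?u = ?u * cnj (?u - c)" using uu by (simp add: right_diff_distrib mult.commute)
  then have "cmod (1 - cnj c * ?u) = cmod (?u - c)" by (simp only: norm_mult complex_mod_cnj norm_cis mult_1)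
  moreover have "cmod (1 - cnj c * ?u) \<noteq> 0" using nz by simp
  ultimately have "cmod ((?u - c) / (1 - cnj c * ?u)) = 1" by (simp add: norm_divide)
  with lim show ?thesis by blast
qed

text \<open>From \<theta> = (z - c) k, the Blaschke factor of c divides \<theta> with quotient (1 -
  cnj c z) k. This quotient is inner because its radial limits are quotients of unimodular
  ones.\<close>

lemma z_factor_of_zero_fiber:
  assumes \<theta>: "inner_fun \<theta>" and c: "c \<in> unit_disk" and zero: "\<And>w. w \<in> unit_disk \<Longrightarrow> heval \<theta> c w = 0"
  shows "\<exists>\<phi>. inner_factor \<phi> \<theta> \<and> only_z \<phi> \<and> \<not> constant_fun \<phi>"
proof (intro exI[of _ "blaschke_z c"] conjI)
  obtain k where k: "\<theta> = Az c k" using vanish_imp_Az[OF c zero] by blast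
  define \<psi> where "\<psi> = k - cnj c *\<^sub>C mult_z k"
  have factor: "heval \<theta> z w = heval (blaschke_z c) z w * heval \<psi> z w" if zw: "z \<in> unit_disk" "w \<in> unit_disk" for z w
  proof -
    have "1 - cnj c * z \<noteq> 0" using one_minus_cnj_mult_nz[of c z] c zw by simp
    moreover have "heval \<psi> z w = (1 - cnj c * z) * heval k z w"
      by (simp add: \<psi>_def heval_linear[OF zw] heval_mult_z left_diff_distrib)
    ultimately show ?thesis by (simp add: k heval_Az[OF zw] heval_blaschke_z[OF c zw])
  qed
  have "inner_fun (blaschke_z c)"
    unfolding inner_fun_def using radial_limit_blaschke_z[OF c] by (intro AE_I2) auto
  moreover have "inner_fun \<psi>"
    using \<theta> unfolding inner_fun_def
  proof (elim AE_mp, intro AE_I2, clarify)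
    fix s t
    assume H: "s \<in> {0..2*pi} \<and> t \<in> {0..2*pi} \<longrightarrow> (\<exists>b. ((\<lambda>r. heval \<theta> (complex_of_real r * cis s) (complex_of_real r * cis t)) \<longlongrightarrow> b) (at_left 1) \<and> cmod b = 1)"
      and st: "s \<in> {0..2*pi}" "t \<in> {0..2*pi}"
    let ?h = "\<lambda>f r. heval f (complex_of_real r * cis s) (complex_of_real r * cis t)"
    obtain b where b: "(?h \<theta> \<longlongrightarrow> b) (at_left 1)" "cmod b = 1" using H st by blast
    obtain \<beta> where \<beta>: "(?h (blaschke_z c) \<longlongrightarrow> \<beta>) (at_left 1)" "cmod \<beta> = 1" using radial_limit_blaschke_z[OF c] by blast
    have \<beta>0: "\<beta> \<noteq> 0" using \<beta>(2) by auto
    have lim: "((\<lambda>r. ?h \<theta> r / ?h (blaschke_z c) r) \<longlongrightarrow> b / \<beta>) (at_left 1)"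
      by (rule tendsto_divide[OF b(1) \<beta>(1) \<beta>0])
    have "\<forall>\<^sub>F r in at_left (1::real). r \<in> {0<..<1}" by (rule eventually_at_left_real) simp
    moreover have "\<forall>\<^sub>F r in at_left 1. ?h (blaschke_z c) r \<noteq> 0" by (rule tendsto_imp_eventually_ne[OF \<beta>(1) \<beta>0])
    ultimately have "\<forall>\<^sub>F r in at_left 1. ?h \<theta> r / ?h (blaschke_z c) r = ?h \<psi> r"
    proof eventually_elim
      case (elim r)
      have "complex_of_real r * cis s \<in> unit_disk" "complex_of_real r * cis t \<in> unit_disk"
        using elim(1) by (simp_all add: norm_mult)
      from factor[OF this] elim(2) show ?case by simp
    qed
    then have "(?h \<psi> \<longlongrightarrow> b / \<beta>) (at_left 1)" by (rule Lim_transform_eventually[OF lim])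
    moreover have "cmod (b / \<beta>) = 1" using b(2) \<beta>(2) by (simp add: norm_divide)
    ultimately show "\<exists>b. (?h \<psi> \<longlongrightarrow> b) (at_left 1) \<and> cmod b = 1" by blast
  qed
  ultimately show "inner_factor (blaschke_z c) \<theta>" unfolding inner_factor_def using factor by blast
  show "only_z (blaschke_z c)" unfolding only_z_def by (simp add: heval_blaschke_z[OF c] del: mem_ball)
  show "\<not> constant_fun (blaschke_z c)"
  proof
    assume "constant_fun (blaschke_z c)"
    then obtain a where a: "\<And>z w. z \<in> unit_disk \<Longrightarrow> w \<in> unit_disk \<Longrightarrow> heval (blaschke_z c) z w = a"
      unfolding constant_fun_def by blast
    have "a = 0" using a[OF c c] heval_blaschke_z[OF c c c] by simp
    obtain z where z: "z \<in> unit_disk" "z \<noteq> c" using connected_disk(2)[of c] c by blast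
    then have "(z - c) / (1 - cnj c * z) = 0" using a[OF z(1) c] heval_blaschke_z[OF c z(1) c] \<open>a = 0\<close> by simp
    then show False using z one_minus_cnj_mult_nz[of c z] c by auto
  qed
qed

section \<open>Membership in the Cowen--Douglas class\<close>

lemma reduced_rational_rep_exists:
  assumes "rational_inner \<theta>" "\<not> (\<exists>\<phi>. inner_factor \<phi> \<theta> \<and> only_z \<phi> \<and> \<not> constant_fun \<phi>)"
  shows "\<exists>p q. reduced_rational_rep \<theta> p q"
proof -
  obtain p q where pq: "rational_rep \<theta> p q" "\<And>\<tau>. cmod \<tau> = 1 \<Longrightarrow> \<exists>z. poly2 p z \<tau> \<noteq> 0"
    using rational_rep_exists[OF assms(1)] rational_rep_reduced by metis
  have "inner_fun \<theta>" using assms(1) by (simp add: rational_inner_def)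
  then have "\<exists>w\<in>unit_disk. heval \<theta> c w \<noteq> 0" if "c \<in> unit_disk" for c
    using z_factor_of_zero_fiber[OF _ that] assms(2) by blast
  then have "reduced_rational_rep \<theta> p q"
    using pq by (simp add: reduced_rational_rep_def reduced_rational_rep_axioms_def del: mem_ball)
  then show ?thesis by blast
qed

text \<open>The orthogonal projection is a contraction, hence continuous, and maps the separable
  space onto K.\<close>

lemma separable_closed_csubspace:
  fixes K :: "'a :: {complex_inner, banach} set"
  assumes K: "csubspace K" "closed K" and sep: "separable_space (euclidean :: 'a topology)"
  shows "separable_space (top_of_set K)"
proof (rule separable_space_continuous_map_image[OF sep])
  let ?P = "orthogonal_projection K"
  have le: "norm (?P x - ?P y) \<le> norm (x - y)" for x y
  proof -
    let ?d = "?P x - ?P y" and ?o = "(x - ?P x) - (y - ?P y)"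
    have "?d \<in> K" by (intro csubspace_closed_ops(3)[OF K(1)] orthogonal_projection_props(1)[OF K])
    moreover have "?o \<in> orthogonal_complement K"
      by (intro csubspace_closed_ops(3)[OF csubspace_orthogonal_complement] orthogonal_projection_props(2)[OF K])
    ultimately have o: "cinner ?o ?d = 0" by (simp add: orthogonal_complement_def)
    have "cinner ?d (- ?o) = 0"
      by (subst cinner_commute) (simp only: cinner_minus_left o minus_zero complex_cnj_zero)
    then have "norm ?d \<le> norm (?d - - ?o)" by (rule norm_le_norm_diff_of_orthogonal)
    then show ?thesis by (simp add: algebra_simps)
  qed
  have "continuous_on UNIV ?P"
    unfolding continuous_on_iff dist_norm using le by (meson le_less_trans)
  then show "continuous_map euclidean (top_of_set K) ?P"
    using orthogonal_projection_props(1)[OF K] by (simp add: continuous_map_in_subtopology image_subset_iff)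
  have "?P x = x" if "x \<in> K" for x
    by (rule orthogonal_projection_unique[OF K that]) (simp add: csubspace_closed_ops(1)[OF csubspace_orthogonal_complement])
  then show "?P ` topspace euclidean = topspace (top_of_set K)"
    using orthogonal_projection_props(1)[OF K] by (auto simp: image_iff) (metis)
qed

context reduced_rational_rep
begin

abbreviation "A \<equiv> adjoint_on K (compressed_shift \<theta>)"

lemma shifted_adjoint: "x \<in> K \<Longrightarrow> shifted_op A (cnj c) x = T' c x"
  by (simp add: shifted_op_def adjoint_compressed_shift)

lemma kernel_adjoint: "kernel_on K (shifted_op A (cnj c)) = N c"
  using shifted_adjoint by (auto simp: kernel_on_def)

lemma zero_number_constant:
  assumes "connected C" "C \<subseteq> \<Omega>" "c \<in> C" "d \<in> C"
  shows "zero_number c = zero_number d"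
proof -
  have "zero_number constant_on C"
  proof (rule locally_constant_imp_constant[OF assms(1)])
    fix a assume a: "a \<in> C"
    then have aO: "a \<in> \<Omega>" using assms(2) by blast
    then have aD: "a \<in> unit_disk" using \<Omega>_subset_disk by blast
    obtain e where e: "e > 0" "\<forall>\<mu>\<in>ball a e. \<mu> \<in> \<Omega> \<and> zero_number \<mu> = zero_number a"
      using \<Omega>_locally_constant(3)[OF open_ball zero_number(2) injective_T[OF aD] aO aD] by blast
    show "\<exists>T. openin (top_of_set C) T \<and> a \<in> T \<and> (\<forall>x\<in>T. zero_number x = zero_number a)"
    proof (intro exI[of _ "C \<inter> ball a e"] conjI ballI)
      show "openin (top_of_set C) (C \<inter> ball a e)" by (rule openin_open_Int) simp
      show "a \<in> C \<inter> ball a e" using a e(1) by simp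
      show "zero_number x = zero_number a" if "x \<in> C \<inter> ball a e" for x using e(2) that by blast
    qed
  qed
  then show ?thesis using assms(3,4) by (auto simp: constant_on_def)
qed

lemma cowen_douglas_adjoint:
  "\<exists>\<alpha> :: complex set \<Rightarrow> nat.
     (\<forall>C\<in>components \<Omega>. \<forall>z\<in>C. has_zero_count (heval \<theta> z) unit_disk (\<alpha> (cnj ` C))) \<and>
     A \<in> cowen_douglas K \<alpha> (cnj ` \<Omega>)"
\<comment> \<open>A component of the conjugate of \<Omega> receives the zero number over an
  arbitrary one of its points; \<open>const\<close> shows that the choice does not matter.\<close>
proof (intro exI[of _ "\<lambda>C. zero_number (cnj (SOME w. w \<in> C))"] conjI ballI)
  have inD: "c \<in> unit_disk" if "c \<in> \<Omega>" for c using \<Omega>_subset_disk that by blast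
  have loc: "zero_number c > 0" "T' c ` K = K" "\<exists>e>0. \<forall>\<mu>\<in>ball c e. \<mu> \<in> \<Omega> \<and> zero_number \<mu> = zero_number c"
    if "c \<in> \<Omega>" for c
    by (rule \<Omega>_locally_constant[OF open_ball zero_number(2) injective_T[OF inD[OF that]] that inD[OF that]]; assumption)+
  have const: "zero_number (cnj (SOME w. w \<in> C)) = zero_number (cnj w) \<and> cnj w \<in> \<Omega>"
    if C: "connected C" "C \<subseteq> cnj ` \<Omega>" and w: "w \<in> C" for C w
  proof -
    have "(SOME w. w \<in> C) \<in> C" using w by (rule someI)
    moreover have "connected (cnj ` C)" by (rule connected_continuous_image[OF _ C(1)]) (intro continuous_intros)
    moreover have "cnj ` C \<subseteq> \<Omega>" using C(2) by auto
    ultimately show ?thesis using zero_number_constant[of "cnj ` C" "cnj (SOME w. w \<in> C)" "cnj w"] w by auto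
  qed
  {
    fix C z assume C: "C \<in> components \<Omega>" and z: "z \<in> C"
    have sub: "C \<subseteq> \<Omega>" "connected C" using C by (auto simp: in_components_subset in_components_connected)
    have "connected (cnj ` C)" by (rule connected_continuous_image[OF _ sub(2)]) (intro continuous_intros)
    then have "zero_number (cnj (SOME w. w \<in> cnj ` C)) = zero_number (cnj (cnj z))"
      using const[of "cnj ` C" "cnj z"] sub(1) z by blast
    then show "has_zero_count (heval \<theta> z) unit_disk (zero_number (cnj (SOME w. w \<in> cnj ` C)))"
      using zero_number(1)[of z] inD sub(1) z by auto
  }
  have openO: "open \<Omega>" unfolding open_contains_ball using loc(3) by (meson subsetI)
  show "A \<in> cowen_douglas K (\<lambda>C. zero_number (cnj (SOME w. w \<in> C))) (cnj ` \<Omega>)"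
    unfolding cowen_douglas_def mem_Collect_eq
  proof (intro conjI ballI)
    show "hilbert_on K" by (simp add: hilbert_on_def csubspace_K closed_K complete_eq_closed)
    show "separable_space (top_of_set K)"
      by (rule separable_closed_csubspace[OF csubspace_K closed_K separable_hardy2])
    have "cnj ` X = cnj -` X" for X
    proof
      show "cnj -` X \<subseteq> cnj ` X"
      proof
        fix x assume "x \<in> cnj -` X"
        then show "x \<in> cnj ` X" using imageI[of "cnj x" X cnj] by simp
      qed
    qed auto
    moreover have "open (cnj -` \<Omega>)" by (rule open_vimage[OF openO]) (intro continuous_intros)
    ultimately show "open (cnj ` \<Omega>)" by simp
    have "cnj ` \<Omega> \<subseteq> unit_disk" using inD by auto
    then show "bounded (cnj ` \<Omega>)" using bounded_subset[OF bounded_ball] by blast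
    show "0 < zero_number (cnj (SOME w. w \<in> C))" if C: "C \<in> components (cnj ` \<Omega>)" for C
    proof -
      obtain w where w: "w \<in> C" using in_components_nonempty[OF C] by blast
      show ?thesis using const[OF in_components_connected[OF C] in_components_subset[OF C] w] loc(1) by auto
    qed
    show "bounded_op_on K A"
      using bounded_S' adjoint_compressed_shift csubspace_closed_ops[OF csubspace_K] by (simp add: bounded_op_on_def)
    show "shifted_op A w ` K = K" if w: "w \<in> cnj ` \<Omega>" for w
    proof -
      obtain c where c: "c \<in> \<Omega>" "w = cnj c" using w by blast
      have "shifted_op A (cnj c) ` K = T' c ` K" using shifted_adjoint by (intro image_cong) auto
      then show ?thesis using loc(2)[OF c(1)] c(2) by simp
    qed
    show "cdim (kernel_on K (shifted_op A w)) = zero_number (cnj (SOME w. w \<in> C))"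
      if C: "C \<in> components (cnj ` \<Omega>)" and w: "w \<in> C" for C w
    proof -
      note k = const[OF in_components_connected[OF C] in_components_subset[OF C] w]
      have "kernel_on K (shifted_op A w) = N (cnj w)" using kernel_adjoint[of "cnj w"] by simp
      moreover have "cnj w \<in> unit_disk" using inD k by blast
      ultimately show ?thesis using has_cdim_cdim[OF zero_number(2)[of "cnj w"]] k by simp
    qed
    define U where "U = (\<Union>w\<in>cnj ` \<Omega>. kernel_on K (shifted_op A w))"
    have U: "U = (\<Union>c\<in>\<Omega>. N c)" unfolding U_def using kernel_adjoint by auto
    have UK: "closure (cspan U) \<subseteq> K"
    proof (rule closure_minimal[OF _ closed_K])
      have "U \<subseteq> K" unfolding U by (auto simp: kernel_on_def)
      then show "cspan U \<subseteq> K" using csubspace_K by (rule complex_vector.span_minimal)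
    qed
    have csub: "csubspace (closure (cspan U))"
      by (rule csubspace_closure) (rule complex_vector.subspace_span)
    have "K \<subseteq> closure (cspan U)"
    proof
      fix x assume x: "x \<in> K"
      obtain y where y: "y \<in> closure (cspan U)" "x - y \<in> orthogonal_complement (closure (cspan U))"
        using projection_exists[OF csub closed_closure] by blast
      \<comment> \<open>The residue of x after projection to the closed span is orthogonal to every
        eigenvector and still lies in K.\<close>
      have "x - y = 0"
      proof (rule eigenvectors_total)
        show "x - y \<in> K" using x y(1) UK csubspace_closed_ops(3)[OF csubspace_K] by blast
        fix c v assume "c \<in> \<Omega>" "v \<in> N c"
        then have "v \<in> U" unfolding U by blast
        then have "v \<in> closure (cspan U)" using complex_vector.span_base closure_subset by blast
        then show "cinner (x - y) v = 0" using y(2) by (simp add: orthogonal_complement_def)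
      qed
      then show "x \<in> closure (cspan U)" using y(1) by simp
    qed
    then show "closure (cspan (\<Union>w\<in>cnj ` \<Omega>. kernel_on K (shifted_op A w))) = K"
      using UK unfolding U_def by blast
  qed
qed

end

theorem theorem4p8:
  fixes \<theta> :: hardy2 and \<Omega> :: "complex set"
  assumes "rational_inner \<theta>"
    and "\<not> (\<exists>\<phi>. inner_factor \<phi> \<theta> \<and> only_z \<phi> \<and> \<not> constant_fun \<phi>)"
    and "\<Omega> = spectrum_on (model_space \<theta>) (compressed_shift \<theta>)
             - essential_spectrum_on (model_space \<theta>) (compressed_shift \<theta>)"
  shows "\<exists>\<alpha> :: complex set \<Rightarrow> nat.
           (\<forall>C\<in>components \<Omega>. \<forall>z\<in>C. has_zero_count (heval \<theta> z) unit_disk (\<alpha> (cnj ` C))) \<and>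
           adjoint_on (model_space \<theta>) (compressed_shift \<theta>)
             \<in> cowen_douglas (model_space \<theta>) \<alpha> (cnj ` \<Omega>)"
proof -
  obtain p q where "reduced_rational_rep \<theta> p q"
    using reduced_rational_rep_exists[OF assms(1,2)] by blast
  then show ?thesis unfolding assms(3) by (rule reduced_rational_rep.cowen_douglas_adjoint)
qed

end
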